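(* Let $d\ge2$, $0<\alpha<d$, $q>\frac{2d}{d+\alpha}$. For every $V\in L^{q'}(\mathbb{R}^d)+\mathring{H}^{\alpha/2}(\mathbb{R}^d)$ the functional $\mathcal{E}$ admits a unique minimizer $\rho_V^+$ on $\mathcal{H}^+_\alpha:=\{f\in\mathcal{H}_\alpha: f\ge0\}$. Moreover $$\int_{\mathbb{R}^d}(\rho_V^+)^{q-1}\varphi\,dx-\langle\varphi,V\rangle+\langle\rho_V^+,\varphi\rangle_{\mathring{H}^{-\alpha/2}(\mathbb{R}^d)}\ge0\quad\text{for all }\varphi\in\mathcal{H}^+_\alpha,$$ and $$\rho^+_V=\big[V-(-\Delta)^{-\alpha/2}\rho^+_V\big]_+^{\frac{1}{q-1}}\quad\text{in }\mathcal{D}'(\mathbb{R}^d).$$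
   Context: $q'=q/(q-1)$, $[x]_+=\max\{x,0\}$. Fourier transform $\hat u(\xi)=\int e^{-2\pi ix\cdot\xi}u(x)dx$. $\mathring{H}^{\alpha/2}(\mathbb{R}^d)$: completion of $C_c^\infty$ under $\int(2\pi|\xi|)^\alpha|\hat u|^2d\xi$. $\mathring{H}^{-\alpha/2}(\mathbb{R}^d)$: tempered distributions $\rho$ with $\hat\rho\in L^1_{loc}$ and $\|\rho\|^2_{\mathring{H}^{-\alpha/2}}=\int(2\pi|\xi|)^{-\alpha}|\hat\rho|^2d\xi<\infty$, identified with the dual of $\mathring{H}^{\alpha/2}$. For $T\in\mathring{H}^{-\alpha/2}$, $(-\Delta)^{-\alpha/2}T$ is the unique $U\in\mathring{H}^{\alpha/2}$ with $\langle T,\varphi\rangle=\langle U,\varphi\rangle_{\mathring{H}^{\alpha/2}}$ for all $\varphi\in\mathring{H}^{\alpha/2}$. $\mathcal{H}_\alpha=L^q\cap\mathring{H}^{-\alpha/2}$. For $V=V_1+V_2$, $V_1\in\mathring{H}^{\alpha/2}$, $V_2\in L^{q'}$: $\langle\rho,V\rangle=\langle\rho,V_1\rangle+\int\rho V_2$. $\mathcal{E}(\rho)=\frac1q\int|\rho|^q-\langle\rho,V\rangle+\frac12\|\rho\|^2_{\mathring{H}^{-\alpha/2}}$. *)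

theory Defs
  imports "HOL-Analysis.Analysis"
begin

text \<open>C-infinity: differentiable everywhere, and every directional derivative is again
  C-infinity (greatest fixed point, i.e. derivatives of all orders exist).\<close>
coinductive smooth_fun :: "(real^'n \<Rightarrow> real) \<Rightarrow> bool" where
  "(\<forall>x. f differentiable (at x)) \<Longrightarrow>
   (\<forall>v. smooth_fun (\<lambda>x. frechet_derivative f (at x) v)) \<Longrightarrow> smooth_fun f"

definition test_fun :: "(real^'n \<Rightarrow> real) \<Rightarrow> bool" where
  "test_fun f \<longleftrightarrow> smooth_fun f \<and> bounded {x. f x \<noteq> 0}"

definition fourier :: "(real^'n \<Rightarrow> real) \<Rightarrow> real^'n \<Rightarrow> complex" where
  "fourier u \<xi> = (\<integral>x. cis (- 2 * pi * (x \<bullet> \<xi>)) * complex_of_real (u x) \<partial>lborel)"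

definition Lp :: "real \<Rightarrow> (real^'n \<Rightarrow> real) set" where
  "Lp p = {f. f \<in> borel_measurable lborel \<and> integrable lborel (\<lambda>x. \<bar>f x\<bar> powr p)}"

definition loc_integrable :: "(real^'n \<Rightarrow> real) \<Rightarrow> bool" where
  "loc_integrable f \<longleftrightarrow> f \<in> borel_measurable lborel \<and>
     (\<forall>K. compact K \<longrightarrow> set_integrable lborel K f)"

definition loc_integrable_c :: "(real^'n \<Rightarrow> complex) \<Rightarrow> bool" where
  "loc_integrable_c g \<longleftrightarrow> g \<in> borel_measurable lborel \<and>
     (\<forall>K. compact K \<longrightarrow> set_integrable lborel K g)"

definition hdot_inner :: "real \<Rightarrow> (real^'n \<Rightarrow> real) \<Rightarrow> (real^'n \<Rightarrow> real) \<Rightarrow> real" where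
  "hdot_inner \<alpha> u w = Re (\<integral>\<xi>. complex_of_real ((2 * pi * norm \<xi>) powr \<alpha>)
        * fourier u \<xi> * cnj (fourier w \<xi>) \<partial>lborel)"

definition hdot_norm2 :: "real \<Rightarrow> (real^'n \<Rightarrow> real) \<Rightarrow> real" where
  "hdot_norm2 \<alpha> u = (\<integral>\<xi>. (2 * pi * norm \<xi>) powr \<alpha> * (cmod (fourier u \<xi>))\<^sup>2 \<partial>lborel)"

text \<open>psi is a sequence of test functions, Cauchy for the H^{alpha/2} norm, whose limit
  (realised as a function, via the Sobolev embedding valid for 0 < alpha < d) is U;
  the realisation is fixed as the L^1_loc limit.\<close>
definition hdot_approx :: "real \<Rightarrow> (nat \<Rightarrow> real^'n \<Rightarrow> real) \<Rightarrow> (real^'n \<Rightarrow> real) \<Rightarrow> bool" where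
  "hdot_approx \<alpha> \<psi> U \<longleftrightarrow> (\<forall>k. test_fun (\<psi> k)) \<and>
     (\<forall>\<epsilon>>0. \<exists>N. \<forall>m\<ge>N. \<forall>n\<ge>N. hdot_norm2 \<alpha> (\<lambda>x. \<psi> m x - \<psi> n x) < \<epsilon>) \<and>
     loc_integrable U \<and>
     (\<forall>K. compact K \<longrightarrow>
        (\<lambda>k. \<integral>x. indicator K x * \<bar>\<psi> k x - U x\<bar> \<partial>lborel) \<longlonglongrightarrow> 0)"

definition Hdot :: "real \<Rightarrow> (real^'n \<Rightarrow> real) set" where
  "Hdot \<alpha> = {U. \<exists>\<psi>. hdot_approx \<alpha> \<psi> U}"

definition is_fourier_of :: "(real^'n \<Rightarrow> real) \<Rightarrow> (real^'n \<Rightarrow> complex) \<Rightarrow> bool" where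
  "is_fourier_of \<rho> g \<longleftrightarrow> loc_integrable_c g \<and>
     (\<forall>\<phi>. test_fun \<phi> \<longrightarrow>
        (\<integral>x. complex_of_real (\<rho> x) * fourier \<phi> x \<partial>lborel)
          = (\<integral>\<xi>. g \<xi> * complex_of_real (\<phi> \<xi>) \<partial>lborel))"

definition fourier_d :: "(real^'n \<Rightarrow> real) \<Rightarrow> real^'n \<Rightarrow> complex" where
  "fourier_d \<rho> = (SOME g. is_fourier_of \<rho> g)"

definition Hneg :: "real \<Rightarrow> (real^'n \<Rightarrow> real) set" where
  "Hneg \<alpha> = {\<rho>. (\<exists>g. is_fourier_of \<rho> g) \<and>
     integrable lborel (\<lambda>\<xi>. (2 * pi * norm \<xi>) powr (- \<alpha>) * (cmod (fourier_d \<rho> \<xi>))\<^sup>2)}"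

definition hneg_norm2 :: "real \<Rightarrow> (real^'n \<Rightarrow> real) \<Rightarrow> real" where
  "hneg_norm2 \<alpha> \<rho> = (\<integral>\<xi>. (2 * pi * norm \<xi>) powr (- \<alpha>) * (cmod (fourier_d \<rho> \<xi>))\<^sup>2 \<partial>lborel)"

definition hneg_inner :: "real \<Rightarrow> (real^'n \<Rightarrow> real) \<Rightarrow> (real^'n \<Rightarrow> real) \<Rightarrow> real" where
  "hneg_inner \<alpha> \<rho> \<sigma> = Re (\<integral>\<xi>. complex_of_real ((2 * pi * norm \<xi>) powr (- \<alpha>))
        * fourier_d \<rho> \<xi> * cnj (fourier_d \<sigma> \<xi>) \<partial>lborel)"

definition H_alpha :: "real \<Rightarrow> real \<Rightarrow> (real^'n \<Rightarrow> real) set" where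
  "H_alpha q \<alpha> = Lp q \<inter> Hneg \<alpha>"

definition H_alpha_pos :: "real \<Rightarrow> real \<Rightarrow> (real^'n \<Rightarrow> real) set" where
  "H_alpha_pos q \<alpha> = {f \<in> H_alpha q \<alpha>. AE x in lborel. f x \<ge> 0}"

definition pair_hdot :: "real \<Rightarrow> (real^'n \<Rightarrow> real) \<Rightarrow> (real^'n \<Rightarrow> real) \<Rightarrow> real" where
  "pair_hdot \<alpha> \<rho> V1 = lim (\<lambda>k. \<integral>x. \<rho> x * (SOME \<psi>. hdot_approx \<alpha> \<psi> V1) k x \<partial>lborel)"

definition pairV :: "real \<Rightarrow> (real^'n \<Rightarrow> real) \<Rightarrow> (real^'n \<Rightarrow> real) \<Rightarrow> (real^'n \<Rightarrow> real) \<Rightarrow> real" where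
  "pairV \<alpha> \<rho> V1 V2 = pair_hdot \<alpha> \<rho> V1 + (\<integral>x. \<rho> x * V2 x \<partial>lborel)"

definition energy :: "real \<Rightarrow> real \<Rightarrow> (real^'n \<Rightarrow> real) \<Rightarrow> (real^'n \<Rightarrow> real) \<Rightarrow> (real^'n \<Rightarrow> real) \<Rightarrow> real" where
  "energy q \<alpha> V1 V2 \<rho> = (1 / q) * (\<integral>x. \<bar>\<rho> x\<bar> powr q \<partial>lborel) - pairV \<alpha> \<rho> V1 V2
      + (1 / 2) * hneg_norm2 \<alpha> \<rho>"

text \<open>U represents (-Delta)^{-alpha/2} rho: U in H^{alpha/2} and
  <rho, phi> = <U, phi>_{H^{alpha/2}} for all phi (by density it suffices to test
  against test functions; the inner product with U is the limit along an
  approximating sequence).\<close>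
definition riesz_pot :: "real \<Rightarrow> (real^'n \<Rightarrow> real) \<Rightarrow> (real^'n \<Rightarrow> real) \<Rightarrow> bool" where
  "riesz_pot \<alpha> \<rho> U \<longleftrightarrow> (\<exists>\<psi>. hdot_approx \<alpha> \<psi> U \<and>
     (\<forall>\<phi>. test_fun \<phi> \<longrightarrow>
        (\<lambda>k. hdot_inner \<alpha> (\<psi> k) \<phi>) \<longlonglongrightarrow> (\<integral>x. \<rho> x * \<phi> x \<partial>lborel)))"

definition conj_exp :: "real \<Rightarrow> real" where
  "conj_exp q = q / (q - 1)"

end

theory Submission
  imports Defs "HOL-Probability.Probability"
begin

text \<open>
  After multiplication by \<open>\<bar>2\<pi>\<xi>\<bar>\<close> to the power \<open>\<alpha>/2\<close> or \<open>-\<alpha>/2\<close>, Fourier transforms turn the two homogeneous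
  Sobolev spaces into subspaces of \<open>L2\<close>, and the pairing of a density with a test function becomes
  the \<open>L2\<close> product. Cut-off inverse transforms of test functions are admissible test functions whose
  transforms converge with a uniform weight; this yields the pairing identity, the uniqueness of
  transforms, and the density of test functions. Duality with bounded densities replaces the Sobolev embedding.

  The midpoint defect of the energy is the sum of the defect of \<open>\<bar>\<cdot>\<bar>\<^sup>q\<close> and one eighth of the squared
  \<open>H\<close>-norm of the difference. Hence minimizing sequences converge strongly both in \<open>L\<^sup>q\<close> and in the
  dual Sobolev norm, which gives existence and uniqueness. Convexity along segments
  towards \<open>\<rho> + h\<close> gives the variational inequality. Let \<open>W\<close> denote \<open>\<rho>\<close> to the power \<open>q - 1\<close> minus \<open>V - U\<close>. Testing with the indicator of
  \<open>{W < 0}\<close> gives \<open>W \<ge> 0\<close>, and testing with \<open>- min \<rho> 1\<close> on balls gives \<open>W = 0\<close> where \<open>\<rho> > 0\<close>.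
\<close>

text \<open>\<open>is_fourier_of\<close> tests a density against transforms of compactly supported
  functions, whereas the pairing with \<open>V1\<close> and the Riesz potential test it against such
  functions themselves. A nonzero function and its transform cannot both have compact support, so
  the two kinds of test cannot be exchanged directly. This is why cut-off inverse transforms and
  domination by one fixed integrable weight recur.

  A second obstacle: an element of the space of positive order is realised only as a limit in
  L^1_loc. Its Fourier side is therefore carried by the \<open>L2\<close> limit of the approximating
  transforms, and the two limits are compared on bounded densities of compact support. These all lie
  in the energy space, and there are enough of them to localise the first variation to a pointwise
  statement.

  Along a minimizing sequence both norms are controlled by a single midpoint identity, so limits
  come from completeness. The linear and quadratic terms pass to the limit exactly; the power term
  is treated by Fatou's lemma.\<close>

text \<open>Coinduction for \<open>smooth_fun\<close> up to the algebra generated by a candidate set: the derivatives of the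
  candidates only have to be polynomials in candidates.\<close>

inductive alg_closure :: "((real^'n \<Rightarrow> real) \<Rightarrow> bool) \<Rightarrow> (real^'n \<Rightarrow> real) \<Rightarrow> bool"
  for S where
  base: "S f \<Longrightarrow> alg_closure S f"
| const: "alg_closure S (\<lambda>x. c)"
| add: "alg_closure S f \<Longrightarrow> alg_closure S g \<Longrightarrow> alg_closure S (\<lambda>x. f x + g x)"
| mult: "alg_closure S f \<Longrightarrow> alg_closure S g \<Longrightarrow> alg_closure S (\<lambda>x. f x * g x)"

lemma frechet_derivativeI:
  "(f has_derivative f') (at x) \<Longrightarrow> frechet_derivative f (at x) = f'"
  using frechet_derivative_at by metis

lemma frechet_derivativeD:
  "f differentiable (at x) \<Longrightarrow> (f has_derivative frechet_derivative f (at x)) (at x)"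
  using frechet_derivative_works by blast

lemma alg_closure_derivative:
  assumes D: "\<And>f x. S f \<Longrightarrow> f differentiable (at x)"
    and C: "\<And>f v. S f \<Longrightarrow> alg_closure S (\<lambda>x. frechet_derivative f (at x) v)"
    and "alg_closure S f"
  shows "(\<forall>x. f differentiable (at x)) \<and> (\<forall>v. alg_closure S (\<lambda>x. frechet_derivative f (at x) v))"
  using assms(3)
proof induction
  case (base f)
  then show ?case using D C by blast
next
  case (const c)
  have "frechet_derivative (\<lambda>x::real^'a. c) (at x) = (\<lambda>v. 0)" for x
    by (rule frechet_derivativeI) auto
  then show ?case by (auto intro: alg_closure.const)
next
  case (add f g)
  have *: "frechet_derivative (\<lambda>x. f x + g x) (at x)
      = (\<lambda>v. frechet_derivative f (at x) v + frechet_derivative g (at x) v)" for x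
    by (rule frechet_derivativeI, rule has_derivative_add)
       (use add in \<open>auto intro: frechet_derivativeD\<close>)
  then show ?case using add by (auto intro: alg_closure.add)
next
  case (mult f g)
  have *: "frechet_derivative (\<lambda>x. f x * g x) (at x)
      = (\<lambda>v. f x * frechet_derivative g (at x) v + frechet_derivative f (at x) v * g x)" for x
    by (rule frechet_derivativeI, rule has_derivative_mult)
       (use mult in \<open>auto intro: frechet_derivativeD\<close>)
  then show ?case using mult by (auto intro!: alg_closure.add alg_closure.mult)
qed

text \<open>Coinduction with the whole algebra as invariant: the sum and product rules keep
  derivatives inside it. \<open>S\<close> alone need not be invariant, since the derivative of a
  member is only a polynomial in members.\<close>

lemma alg_closure_smooth:
  assumes "\<And>f x. S f \<Longrightarrow> f differentiable (at x)"
    and "\<And>f v. S f \<Longrightarrow> alg_closure S (\<lambda>x. frechet_derivative f (at x) v)"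
    and "alg_closure S f"
  shows "smooth_fun f"
  using assms(3)
proof (coinduction arbitrary: f)
  case smooth_fun
  then show ?case using alg_closure_derivative[OF assms(1,2)] by blast
qed

lemma smooth_fun_differentiable: "smooth_fun f \<Longrightarrow> f differentiable (at x)"
  by (auto elim: smooth_fun.cases)

lemma smooth_fun_derivative: "smooth_fun f \<Longrightarrow> smooth_fun (\<lambda>x. frechet_derivative f (at x) v)"
  by (auto elim: smooth_fun.cases)

text \<open>With \<open>smooth_fun\<close> itself as the candidate set, the closure result becomes
  stability under sums and products.\<close>

lemma smooth_closure_smooth: "alg_closure smooth_fun f \<Longrightarrow> smooth_fun f"
  by (rule alg_closure_smooth) (auto intro: smooth_fun_differentiable smooth_fun_derivative alg_closure.base)

lemma smooth_fun_const [intro]: "smooth_fun (\<lambda>x. c)"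
  by (rule smooth_closure_smooth, rule alg_closure.const)

lemma smooth_fun_add [intro]: "smooth_fun f \<Longrightarrow> smooth_fun g \<Longrightarrow> smooth_fun (\<lambda>x. f x + g x)"
  by (rule smooth_closure_smooth, rule alg_closure.add; rule alg_closure.base)

lemma smooth_fun_mult [intro]: "smooth_fun f \<Longrightarrow> smooth_fun g \<Longrightarrow> smooth_fun (\<lambda>x. f x * g x)"
  by (rule smooth_closure_smooth, rule alg_closure.mult; rule alg_closure.base)

lemma smooth_fun_cmult [intro]: "smooth_fun f \<Longrightarrow> smooth_fun (\<lambda>x. c * f x)"
  by (rule smooth_fun_mult[OF smooth_fun_const])

lemma smooth_fun_prod: "finite I \<Longrightarrow> (\<And>i. i \<in> I \<Longrightarrow> smooth_fun (f i)) \<Longrightarrow> smooth_fun (\<lambda>x. \<Prod>i\<in>I. f i x)"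
  by (induction I rule: finite_induct) auto

text \<open>Differentiating a dilated and translated smooth function gives \<open>c\<close> times
  another one, so all of them together form a candidate set for
  \<open>alg_closure_smooth\<close>.\<close>

lemma smooth_fun_affine:
  assumes "smooth_fun f"
  shows "smooth_fun (\<lambda>x. f (c *\<^sub>R x + b))"
proof -
  define S where "S = (\<lambda>g. \<exists>f. smooth_fun f \<and> g = (\<lambda>x. f (c *\<^sub>R x + b)))"
  have hd: "((\<lambda>x. f (c *\<^sub>R x + b)) has_derivative
      (\<lambda>v. c * frechet_derivative f (at (c *\<^sub>R x + b)) v)) (at x)" if "smooth_fun f" for f x
  proof -
    have 1: "((\<lambda>x. c *\<^sub>R x + b) has_derivative (\<lambda>v. c *\<^sub>R v)) (at x)"
      by (auto intro!: derivative_eq_intros)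
    have 2: "(f has_derivative frechet_derivative f (at (c *\<^sub>R x + b))) (at (c *\<^sub>R x + b))"
      using frechet_derivativeD smooth_fun_differentiable that by blast
    show ?thesis
      using has_derivative_compose[OF 1 2] linear_scale[OF has_derivative_linear[OF 2]] by simp
  qed
  show ?thesis
  proof (rule alg_closure_smooth[of S])
    show "g differentiable (at x)" if "S g" for g x
      using that hd unfolding S_def differentiable_def by blast
    show "alg_closure S (\<lambda>x. frechet_derivative g (at x) v)" if "S g" for g v
    proof -
      from that obtain f where f: "smooth_fun f" "g = (\<lambda>x. f (c *\<^sub>R x + b))" by (auto simp: S_def)
      have "(\<lambda>x. frechet_derivative g (at x) v) = (\<lambda>x. c * frechet_derivative f (at (c *\<^sub>R x + b)) v)"
        using frechet_derivativeI[OF hd[OF f(1)]] f(2) by simp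
      moreover have "S (\<lambda>x. frechet_derivative f (at (c *\<^sub>R x + b)) v)"
        using smooth_fun_derivative[OF f(1), of v] by (auto simp: S_def)
      ultimately show ?thesis
        by (auto intro!: alg_closure.mult alg_closure.const intro: alg_closure.base)
    qed
    show "alg_closure S (\<lambda>x. f (c *\<^sub>R x + b))"
      using assms by (auto intro!: alg_closure.base simp: S_def)
  qed
qed

lemma smooth_fun_continuous: "smooth_fun f \<Longrightarrow> continuous_on A f"
  using differentiable_imp_continuous_on differentiable_on_def smooth_fun_differentiable
  by (metis differentiable_at_withinI)

section \<open>Flat functions and smooth ridges\<close>

text \<open>The classical flat function is the case \<open>m = 0\<close>. Its derivatives bring in
  powers of 1/t; admitting them makes the family closed under differentiation up to linear
  combinations.\<close>

definition flat_exp :: "nat \<Rightarrow> real \<Rightarrow> real" where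
  "flat_exp m t = (if t > 0 then exp (- inverse t) * inverse t ^ m else 0)"

text \<open>With s = 1/t, the single term s^(m+1)/(m+1)! of the exponential series is at most exp s.
  The spare factor s supplies |t|.\<close>

lemma flat_bound: "\<exists>C\<ge>0. \<forall>t. \<bar>flat_exp m t\<bar> \<le> C * \<bar>t\<bar>"
proof -
  have "\<bar>flat_exp m t\<bar> \<le> fact (Suc m) * \<bar>t\<bar>" for t
  proof (cases "t > 0")
    case True
    have "inverse t ^ Suc m / fact (Suc m) \<le> exp (inverse t)"
    proof -
      have "(\<Sum>k\<in>{Suc m}. inverse t ^ k / fact k) \<le> (\<Sum>k. inverse t ^ k / fact k)"
        using True summable_exp[of "inverse t"]
        by (intro sum_le_suminf) (auto simp: divide_inverse mult.commute)
      also have "\<dots> = exp (inverse t)"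
        by (simp add: exp_def divide_inverse mult.commute scaleR_conv_of_real)
      finally show ?thesis by simp
    qed
    then have "exp (- inverse t) * inverse t ^ Suc m \<le> fact (Suc m)"
    proof -
      assume "inverse t ^ Suc m / fact (Suc m) \<le> exp (inverse t)"
      then have "inverse t ^ Suc m \<le> exp (inverse t) * fact (Suc m)"
        by (simp add: pos_divide_le_eq del: power_Suc fact_Suc)
      then have "exp (- inverse t) * inverse t ^ Suc m \<le> exp (- inverse t) * (exp (inverse t) * fact (Suc m))"
        by (rule mult_left_mono) simp
      also have "\<dots> = (exp (- inverse t) * exp (inverse t)) * fact (Suc m)" by (simp only: mult.assoc)
      also have "\<dots> = fact (Suc m)" by (simp add: exp_minus)
      finally show ?thesis .
    qed
    then have "exp (- inverse t) * inverse t ^ Suc m * t \<le> fact (Suc m) * t"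
      using True by (intro mult_right_mono) auto
    moreover have "exp (- inverse t) * inverse t ^ Suc m * t = exp (- inverse t) * inverse t ^ m"
      using True by simp
    moreover have "\<bar>flat_exp m t\<bar> = exp (- inverse t) * inverse t ^ m" "\<bar>t\<bar> = t"
      using True by (simp_all add: flat_exp_def abs_mult)
    ultimately show ?thesis by (simp only:)
  next
    case False
    have "0 \<le> fact (Suc m) * \<bar>t\<bar>" by (intro mult_nonneg_nonneg) auto
    then show ?thesis using False by (simp only: flat_exp_def if_False abs_zero)
  qed
  then show ?thesis by (intro exI[of _ "fact (Suc m)"]) auto
qed

text \<open>At the origin the difference quotient of \<open>flat_exp m\<close> is
  \<open>flat_exp (Suc m)\<close>, which tends to 0 by \<open>flat_bound\<close>; elsewhere one of
  the two defining formulas holds in a neighbourhood.\<close>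

lemma flat_deriv:
  "(flat_exp m has_real_derivative (flat_exp (m+2) t - of_nat m * flat_exp (Suc m) t)) (at t)"
proof (cases "t = 0")
  case True
  obtain C where C: "C \<ge> 0" "\<And>t. \<bar>flat_exp (Suc m) t\<bar> \<le> C * \<bar>t\<bar>" using flat_bound by blast
  have "((\<lambda>h. flat_exp (Suc m) h) \<longlongrightarrow> 0) (at 0)"
  proof (rule Lim_null_comparison)
    show "\<forall>\<^sub>F h in at 0. norm (flat_exp (Suc m) h) \<le> C * \<bar>h\<bar>" using C by auto
    show "((\<lambda>h. C * \<bar>h\<bar>) \<longlongrightarrow> 0) (at 0)" by (auto intro!: tendsto_eq_intros)
  qed
  moreover have "flat_exp m h / h = flat_exp (Suc m) h" for h
    by (simp add: flat_exp_def field_simps)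
  ultimately show ?thesis
    using True by (simp add: DERIV_def flat_exp_def)
next
  case False
  consider "t > 0" | "t < 0" using False by linarith
  then show ?thesis
  proof cases
    case 1
    have "((\<lambda>t. exp (- inverse t) * inverse t ^ m) has_real_derivative (flat_exp (m+2) t - of_nat m * flat_exp (Suc m) t)) (at t)"
    proof (rule DERIV_cong)
      show "((\<lambda>t. exp (- inverse t) * inverse t ^ m) has_real_derivative
          exp (- inverse t) * (inverse t * inverse t) * inverse t ^ m
          + of_nat m * inverse t ^ (m - 1) * - (inverse t * inverse t) * exp (- inverse t)) (at t)"
        using 1 by (auto intro!: derivative_eq_intros simp: power2_eq_square)
    qed (use 1 in \<open>cases m; simp add: flat_exp_def algebra_simps\<close>)
    then show ?thesis
      by (rule has_field_derivative_transform_within_open[where S="{0<..}"]) (auto simp: flat_exp_def 1)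
  next
    case 2
    have "((\<lambda>t. 0::real) has_real_derivative (flat_exp (m+2) t - of_nat m * flat_exp (Suc m) t)) (at t)"
      using 2 by (auto simp: flat_exp_def)
    then show ?thesis
      by (rule has_field_derivative_transform_within_open[where S="{..<0}"]) (auto simp: flat_exp_def 2)
  qed
qed

text \<open>Ridges in coordinate directions are the factors from which smooth bumps on boxes are
  built.\<close>

lemma smooth_flat_ridge: "smooth_fun (\<lambda>x. flat_exp m (x \<bullet> v + b))"
proof -
  define S where "S = (\<lambda>g. \<exists>m. g = (\<lambda>x. flat_exp m (x \<bullet> v + b)))"
  have hd: "((\<lambda>x. flat_exp m (x \<bullet> v + b)) has_derivative
      (\<lambda>w. (w \<bullet> v) * (flat_exp (m+2) (x \<bullet> v + b) - of_nat m * flat_exp (Suc m) (x \<bullet> v + b)))) (at x)" for m x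
  proof -
    have 1: "((\<lambda>x. x \<bullet> v + b) has_derivative (\<lambda>w. w \<bullet> v)) (at x)"
      by (auto intro!: derivative_eq_intros)
    show ?thesis
      using has_derivative_compose[OF 1 flat_deriv[unfolded has_field_derivative_def]]
      by (simp add: mult.commute)
  qed
  show ?thesis
  proof (rule alg_closure_smooth[of S])
    show "g differentiable (at x)" if "S g" for g x
      using that hd unfolding S_def differentiable_def by blast
    show "alg_closure S (\<lambda>x. frechet_derivative g (at x) w)" if "S g" for g w
    proof -
      from that obtain m where m: "g = (\<lambda>x. flat_exp m (x \<bullet> v + b))" by (auto simp: S_def)
      have eq: "(\<lambda>x. frechet_derivative g (at x) w)
        = (\<lambda>x. (w \<bullet> v) * (flat_exp (m+2) (x \<bullet> v + b) + (- of_nat m) * flat_exp (Suc m) (x \<bullet> v + b)))"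
        using frechet_derivativeI[OF hd] m by simp
      show ?thesis unfolding eq
        by (intro alg_closure.mult alg_closure.add alg_closure.const alg_closure.base) (auto simp: S_def)
    qed
    show "alg_closure S (\<lambda>x. flat_exp m (x \<bullet> v + b))"
      by (auto intro!: alg_closure.base simp: S_def)
  qed
qed

section \<open>Test functions\<close>

lemma test_fun_smooth: "test_fun f \<Longrightarrow> smooth_fun f" by (simp add: test_fun_def)

lemma test_fun_mult: "test_fun f \<Longrightarrow> smooth_fun g \<Longrightarrow> test_fun (\<lambda>x. f x * g x)"
  unfolding test_fun_def by (auto elim!: bounded_subset)

lemma test_fun_add: "test_fun f \<Longrightarrow> test_fun g \<Longrightarrow> test_fun (\<lambda>x. f x + g x)"
  unfolding test_fun_def
  by (auto intro: bounded_subset[of "{x. f x \<noteq> 0} \<union> {x. g x \<noteq> 0}"])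

lemma test_fun_cmult: "test_fun f \<Longrightarrow> test_fun (\<lambda>x. c * f x)"
  unfolding test_fun_def by (auto elim!: bounded_subset)

lemma test_fun_diff: "test_fun f \<Longrightarrow> test_fun g \<Longrightarrow> test_fun (\<lambda>x. f x - g x)"
  using test_fun_add[of f "\<lambda>x. (-1) * g x"] test_fun_cmult[of g "-1"] by simp

lemma test_fun_zero: "test_fun (\<lambda>x. 0)"
  by (auto simp: test_fun_def)

lemma test_fun_support:
  assumes "test_fun f" obtains R where "R > 0" "\<And>x. norm x > R \<Longrightarrow> f x = 0"
  using assms unfolding test_fun_def bounded_pos by (metis mem_Collect_eq not_le)

lemma test_fun_derivative:
  assumes "test_fun f" shows "test_fun (\<lambda>x. frechet_derivative f (at x) v)"
proof -
  obtain R where R: "R > 0" "\<And>x. norm x > R \<Longrightarrow> f x = 0" using test_fun_support[OF assms] by blast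
  have "frechet_derivative f (at x) v = 0" if "norm x > R" for x
  proof -
    have "(f has_derivative (\<lambda>v. 0)) (at x)"
    proof (rule has_derivative_transform_within_open)
      show "((\<lambda>x. 0) has_derivative (\<lambda>v. 0)) (at x)" by simp
      show "open {x::real^'a. R < norm x}" by (intro open_Collect_less continuous_intros)
    qed (use that R in auto)
    then show ?thesis using frechet_derivativeI by metis
  qed
  then have "{x. frechet_derivative f (at x) v \<noteq> 0} \<subseteq> cball 0 R"
    by (auto simp: not_less[symmetric])
  then show ?thesis
    using assms bounded_subset bounded_cball smooth_fun_derivative unfolding test_fun_def by blast
qed

lemma test_fun_scale:
  assumes "test_fun f" "c \<noteq> 0" shows "test_fun (\<lambda>x. f (c *\<^sub>R x + b))"
proof -
  obtain R where R: "R > 0" "\<And>x. norm x > R \<Longrightarrow> f x = 0" using test_fun_support[OF assms(1)] by blast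
  have "norm x \<le> (R + norm b) / \<bar>c\<bar>" if "f (c *\<^sub>R x + b) \<noteq> 0" for x
  proof -
    have "norm (c *\<^sub>R x + b) \<le> R" using that R(2) by force
    then have "norm (c *\<^sub>R x) \<le> R + norm b" using norm_triangle_ineq4[of "c *\<^sub>R x + b" b] by simp
    then show ?thesis using assms(2) by (simp add: field_simps)
  qed
  then have "bounded {x. f (c *\<^sub>R x + b) \<noteq> 0}" by (auto simp: bounded_iff)
  then show ?thesis using smooth_fun_affine[of f c b] assms unfolding test_fun_def by auto
qed

lemma test_fun_continuous: "test_fun f \<Longrightarrow> continuous_on A f"
  by (simp add: test_fun_smooth smooth_fun_continuous)

lemma test_fun_measurable [measurable_dest]: "test_fun f \<Longrightarrow> f \<in> borel_measurable borel"
  by (intro borel_measurable_continuous_onI test_fun_continuous)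

lemma test_fun_bounded:
  assumes "test_fun f" obtains B where "B > 0" "\<And>x. \<bar>f x\<bar> \<le> B"
proof -
  obtain R where R: "R > 0" "\<And>x. norm x > R \<Longrightarrow> f x = 0" using test_fun_support[OF assms] by blast
  have "bounded (f ` cball 0 R)"
    by (intro compact_imp_bounded compact_continuous_image test_fun_continuous assms) auto
  then obtain B where B: "B > 0" "\<And>x. x \<in> cball 0 R \<Longrightarrow> \<bar>f x\<bar> \<le> B"
    unfolding bounded_pos by auto
  have "\<bar>f x\<bar> \<le> B" for x using B R(2)[of x] by (cases "norm x > R") auto
  then show ?thesis using B that by blast
qed

lemma integrable_bounded_support:
  fixes f :: "'a::euclidean_space \<Rightarrow> 'b::{banach,second_countable_topology}"
  assumes [measurable]: "f \<in> borel_measurable borel" and B: "\<And>x. norm (f x) \<le> B"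
    and R: "\<And>x. norm x > R \<Longrightarrow> f x = 0"
  shows "integrable lborel f"
proof (rule Bochner_Integration.integrable_bound[where f="\<lambda>x. B * indicator (cball 0 R) x"])
  show "integrable lborel (\<lambda>x. B * indicator (cball 0 R) x :: real)"
    by (intro integrable_mult_right integrable_real_indicator) (use emeasure_bounded_finite[OF bounded_cball[of 0 R]] in auto)
  show "AE x in lborel. norm (f x) \<le> norm (B * indicator (cball 0 R) x :: real)"
  proof (rule AE_I2)
    fix x
    show "norm (f x) \<le> norm (B * indicator (cball 0 R) x :: real)"
      using B[of x] R[of x] order_trans[OF norm_ge_zero B[of x]] by (cases "R < norm x") auto
  qed
qed simp

lemma test_fun_integrable:
  assumes "test_fun f" shows "integrable lborel f"
proof -
  obtain R where R: "R > 0" "\<And>x. norm x > R \<Longrightarrow> f x = 0" using test_fun_support[OF assms] by blast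
  obtain B where B: "B > 0" "\<And>x. \<bar>f x\<bar> \<le> B" using test_fun_bounded[OF assms] by blast
  show ?thesis using assms B R by (intro integrable_bounded_support[of f B R]) auto
qed

text \<open>Each coordinate contributes flat functions of \<open>k\<close> times the signed
  distances to the two faces. They vanish outside the box, and inside they tend to 1 because exp
  (-1/(k t)) does for every t > 0.\<close>

lemma test_fun_approx_box:
  "\<exists>\<phi>. (\<forall>k. test_fun (\<phi> k)) \<and> (\<forall>k x. 0 \<le> \<phi> k x \<and> \<phi> k x \<le> indicator (box a b) x)
     \<and> (\<forall>x. (\<lambda>k. \<phi> k x) \<longlonglongrightarrow> indicator (box a b) (x::real^'n))"
proof -
  define \<phi> where "\<phi> = (\<lambda>(k::nat) (x::real^'n).
     (\<Prod>i\<in>Basis. flat_exp 0 (x \<bullet> (real k *\<^sub>R i) + (- real k * (a \<bullet> i))) * flat_exp 0 (x \<bullet> ((- real k) *\<^sub>R i) + real k * (b \<bullet> i))))"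
  have eq: "\<phi> k x = (\<Prod>i\<in>Basis. flat_exp 0 (real k * (x \<bullet> i - a \<bullet> i)) * flat_exp 0 (real k * (b \<bullet> i - x \<bullet> i)))" for k x
    by (simp add: \<phi>_def algebra_simps)
  have f01: "0 \<le> flat_exp 0 t \<and> flat_exp 0 t \<le> 1" for t by (auto simp: flat_exp_def)
  have fz: "flat_exp 0 t = 0" if "t \<le> 0" for t using that by (auto simp: flat_exp_def)
  have pos: "0 \<le> \<phi> k x" for k x unfolding eq using f01 by (intro prod_nonneg) auto
  have le1: "\<phi> k x \<le> 1" for k x
    unfolding eq using f01 by (intro prod_le_1) (auto intro: mult_le_one)
  have zero: "\<phi> k x = 0" if "x \<notin> box a b" for k x
  proof -
    from that obtain i where i: "i \<in> Basis" "x \<bullet> i - a \<bullet> i \<le> 0 \<or> b \<bullet> i - x \<bullet> i \<le> 0"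
      unfolding mem_box by force
    then have "flat_exp 0 (real k * (x \<bullet> i - a \<bullet> i)) * flat_exp 0 (real k * (b \<bullet> i - x \<bullet> i)) = 0"
      using fz[of "real k * (x \<bullet> i - a \<bullet> i)"] fz[of "real k * (b \<bullet> i - x \<bullet> i)"]
      by (auto simp: mult_nonneg_nonpos)
    then show ?thesis unfolding eq using i(1) by (auto intro!: prod_zero)
  qed
  have "test_fun (\<phi> k)" for k
  proof -
    have "smooth_fun (\<phi> k)" unfolding \<phi>_def
      by (intro smooth_fun_prod smooth_fun_mult smooth_flat_ridge) auto
    moreover have "{x. \<phi> k x \<noteq> 0} \<subseteq> box a b" using zero by auto
    ultimately show ?thesis unfolding test_fun_def using bounded_subset bounded_box by blast
  qed
  moreover have "(\<lambda>k. \<phi> k x) \<longlonglongrightarrow> indicator (box a b) x" for x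
  proof (cases "x \<in> box a b")
    case True
    have lim: "(\<lambda>k. flat_exp 0 (real k * t)) \<longlonglongrightarrow> 1" if "t > 0" for t
    proof -
      have "(\<lambda>k. exp (- inverse (real k * t))) \<longlonglongrightarrow> exp (- 0)"
        using that by (intro tendsto_intros tendsto_inverse_0_at_top filterlim_at_top_mult_tendsto_pos[where c=t])
          (auto intro: filterlim_real_sequentially simp: mult.commute)
      then have "(\<lambda>k. exp (- inverse (real k * t))) \<longlonglongrightarrow> 1" by simp
      then show ?thesis
        by (rule Lim_transform_eventually)
           (use that in \<open>auto simp: flat_exp_def intro!: eventually_sequentiallyI[of 1]\<close>)
    qed
    have "(\<lambda>k. \<phi> k x) \<longlonglongrightarrow> (\<Prod>i\<in>(Basis::(real^'n) set). 1 * 1)" unfolding eq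
      by (intro tendsto_prod tendsto_mult lim) (use True in \<open>auto simp: mem_box\<close>)
    then show ?thesis using True by simp
  qed (use zero in simp)
  ultimately show ?thesis
    using pos le1 zero by (intro exI[of _ \<phi>]) (auto simp: indicator_def)
qed

section \<open>Integration over Euclidean space: products, affine maps, weights\<close>

lemma
  fixes f :: "'a::euclidean_space \<Rightarrow> real \<Rightarrow> 'b::{real_normed_field,banach,second_countable_topology}"
  assumes int: "\<And>b. b \<in> Basis \<Longrightarrow> integrable lborel (f b)"
  shows integrable_lborel_prod: "integrable lborel (\<lambda>x::'a. \<Prod>b\<in>Basis. f b (x \<bullet> b))"
    and integral_lborel_prod: "(\<integral>x. (\<Prod>b\<in>Basis. f b ((x::'a) \<bullet> b)) \<partial>lborel) = (\<Prod>b\<in>Basis. (\<integral>t. f b t \<partial>lborel))"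
proof -
  interpret product_sigma_finite "\<lambda>_::'a. lborel :: real measure" ..
  have [measurable]: "f b \<in> borel_measurable borel" if "b \<in> Basis" for b
    using int[OF that] by auto
  have [measurable]: "(\<lambda>x::'a. \<Prod>b\<in>Basis. f b (x \<bullet> b)) \<in> borel_measurable borel"
    by measurable
  have m: "(\<lambda>f. \<Sum>b\<in>Basis. f b *\<^sub>R b) \<in> measurable (\<Pi>\<^sub>M b\<in>(Basis::'a set). (lborel::real measure)) borel"
    by measurable
  have eq: "(\<Prod>b\<in>Basis. f b ((\<Sum>b'\<in>Basis. g b' *\<^sub>R b') \<bullet> b)) = (\<Prod>b\<in>Basis. f b (g b))" for g
    by (intro prod.cong refl) (simp add: inner_sum_left inner_Basis if_distrib sum.If_cases cong: if_cong)
  show "integrable lborel (\<lambda>x::'a. \<Prod>b\<in>Basis. f b (x \<bullet> b))"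
    by (subst lborel_eq, subst integrable_distr_eq[OF m])
      (auto simp: eq intro!: product_integrable_prod int)
  show "(\<integral>x. (\<Prod>b\<in>Basis. f b ((x::'a) \<bullet> b)) \<partial>lborel) = (\<Prod>b\<in>Basis. (\<integral>t. f b t \<partial>lborel))"
    by (subst lborel_eq, subst integral_distr[OF m])
      (auto simp: eq intro!: product_integral_prod int)
qed

lemma
  fixes f :: "'a::euclidean_space \<Rightarrow> 'b::{banach,second_countable_topology}"
  assumes c: "c \<noteq> 0" and f: "f \<in> borel_measurable borel"
  shows lborel_integrable_affine: "integrable lborel (\<lambda>x. f (t + c *\<^sub>R x)) \<longleftrightarrow> integrable lborel f"
    and lborel_integral_affine: "(\<integral>x. f x \<partial>lborel) = \<bar>c\<bar> ^ DIM('a) *\<^sub>R (\<integral>x. f (t + c *\<^sub>R x) \<partial>lborel)"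
proof -
  note f[measurable]
  show "integrable lborel (\<lambda>x. f (t + c *\<^sub>R x)) \<longleftrightarrow> integrable lborel f"
  proof -
    have "integrable lborel f \<longleftrightarrow> integrable lborel (\<lambda>x. \<bar>c\<bar> ^ DIM('a) *\<^sub>R f (t + c *\<^sub>R x))" (is "_ \<longleftrightarrow> integrable lborel ?g")
      by (subst lborel_affine[OF c, of t], subst integrable_density) (auto simp: integrable_distr_eq)
    moreover have "integrable lborel (\<lambda>x. f (t + c *\<^sub>R x))" if "integrable lborel ?g"
      using integrable_scaleR_right[of "inverse (\<bar>c\<bar> ^ DIM('a))" lborel ?g] that c by simp
    ultimately show ?thesis by auto
  qed
  show "(\<integral>x. f x \<partial>lborel) = \<bar>c\<bar> ^ DIM('a) *\<^sub>R (\<integral>x. f (t + c *\<^sub>R x) \<partial>lborel)"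
    by (subst lborel_affine[OF c, of t], subst integral_density) 
      (auto simp: integral_distr c)
qed

lemma
  fixes f :: "'a::euclidean_space \<Rightarrow> 'b::{banach,second_countable_topology}"
  assumes f: "f \<in> borel_measurable borel"
  shows lborel_integrable_translate: "integrable lborel (\<lambda>x. f (x + t)) \<longleftrightarrow> integrable lborel f"
    and lborel_integral_translate: "(\<integral>x. f (x + t) \<partial>lborel) = (\<integral>x. f x \<partial>lborel)"
    and lborel_integral_uminus: "(\<integral>x. f (- x) \<partial>lborel) = (\<integral>x. f x \<partial>lborel)"
  using lborel_integrable_affine[OF _ f, of 1 t] lborel_integral_affine[OF _ f, of 1 t]
    lborel_integral_affine[OF _ f, of "-1" 0]
  by (simp_all add: add.commute)

text \<open>The exponent is the dimension, so that the weight lies below the product over the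
  coordinates of 1/(1 + t^2), which is integrable factor by factor. It is the common majorant of all
  later dominated limits on the whole space that involve transforms of test functions.\<close>

definition weight :: "'a::euclidean_space \<Rightarrow> real" where
  "weight x = inverse (1 + (norm x)\<^sup>2) ^ DIM('a)"

lemma norm2_pos: "0 < 1 + (norm x)\<^sup>2"
  by (simp add: add_pos_nonneg)

lemma weight_pos: "0 < weight x" by (simp add: weight_def norm2_pos)

lemma weight_nonneg [simp]: "0 \<le> weight x" using weight_pos[of x] by simp

lemma weight_le1: "weight x \<le> 1"
  unfolding weight_def by (rule power_le_one) (simp_all add: field_simps norm2_pos norm2_pos[THEN less_imp_le])

lemma weight_measurable [measurable]: "weight \<in> borel_measurable borel"
  unfolding weight_def[abs_def] by measurable

lemma integrable_inverse_1_square: "integrable lborel (\<lambda>t::real. inverse (1 + t\<^sup>2))"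
  using integrable_inverse_1_plus_square by (simp add: set_integrable_def)

lemma integrable_weight: "integrable lborel (weight :: 'a::euclidean_space \<Rightarrow> real)"
proof (rule Bochner_Integration.integrable_bound)
  show "integrable lborel (\<lambda>x::'a. \<Prod>b\<in>Basis. inverse (1 + (x \<bullet> b)\<^sup>2))"
    by (intro integrable_lborel_prod integrable_inverse_1_square)
  have "weight x \<le> (\<Prod>b\<in>Basis. inverse (1 + (x \<bullet> b)\<^sup>2))" for x :: 'a
  proof -
    have "weight x = (\<Prod>b\<in>(Basis::'a set). inverse (1 + (norm x)\<^sup>2))" by (simp add: weight_def)
    also have "\<dots> \<le> (\<Prod>b\<in>Basis. inverse (1 + (x \<bullet> b)\<^sup>2))"
    proof (intro prod_mono conjI)
      fix b :: 'a assume "b \<in> Basis"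
      then have "(x \<bullet> b)\<^sup>2 \<le> (norm x)\<^sup>2" 
        using Basis_le_norm[of b x] by (metis abs_le_square_iff abs_norm_cancel)
      then show "inverse (1 + (norm x)\<^sup>2) \<le> inverse (1 + (x \<bullet> b)\<^sup>2)"
        by (intro le_imp_inverse_le) (auto simp: add_pos_nonneg)
    qed (simp add: norm2_pos less_imp_le)
    finally show ?thesis .
  qed
  then show "AE x in lborel. norm (weight x) \<le> norm (\<Prod>b\<in>Basis. inverse (1 + ((x::'a) \<bullet> b)\<^sup>2))"
    by (intro AE_I2) (simp add: abs_prod)
qed simp

lemma integrable_abs_powr_unit:
  assumes "0 < s" "s < 1"
  shows "integrable lborel (\<lambda>t::real. indicator {-1..1} t * \<bar>t\<bar> powr (- s))"
proof -
  define g where "g = (\<lambda>t::real. indicator {0<..1} t * t powr (-s))"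
  have "set_integrable lebesgue {0<..1} (\<lambda>t. t powr (- s))"
    using assms by (intro nonnegative_absolutely_integrable_1 integrable_on_powr_from_0') auto
  then have "integrable lebesgue g" by (simp add: set_integrable_def g_def)
  moreover have [measurable]: "g \<in> borel_measurable borel" unfolding g_def by measurable
  ultimately have g: "integrable lborel g" by (simp add: integrable_completion)
  have "integrable lborel (\<lambda>t. g t + g (0 + (-1) *\<^sub>R t))"
    by (intro Bochner_Integration.integrable_add g) (subst lborel_integrable_affine, auto intro: g)
  \<comment> \<open>The point t = 0 belongs to neither copy; the identity still holds there because
    \<open>0 powr (- s)\<close> is 0.\<close>
  moreover have "(\<lambda>t. g t + g (0 + (-1) *\<^sub>R t)) = (\<lambda>t::real. indicator {-1..1} t * \<bar>t\<bar> powr (- s))"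
    by (auto simp: g_def indicator_def fun_eq_iff)
  ultimately show ?thesis by simp
qed

lemma AE_lborel_inner_nonzero: "AE x in (lborel :: 'a::euclidean_space measure). \<forall>b\<in>Basis. x \<bullet> b \<noteq> 0"
proof (subst AE_finite_all, simp, intro ballI)
  fix b :: 'a assume b: "b \<in> Basis"
  have "{x. x \<bullet> b = 0} \<in> null_sets lborel"
    using negligible_standard_hyperplane[OF b, of 0] unfolding negligible_iff_null_sets
    by (subst (asm) null_sets_completion_iff) auto
  then show "AE x in lborel. x \<bullet> b \<noteq> 0"
    by (rule AE_I') auto
qed

lemma AE_lborel_nonzero: "AE x in (lborel :: 'a::euclidean_space measure). x \<noteq> 0"
proof -
  obtain b :: 'a where "b \<in> Basis" using nonempty_Basis by blast
  then show ?thesis using AE_lborel_inner_nonzero by (auto elim!: eventually_mono)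
qed

text \<open>Distribute the singularity over the coordinates: with s = a/d, |x|^(-a) is a product of
  d factors |x|^(-s), each at most |x_b|^(-s) off the coordinate hyperplanes. Here s < 1 because a <
  d, so every one-dimensional factor is integrable.\<close>

lemma integrable_norm_powr_unit_ball:
  fixes a :: real
  assumes "0 < a" "a < DIM('a)"
  shows "integrable lborel (\<lambda>x::'a::euclidean_space. indicator (cball 0 1) x * norm x powr (- a))"
proof -
  define s where "s = a / DIM('a)"
  have s: "0 < s" "s < 1" using assms by (auto simp: s_def)
  have I: "integrable lborel (\<lambda>x::'a. \<Prod>b\<in>Basis. indicator {-1..1} (x \<bullet> b) * \<bar>x \<bullet> b\<bar> powr (- s))"
    by (intro integrable_lborel_prod integrable_abs_powr_unit s)
  have *: "AE x in lborel. norm (indicator (cball 0 1) x * norm x powr (- a))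
      \<le> norm (\<Prod>b\<in>Basis. indicator {-1..1} ((x::'a) \<bullet> b) * \<bar>x \<bullet> b\<bar> powr (- s))"
  proof (rule eventually_mono[OF AE_lborel_inner_nonzero])
    fix x :: 'a assume elim: "\<forall>b\<in>Basis. x \<bullet> b \<noteq> 0"
    show "norm (indicator (cball 0 1) x * norm x powr (- a))
      \<le> norm (\<Prod>b\<in>Basis. indicator {-1..1} (x \<bullet> b) * \<bar>x \<bullet> b\<bar> powr (- s))"
    proof (cases "norm x \<le> 1")
      case True
      have x0: "x \<noteq> 0" using elim nonempty_Basis by force
      have "norm x powr (- a) = (norm x powr (- s)) ^ DIM('a)"
        using x0 by (simp add: s_def powr_realpow[symmetric] powr_powr)
      also have "\<dots> = (\<Prod>b\<in>(Basis::'a set). norm x powr (- s))" by simp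
      also have "\<dots> \<le> (\<Prod>b\<in>Basis. indicator {-1..1} (x \<bullet> b) * \<bar>x \<bullet> b\<bar> powr (- s))"
      proof (intro prod_mono conjI)
        fix b :: 'a assume b: "b \<in> Basis"
        have le: "\<bar>x \<bullet> b\<bar> \<le> norm x" using Basis_le_norm[OF b] .
        then have "x \<bullet> b \<in> {-1..1}" using True by auto
        moreover have "norm x powr (- s) \<le> \<bar>x \<bullet> b\<bar> powr (- s)"
          using le s elim b by (intro powr_mono2') auto
        ultimately show "norm x powr (- s) \<le> indicator {-1..1} (x \<bullet> b) * \<bar>x \<bullet> b\<bar> powr (- s)" by simp
      qed simp
      finally show ?thesis using True by (simp add: abs_prod)
    qed (simp add: indicator_def)
  qed
  have [measurable]: "cball 0 1 \<in> sets (borel :: 'a measure)" by simp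
  have "(\<lambda>x::'a. indicator (cball 0 1) x * norm x powr (- a)) \<in> borel_measurable lborel" by measurable
  then show ?thesis by (rule Bochner_Integration.integrable_bound[OF I _ *])
qed

section \<open>Functions determined by their integrals\<close>

text \<open>The sets on which \<open>h\<close> integrates to zero form a Dynkin system containing
  the boxes, an intersection-stable generator. Complements require the total integral to vanish,
  which follows by exhausting the space with boxes.\<close>

lemma AE_zero_if_box_integrals_zero:
  fixes h :: "'a::euclidean_space \<Rightarrow> 'b::{banach,second_countable_topology}"
  assumes h: "integrable lborel h" and box: "\<And>a b. (\<integral>x. indicator (box a b) x *\<^sub>R h x \<partial>lborel) = 0"
  shows "AE x in lborel. h x = 0"
proof (rule sigma_finite_measure.density_zero[OF lborel.sigma_finite_measure_axioms h])
  have Z: "(\<integral>x. h x \<partial>lborel) = 0"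
  proof -
    have "(\<lambda>n. \<integral>x. indicator (box (- real n *\<^sub>R One) (real n *\<^sub>R One)) x *\<^sub>R h x \<partial>lborel) \<longlonglongrightarrow> (\<integral>x. h x \<partial>lborel)"
    proof (rule integral_dominated_convergence[where w="\<lambda>x. norm (h x)"])
      show "AE x in lborel. (\<lambda>n. indicator (box (- real n *\<^sub>R One) (real n *\<^sub>R One)) x *\<^sub>R h x) \<longlonglongrightarrow> h x"
      proof (rule AE_I2)
        fix x :: 'a
        obtain N :: nat where N: "norm x < real N" using reals_Archimedean2 by blast
        have "indicator (box (- real n *\<^sub>R One) (real n *\<^sub>R One)) x *\<^sub>R h x = h x" if "n \<ge> N" for n
        proof -
          have "x \<in> box (- real n *\<^sub>R One) (real n *\<^sub>R One)"
            unfolding mem_box using that N Basis_le_norm[of _ x] by (force simp: abs_le_iff)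
          then show ?thesis by simp
        qed
        then show "(\<lambda>n. indicator (box (- real n *\<^sub>R One) (real n *\<^sub>R One)) x *\<^sub>R h x) \<longlonglongrightarrow> h x"
          by (intro tendsto_eventually eventually_sequentiallyI[of N])
      qed
    qed (use h in \<open>auto simp: indicator_def\<close>)
    then show ?thesis using box LIMSEQ_unique[OF tendsto_const] by force
  qed
  have int: "set_integrable lborel A h" if "A \<in> sets lborel" for A
    unfolding set_integrable_def using h that by (intro integrable_mult_indicator) auto
  fix A :: "'a set" assume A: "A \<in> sets lborel"
  let ?G = "range (\<lambda> (a, b). box a b :: 'a set)"
  have st: "Int_stable ?G" unfolding Int_stable_def by (auto simp: box_Int_box)
  have sets_eq: "sets lborel = sigma_sets UNIV ?G" by (simp add: borel_eq_box)
  have subs: "?G \<subseteq> Pow UNIV" by simp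
  have "A \<in> sigma_sets UNIV ?G" using A by (simp only: sets_eq)
  with st subs show "set_lebesgue_integral lborel A h = 0"
  proof (induct rule: sigma_sets_induct_disjoint)
    case (basic A)
    then show ?case using box by (auto simp: set_lebesgue_integral_def)
  next
    case (compl A)
    then have A: "A \<in> sets lborel" by (simp only: sets_eq)
    have "(\<lambda>x. indicator (UNIV - A) x *\<^sub>R h x) = (\<lambda>x. h x - indicator A x *\<^sub>R h x)"
      by (auto split: split_indicator)
    then have "set_lebesgue_integral lborel (UNIV - A) h = (\<integral>x. h x \<partial>lborel) - set_lebesgue_integral lborel A h"
      unfolding set_lebesgue_integral_def
      using h int[OF A] by (simp add: set_integrable_def)
    then show ?case using compl Z by simp
  next
    case (union A)
    then have "A i \<in> sets lborel" for i unfolding sets_eq by blast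
    moreover have "i \<noteq> j \<Longrightarrow> A i \<inter> A j = {}" for i j using union by (auto simp: disjoint_family_on_def)
    ultimately show ?case using union
      by (subst lebesgue_integral_countable_add) (auto intro!: int)
  qed (auto simp: set_lebesgue_integral_def)
qed

lemma loc_integrable_c_test_fun:
  assumes g: "loc_integrable_c g" and \<phi>: "test_fun \<phi>"
  shows "integrable lborel (\<lambda>x. g x * complex_of_real (\<phi> x))"
proof -
  obtain R where R: "R > 0" "\<And>x. norm x > R \<Longrightarrow> \<phi> x = 0" using test_fun_support[OF \<phi>] by blast
  obtain B where B: "B > 0" "\<And>x. \<bar>\<phi> x\<bar> \<le> B" using test_fun_bounded[OF \<phi>] by blast
  have [measurable]: "g \<in> borel_measurable borel" using g by (simp add: loc_integrable_c_def)
  note \<phi>[measurable]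
  have "integrable lborel (\<lambda>x. indicator (cball 0 R) x *\<^sub>R g x)"
    using g compact_cball unfolding loc_integrable_c_def set_integrable_def by blast
  then have "integrable lborel (\<lambda>x. B *\<^sub>R (indicator (cball 0 R) x *\<^sub>R g x))"
    by (rule integrable_scaleR_right)
  then show ?thesis
  proof (rule Bochner_Integration.integrable_bound)
    show "AE x in lborel. norm (g x * complex_of_real (\<phi> x)) \<le> norm (B *\<^sub>R (indicator (cball 0 R) x *\<^sub>R g x))"
    proof (rule AE_I2)
      fix x
      show "norm (g x * complex_of_real (\<phi> x)) \<le> norm (B *\<^sub>R (indicator (cball 0 R) x *\<^sub>R g x))"
        using B(1) B(2)[of x] R(2)[of x]
        by (cases "norm x > R") (auto simp: norm_mult mult.commute[of B] intro!: mult_left_mono)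
    qed
  qed measurable
qed

text \<open>Box indicators are limits of test functions dominated by the indicator of the closed
  box. Since \<open>g\<close> is only locally integrable, the box criterion is applied to its
  restrictions to growing boxes.\<close>

lemma fundamental_lemma_test_fun:
  assumes g: "loc_integrable_c g"
    and Z: "\<And>\<phi>. test_fun \<phi> \<Longrightarrow> (\<integral>x. g x * complex_of_real (\<phi> x) \<partial>lborel) = 0"
  shows "AE x in lborel. g x = (0::complex)"
proof -
  have [measurable]: "g \<in> borel_measurable borel" using g by (simp add: loc_integrable_c_def)
  have int: "integrable lborel (\<lambda>x. indicator (cbox a b) x *\<^sub>R g x)" for a b
    using g compact_cbox unfolding loc_integrable_c_def set_integrable_def by blast
  have boxz: "(\<integral>x. indicator (box a b) x *\<^sub>R g x \<partial>lborel) = 0" for a b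
  proof -
    obtain \<phi> where \<phi>: "\<And>k. test_fun (\<phi> k)" "\<And>k x. 0 \<le> \<phi> k x \<and> \<phi> k x \<le> indicator (box a b) x"
      "\<And>x. (\<lambda>k. \<phi> k x) \<longlonglongrightarrow> indicator (box a b) x"
      using test_fun_approx_box[of a b] by blast
    have [measurable]: "\<phi> k \<in> borel_measurable borel" for k using \<phi>(1)[of k] by measurable
    have "(\<lambda>k. \<integral>x. g x * complex_of_real (\<phi> k x) \<partial>lborel) \<longlonglongrightarrow> (\<integral>x. g x * complex_of_real (indicator (box a b) x) \<partial>lborel)"
    proof (rule integral_dominated_convergence[where w="\<lambda>x. norm (indicator (cbox a b) x *\<^sub>R g x)"])
      show "AE x in lborel. (\<lambda>k. g x * complex_of_real (\<phi> k x)) \<longlonglongrightarrow> g x * complex_of_real (indicator (box a b) x)"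
        using \<phi>(3) by (intro AE_I2 tendsto_intros)
      show "AE x in lborel. norm (g x * complex_of_real (\<phi> k x)) \<le> norm (indicator (cbox a b) x *\<^sub>R g x)" for k
      proof (rule AE_I2)
        fix x
        have "\<bar>\<phi> k x\<bar> \<le> indicator (cbox a b) x"
          using \<phi>(2)[of k x] box_subset_cbox[of a b] by (cases "x \<in> box a b") (auto simp: indicator_def)
        then show "norm (g x * complex_of_real (\<phi> k x)) \<le> norm (indicator (cbox a b) x *\<^sub>R g x)"
          by (auto simp: norm_mult mult.commute intro!: mult_left_mono)
      qed
      show "integrable lborel (\<lambda>x. norm (indicator (cbox a b) x *\<^sub>R g x))" by (intro integrable_norm int)
    qed measurable
    then have "(\<integral>x. g x * complex_of_real (indicator (box a b) x) \<partial>lborel) = 0"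
      using Z[OF \<phi>(1)] LIMSEQ_unique[OF tendsto_const] by force
    then show ?thesis by (simp add: scaleR_conv_of_real mult.commute)
  qed
  have "AE x in lborel. indicator (box (- real n *\<^sub>R One) (real n *\<^sub>R One)) x *\<^sub>R g x = 0" for n
  proof (rule AE_zero_if_box_integrals_zero)
    have "integrable lborel (\<lambda>x. indicator (box (- real n *\<^sub>R One) (real n *\<^sub>R One)) x *\<^sub>R (indicator (cbox (- real n *\<^sub>R One) (real n *\<^sub>R One)) x *\<^sub>R g x))"
      by (intro integrable_mult_indicator int) auto
    also have "(\<lambda>x. indicator (box (- real n *\<^sub>R One) (real n *\<^sub>R One)) x *\<^sub>R (indicator (cbox (- real n *\<^sub>R One) (real n *\<^sub>R One)) x *\<^sub>R g x))
      = (\<lambda>x. indicator (box (- real n *\<^sub>R One) (real n *\<^sub>R One)) x *\<^sub>R g x)"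
      using box_subset_cbox by (force simp: indicator_def)
    finally show "integrable lborel (\<lambda>x. indicator (box (- real n *\<^sub>R One) (real n *\<^sub>R One)) x *\<^sub>R g x)" .
    show "(\<integral>x. indicator (box a b) x *\<^sub>R indicator (box (- real n *\<^sub>R One) (real n *\<^sub>R One)) x *\<^sub>R g x \<partial>lborel) = 0" for a b
      using boxz by (simp add: indicator_inter_arith[symmetric] box_Int_box)
  qed
  then have "AE x in lborel. \<forall>n. indicator (box (- real n *\<^sub>R One) (real n *\<^sub>R One)) x *\<^sub>R g x = 0"
    by (subst AE_all_countable) blast
  then show ?thesis
  proof eventually_elim
    case (elim x)
    obtain N :: nat where N: "norm x < real N" using reals_Archimedean2 by blast
    have "x \<in> box (- real N *\<^sub>R One) (real N *\<^sub>R One)"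
      unfolding mem_box using N Basis_le_norm[of _ x] by (force simp: abs_le_iff)
    then show ?case using elim[rule_format, of N] by simp
  qed
qed

section \<open>Powers of the norm: completeness and Hoelder's inequality\<close>

lemma norm_add_powr_le:
  fixes a b :: "'a::real_normed_vector"
  assumes "p \<ge> 0"
  shows "norm (a + b) powr p \<le> 2 powr p * (norm a powr p + norm b powr p)"
proof -
  have "norm (a + b) \<le> 2 * max (norm a) (norm b)"
    using norm_triangle_ineq[of a b] by linarith
  then have "norm (a + b) powr p \<le> (2 * max (norm a) (norm b)) powr p"
    using assms by (intro powr_mono2) auto
  also have "\<dots> = 2 powr p * max (norm a) (norm b) powr p"
    by (simp add: powr_mult)
  also have "\<dots> \<le> 2 powr p * (norm a powr p + norm b powr p)"
    by (intro mult_left_mono) (auto simp: max_def)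
  finally show ?thesis .
qed

lemma integrable_powr_add:
  fixes f g :: "'a \<Rightarrow> 'b::{banach,second_countable_topology}"
  assumes [measurable]: "f \<in> borel_measurable M" "g \<in> borel_measurable M" and "p \<ge> 0"
    and f: "integrable M (\<lambda>x. norm (f x) powr p)" and g: "integrable M (\<lambda>x. norm (g x) powr p)"
  shows "integrable M (\<lambda>x. norm (f x + g x) powr p)"
proof (rule Bochner_Integration.integrable_bound)
  show "integrable M (\<lambda>x. 2 powr p * (norm (f x) powr p + norm (g x) powr p))" using f g by auto
  show "AE x in M. norm (norm (f x + g x) powr p) \<le> norm (2 powr p * (norm (f x) powr p + norm (g x) powr p))"
    using norm_add_powr_le[OF \<open>p \<ge> 0\<close>] by (intro AE_I2) (auto intro: order_trans[OF _ abs_ge_self])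
qed measurable

lemma integrable_powr_diff:
  fixes f g :: "'a \<Rightarrow> 'b::{banach,second_countable_topology}"
  assumes "f \<in> borel_measurable M" "g \<in> borel_measurable M" and "p \<ge> 0"
    and "integrable M (\<lambda>x. norm (f x) powr p)" and "integrable M (\<lambda>x. norm (g x) powr p)"
  shows "integrable M (\<lambda>x. norm (f x - g x) powr p)"
  using integrable_powr_add[of f M "\<lambda>x. - g x" p] assms by simp

text \<open>Along a fast subsequence the increments, enlarged by 2^k and raised to the power p, have
  summable integrals; hence almost everywhere they are eventually below 2^(-k) and the subsequence
  converges. The subsequence is part of the conclusion because signs and Fatou's lemma will later be
  transported along it.\<close>

lemma Lp_complete:
  fixes f :: "nat \<Rightarrow> 'a \<Rightarrow> 'b::{banach,second_countable_topology}"
  assumes p: "p > 0" and f[measurable]: "\<And>n. f n \<in> borel_measurable M"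
    and int: "\<And>n. integrable M (\<lambda>x. norm (f n x) powr p)"
    and Cauchy: "\<And>e. e > 0 \<Longrightarrow> \<exists>N. \<forall>m\<ge>N. \<forall>n\<ge>N. (\<integral>x. norm (f m x - f n x) powr p \<partial>M) < e"
  obtains g r where "g \<in> borel_measurable M" "integrable M (\<lambda>x. norm (g x) powr p)" "strict_mono r"
    "AE x in M. (\<lambda>k. f (r k) x) \<longlonglongrightarrow> g x" "(\<lambda>n. \<integral>x. norm (f n x - g x) powr p \<partial>M) \<longlonglongrightarrow> 0"
proof -
  have intd: "integrable M (\<lambda>x. norm (f m x - f n x) powr p)" for m n
    using p int by (intro integrable_powr_diff) auto
  \<comment> \<open>The factor \<open>((1/2) ^ k) powr p\<close> cancels the enlargement by 2^k in
    \<open>T\<close>; the factor \<open>(1/2) ^ k\<close> is what remains and is summable.\<close>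
  define e where "e = (\<lambda>k::nat. (1/2) ^ k * ((1/2) ^ k) powr p :: real)"
  have "\<exists>N. \<forall>m\<ge>N. \<forall>n\<ge>N. (\<integral>x. norm (f m x - f n x) powr p \<partial>M) < e k" for k
    using Cauchy[of "e k"] by (simp add: e_def)
  then obtain N where N: "\<And>k m n. m \<ge> N k \<Longrightarrow> n \<ge> N k \<Longrightarrow> (\<integral>x. norm (f m x - f n x) powr p \<partial>M) < e k"
    by metis
  \<comment> \<open>Summing \<open>N i + 1\<close> yields strict monotonicity and
    \<open>r k \<ge> N k\<close> at once.\<close>
  define r where "r = (\<lambda>k::nat. \<Sum>i\<le>k. N i + 1)"
  have sm: "strict_mono r" by (auto simp: strict_mono_Suc_iff r_def)
  have rN: "r k \<ge> N k" for k
  proof -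
    have "N k + 1 \<le> (\<Sum>i\<le>k. N i + 1)" by (rule member_le_sum) auto
    then show ?thesis by (simp add: r_def)
  qed
  define D where "D = (\<lambda>k x. norm (f (r (Suc k)) x - f (r k) x))"
  define T where "T = (\<lambda>k x. (2 ^ k * D k x) powr p)"
  have [measurable]: "T k \<in> borel_measurable M" for k unfolding T_def D_def by measurable
  have T0: "T k x \<ge> 0" for k x by (simp add: T_def)
  have Tint: "(\<integral>\<^sup>+x. ennreal (T k x) \<partial>M) \<le> ennreal ((1/2) ^ k)" for k
  proof -
    have eq: "T k x = (2 ^ k) powr p * norm (f (r (Suc k)) x - f (r k) x) powr p" for x
      by (simp add: T_def D_def powr_mult)
    have "(\<integral>\<^sup>+x. ennreal (T k x) \<partial>M) = ennreal (\<integral>x. T k x \<partial>M)"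
      unfolding eq by (intro nn_integral_eq_integral) (auto intro!: integrable_mult_right intd)
    also have "(\<integral>x. T k x \<partial>M) = (2 ^ k) powr p * (\<integral>x. norm (f (r (Suc k)) x - f (r k) x) powr p \<partial>M)"
      unfolding eq by simp
    also have "\<dots> \<le> (2 ^ k) powr p * e k"
    proof (rule mult_left_mono[OF less_imp_le[OF N]])
      show "N k \<le> r (Suc k)" using rN[of k] strict_monoD[OF sm, of k "Suc k"] by simp
    qed (simp_all add: rN)
    also have "\<dots> = (1/2) ^ k"
      by (simp add: e_def powr_mult[symmetric] power_mult_distrib[symmetric])
    finally show ?thesis by (simp add: ennreal_leI)
  qed
  have "(\<integral>\<^sup>+x. (\<Sum>k. ennreal (T k x)) \<partial>M) = (\<Sum>k. \<integral>\<^sup>+x. ennreal (T k x) \<partial>M)"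
    by (intro nn_integral_suminf) measurable
  also have "\<dots> \<le> (\<Sum>k. ennreal ((1/2) ^ k))" by (intro suminf_le Tint) auto
  also have "\<dots> = ennreal (\<Sum>k. (1/2) ^ k)"
    by (intro suminf_ennreal2) (auto intro!: summable_geometric)
  also have "\<dots> < \<infinity>" by simp
  finally have "(\<integral>\<^sup>+x. (\<Sum>k. ennreal (T k x)) \<partial>M) \<noteq> \<infinity>" by auto
  then have "AE x in M. (\<Sum>k. ennreal (T k x)) \<noteq> \<infinity>" by (intro nn_integral_PInf_AE) auto
  then have conv: "AE x in M. convergent (\<lambda>k. f (r k) x)"
  proof (rule eventually_mono)
    fix x assume "(\<Sum>k. ennreal (T k x)) \<noteq> \<infinity>"
    then have "summable (\<lambda>k. T k x)" using T0 by (intro summable_suminf_not_top) auto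
    then have "(\<lambda>k. T k x) \<longlonglongrightarrow> 0" by (rule summable_LIMSEQ_zero)
    then have ev: "eventually (\<lambda>k. T k x < 1) sequentially" by (rule order_tendstoD) simp
    have "eventually (\<lambda>k. norm (f (r (Suc k)) x - f (r k) x) \<le> (1/2) ^ k) sequentially"
      using ev
    proof eventually_elim
      case (elim k)
      have "2 ^ k * D k x \<le> 1"
      proof (rule ccontr)
        assume "\<not> ?thesis"
        then have "1 powr p \<le> (2 ^ k * D k x) powr p" using p by (intro powr_mono2) auto
        then show False using elim by (simp add: T_def)
      qed
      then show ?case by (simp add: D_def field_simps)
    qed
    then have "summable (\<lambda>k. f (r (Suc k)) x - f (r k) x)"
      using summable_comparison_test_ev[of _ "\<lambda>k. (1/2) ^ k :: real"] by (simp add: summable_geometric)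
    then have "summable (\<lambda>k. f (r (Suc k)) x - f (r k) x)" .
    then have "convergent (\<lambda>n. \<Sum>k<n. f (r (Suc k)) x - f (r k) x)" by (simp add: summable_iff_convergent)
    then have "convergent (\<lambda>n. f (r n) x - f (r 0) x)" by (simp only: sum_lessThan_telescope[of "\<lambda>n. f (r n) x"])
    then have "convergent (\<lambda>n. f (r n) x - f (r 0) x + f (r 0) x)"
      by (intro convergent_add convergent_const)
    then show "convergent (\<lambda>n. f (r n) x)" by simp
  qed
  define g where "g = (\<lambda>x. lim (\<lambda>k. f (r k) x))"
  have [measurable]: "g \<in> borel_measurable M" unfolding g_def by measurable
  have lim: "AE x in M. (\<lambda>k. f (r k) x) \<longlonglongrightarrow> g x"
    using conv by (auto elim!: eventually_mono simp: g_def convergent_LIMSEQ_iff)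
  \<comment> \<open>Fatou in the index of the subsequence, with \<open>n\<close> fixed. The bound is
    stated for nonnegative integrals because integrability of the difference to \<open>g\<close> is
    still to be derived from it.\<close>
  have fat: "(\<integral>\<^sup>+x. ennreal (norm (f n x - g x) powr p) \<partial>M) \<le> ennreal e"
    if e: "e > 0" and n: "n \<ge> N'" and N': "\<forall>m\<ge>N'. \<forall>n\<ge>N'. (\<integral>x. norm (f m x - f n x) powr p \<partial>M) < e" for e n N'
  proof -
    have "(\<integral>\<^sup>+x. ennreal (norm (f n x - g x) powr p) \<partial>M)
        \<le> (\<integral>\<^sup>+x. liminf (\<lambda>k. ennreal (norm (f n x - f (r k) x) powr p)) \<partial>M)"
    proof (intro nn_integral_mono_AE, use lim in eventually_elim)
      case (elim x)
      have "(\<lambda>k. ennreal (norm (f n x - f (r k) x) powr p)) \<longlonglongrightarrow> ennreal (norm (f n x - g x) powr p)"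
        using p by (intro tendsto_ennrealI tendsto_powr' tendsto_norm tendsto_diff elim tendsto_const) auto
      from lim_imp_Liminf[OF _ this] show ?case by simp
    qed
    also have "\<dots> \<le> liminf (\<lambda>k. \<integral>\<^sup>+x. ennreal (norm (f n x - f (r k) x) powr p) \<partial>M)"
      by (intro nn_integral_liminf) measurable
    also have "\<dots> \<le> ennreal e"
    proof (rule Liminf_le)
      show "\<forall>\<^sub>F k in sequentially. (\<integral>\<^sup>+x. ennreal (norm (f n x - f (r k) x) powr p) \<partial>M) \<le> ennreal e"
      proof (rule eventually_sequentiallyI[of N'])
        fix k assume "N' \<le> k"
        then have "N' \<le> r k" using seq_suble[OF sm, of k] by simp
        then have "(\<integral>x. norm (f n x - f (r k) x) powr p \<partial>M) < e" using N' n by blast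
        then show "(\<integral>\<^sup>+x. ennreal (norm (f n x - f (r k) x) powr p) \<partial>M) \<le> ennreal e"
          by (subst nn_integral_eq_integral[OF intd]) (auto intro: ennreal_leI)
      qed
    qed auto
    finally show ?thesis .
  qed
  have intg': "integrable M (\<lambda>x. norm (f n x - g x) powr p) \<and> (\<integral>x. norm (f n x - g x) powr p \<partial>M) \<le> e"
    if "e > 0" "n \<ge> N'" "\<forall>m\<ge>N'. \<forall>n\<ge>N'. (\<integral>x. norm (f m x - f n x) powr p \<partial>M) < e" for e n N'
  proof -
    have I: "integrable M (\<lambda>x. norm (f n x - g x) powr p)"
      using fat[OF that] by (intro integrableI_bounded) (auto simp: le_less_trans)
    then have "ennreal (\<integral>x. norm (f n x - g x) powr p \<partial>M) \<le> ennreal e"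
      using fat[OF that] by (subst (asm) nn_integral_eq_integral) auto
    then show ?thesis using I that(1) by simp
  qed
  have "integrable M (\<lambda>x. norm (g x) powr p)"
  proof -
    obtain N' where N': "\<forall>m\<ge>N'. \<forall>n\<ge>N'. (\<integral>x. norm (f m x - f n x) powr p \<partial>M) < 1"
      using Cauchy[of 1] by auto
    then have "integrable M (\<lambda>x. norm (f N' x - g x) powr p)" using intg'[of 1 N' N'] by auto
    have "(\<lambda>x. f N' x - g x) \<in> borel_measurable M" by measurable
    from integrable_powr_diff[OF f[of N'] this less_imp_le[OF p] int[of N'] \<open>integrable M (\<lambda>x. norm (f N' x - g x) powr p)\<close>]
    show ?thesis by simp
  qed
  moreover have "(\<lambda>n. \<integral>x. norm (f n x - g x) powr p \<partial>M) \<longlonglongrightarrow> 0"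
  proof (rule LIMSEQ_I)
    fix e :: real assume "e > 0"
    then obtain N' where N': "\<forall>m\<ge>N'. \<forall>n\<ge>N'. (\<integral>x. norm (f m x - f n x) powr p \<partial>M) < e/2"
      using Cauchy[of "e/2"] by auto
    show "\<exists>N'. \<forall>n\<ge>N'. norm ((\<integral>x. norm (f n x - g x) powr p \<partial>M) - 0) < e"
    proof (intro exI[of _ N'] allI impI)
      fix n assume "n \<ge> N'"
      then have "(\<integral>x. norm (f n x - g x) powr p \<partial>M) \<le> e/2"
        using intg'[of "e/2" N' n] \<open>e > 0\<close> N' by auto
      moreover have "(\<integral>x. norm (f n x - g x) powr p \<partial>M) \<ge> 0" by (intro integral_nonneg_AE) auto
      ultimately show "norm ((\<integral>x. norm (f n x - g x) powr p \<partial>M) - 0) < e" using \<open>e > 0\<close> by simp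
    qed
  qed
  ultimately show ?thesis using that[OF _ _ sm lim] \<open>g \<in> borel_measurable M\<close> by blast
qed

lemma
  fixes f g :: "'a \<Rightarrow> real"
  assumes p: "p > 1" "q > 1" "1/p + 1/q = 1"
    and [measurable]: "f \<in> borel_measurable M" "g \<in> borel_measurable M"
    and f: "integrable M (\<lambda>x. \<bar>f x\<bar> powr p)" and g: "integrable M (\<lambda>x. \<bar>g x\<bar> powr q)"
  shows integrable_Hoelder: "integrable M (\<lambda>x. f x * g x)"
    and Hoelder_inequality: "(\<integral>x. \<bar>f x * g x\<bar> \<partial>M) \<le> (\<integral>x. \<bar>f x\<bar> powr p \<partial>M) powr (1/p) * (\<integral>x. \<bar>g x\<bar> powr q \<partial>M) powr (1/q)"
proof -
  have Y: "\<bar>f x * g x\<bar> \<le> \<bar>f x\<bar> powr p / p + \<bar>g x\<bar> powr q / q" for x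
    using Youngs_inequality[of p q "\<bar>f x\<bar>" "\<bar>g x\<bar>"] p by (simp add: abs_mult)
  show int: "integrable M (\<lambda>x. f x * g x)"
  proof (rule Bochner_Integration.integrable_bound)
    show "integrable M (\<lambda>x. \<bar>f x\<bar> powr p / p + \<bar>g x\<bar> powr q / q)" using f g by auto
    show "AE x in M. norm (f x * g x) \<le> norm (\<bar>f x\<bar> powr p / p + \<bar>g x\<bar> powr q / q)"
      using Y by (intro AE_I2) (auto intro: order_trans[OF _ abs_ge_self])
  qed measurable
  define A where "A = (\<integral>x. \<bar>f x\<bar> powr p \<partial>M)"
  define B where "B = (\<integral>x. \<bar>g x\<bar> powr q \<partial>M)"
  have AB: "A \<ge> 0" "B \<ge> 0" unfolding A_def B_def by (auto intro!: integral_nonneg_AE)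
  show "(\<integral>x. \<bar>f x * g x\<bar> \<partial>M) \<le> A powr (1/p) * B powr (1/q)"
  proof (cases "A = 0 \<or> B = 0")
    case True
    then have "(AE x in M. \<bar>f x\<bar> powr p = 0) \<or> (AE x in M. \<bar>g x\<bar> powr q = 0)"
      using integral_nonneg_eq_0_iff_AE[OF f] integral_nonneg_eq_0_iff_AE[OF g] by (auto simp: A_def B_def)
    then have "AE x in M. \<bar>f x * g x\<bar> = 0" by (auto elim!: eventually_mono)
    then have "(\<integral>x. \<bar>f x * g x\<bar> \<partial>M) = (\<integral>x. 0 \<partial>M)"
      by (intro integral_cong_AE) auto
    then show ?thesis by simp
  next
    case False
    then have pos: "A > 0" "B > 0" using AB by auto
    define a where "a = A powr (1/p)"
    define b where "b = B powr (1/q)"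
    have ab: "a > 0" "b > 0" "a powr p = A" "b powr q = B"
      using pos p by (auto simp: a_def b_def powr_powr)
    have Y2: "\<bar>f x * g x\<bar> \<le> a * b * (\<bar>f x\<bar> powr p / (p * A) + \<bar>g x\<bar> powr q / (q * B))" for x
    proof -
      have "(\<bar>f x\<bar> / a) * (\<bar>g x\<bar> / b) \<le> (\<bar>f x\<bar> / a) powr p / p + (\<bar>g x\<bar> / b) powr q / q"
        using Youngs_inequality[of p q "\<bar>f x\<bar> / a" "\<bar>g x\<bar> / b"] p ab by simp
      also have "\<dots> = \<bar>f x\<bar> powr p / (p * A) + \<bar>g x\<bar> powr q / (q * B)"
        using ab by (simp add: powr_divide mult.commute)
      finally show ?thesis using ab by (simp add: abs_mult field_simps)
    qed
    have "(\<integral>x. \<bar>f x * g x\<bar> \<partial>M) \<le> (\<integral>x. a * b * (\<bar>f x\<bar> powr p / (p * A) + \<bar>g x\<bar> powr q / (q * B)) \<partial>M)"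
      using f g int Y2 by (intro integral_mono) auto
    also have "\<dots> = a * b * (A / (p * A) + B / (q * B))"
      using f g by (simp add: A_def B_def)
    also have "\<dots> = a * b" using pos p by simp
    finally show ?thesis by (simp add: a_def b_def)
  qed
qed

section \<open>Convexity of powers\<close>

lemma Bernoulli_powr_strict:
  fixes t :: real
  assumes "q > 1" "t \<ge> 0" "t \<noteq> 1"
  shows "t powr q > 1 + q * (t - 1)"
proof -
  have D: "((\<lambda>t. t powr q) has_real_derivative q * z powr (q - 1)) (at z)" if "z > 0" for z
    using that by (auto intro!: derivative_eq_intros)
  consider "t = 0" | "0 < t" "t < 1" | "t > 1" using assms by linarith
  then show ?thesis
  proof cases
    case 1
    then show ?thesis using assms by simp
  next
    case 2
    obtain z where z: "z > t" "z < 1" "1 powr q - t powr q = (1 - t) * (q * z powr (q - 1))"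
      using MVT2[of t 1 "\<lambda>t. t powr q" "\<lambda>z. q * z powr (q - 1)"] 2 D by auto
    have "z powr (q - 1) < 1 powr (q - 1)" using z 2 assms by (intro powr_less_mono2) auto
    then have "(1 - t) * (q * z powr (q - 1)) < (1 - t) * (q * 1)"
      using 2 assms by (intro mult_strict_left_mono) auto
    then show ?thesis using z by (simp add: algebra_simps)
  next
    case 3
    obtain z where z: "z > 1" "z < t" "t powr q - 1 powr q = (t - 1) * (q * z powr (q - 1))"
      using MVT2[of 1 t "\<lambda>t. t powr q" "\<lambda>z. q * z powr (q - 1)"] 3 D by auto
    have "1 powr (q - 1) < z powr (q - 1)" using z 3 assms by (intro powr_less_mono2) auto
    then have "(t - 1) * (q * 1) < (t - 1) * (q * z powr (q - 1))"
      using 3 assms by (intro mult_strict_left_mono) auto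
    then show ?thesis using z by (simp add: algebra_simps)
  qed
qed

text \<open>Bernoulli's inequality at a/b, multiplied by b^q. The slope is taken at
  \<open>b\<close>, the end of the increment: this form bounds the increment from above.\<close>

lemma powr_tangent:
  fixes a b :: real
  assumes q: "q > 1" and ab: "a \<ge> 0" "b \<ge> 0"
  shows "b powr q - a powr q \<le> q * b powr (q - 1) * (b - a)"
proof (cases "b = 0")
  case False
  then have b: "b > 0" using ab by simp
  have "1 + q * (a/b - 1) \<le> (a/b) powr q"
    using Bernoulli_powr_strict[of q "a/b"] q ab by (cases "a/b = 1") auto
  then have "b powr q * (1 + q * (a/b - 1)) \<le> b powr q * (a/b) powr q"
    by (intro mult_left_mono) auto
  moreover have "b powr q * (a/b) powr q = a powr q"
    using b ab by (simp add: powr_divide)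
  moreover have "b powr q * (1 + q * (a/b - 1)) = b powr q - q * b powr (q - 1) * (b - a)"
  proof -
    have "b powr q = b powr (q - 1) * b"
      using b by (simp add: powr_mult_base mult.commute)
    then have "b powr q * (1 + q * (a/b - 1)) = b powr q + q * b powr (q - 1) * (b * (a/b - 1))"
      by (simp only: distrib_left mult.assoc mult.left_commute mult_1_right)
    also have "b * (a/b - 1) = - (b - a)" using b by (simp add: field_simps)
    finally show ?thesis by (simp only: mult_minus_right diff_conv_add_uminus)
  qed
  ultimately show ?thesis by linarith
qed simp

definition powr_gap :: "real \<Rightarrow> real \<Rightarrow> real \<Rightarrow> real" where
  "powr_gap q a b = (a powr q + b powr q) / 2 - ((a + b) / 2) powr q"

lemma powr_gap_sym: "powr_gap q a b = powr_gap q b a"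
  by (simp add: powr_gap_def add.commute)

text \<open>After division by the midpoint m, the points s/m and 1/m average to 1, so the linear
  terms of the two strict Bernoulli inequalities cancel.\<close>

lemma powr_gap_pos_unit:
  assumes q: "q > 1" and s: "0 \<le> s" "s \<noteq> 1"
  shows "powr_gap q s 1 > 0"
proof -
  define m where "m = (s + 1) / 2"
  have m: "m > 0" "s / m \<noteq> 1" "1 / m \<noteq> 1" using s by (auto simp: m_def field_simps)
  have 1: "(s/m) powr q > 1 + q * (s/m - 1)" using Bernoulli_powr_strict[of q "s/m"] q m s by auto
  have 2: "(1/m) powr q > 1 + q * (1/m - 1)" using Bernoulli_powr_strict[of q "1/m"] q m s by auto
  have "s/m + 1/m = (s + 1) / m" by (simp add: add_divide_distrib)
  also have "s + 1 = 2 * m" by (simp add: m_def)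
  finally have "s/m + 1/m = 2" using m(1) by simp
  then have "q * (s/m - 1) + q * (1/m - 1) = 0"
    by (simp add: distrib_left[symmetric])
  then have "(s/m) powr q + (1/m) powr q > 2" using 1 2 by linarith
  then have "(s powr q + 1) / m powr q > 2" using m s by (simp add: powr_divide add_divide_distrib)
  then have "2 * m powr q < s powr q + 1" using m by (simp add: field_simps)
  then show ?thesis unfolding powr_gap_def m_def[symmetric] by simp
qed

text \<open>Add the tangent inequalities with slope at the midpoint; the two linear terms
  cancel.\<close>

lemma powr_gap_nonneg:
  assumes q: "q > 1" and "a \<ge> 0" "b \<ge> 0"
  shows "powr_gap q a b \<ge> 0"
proof -
  define m where "m = (a + b) / 2"
  have "m powr q - a powr q \<le> q * m powr (q - 1) * (m - a)"
    "m powr q - b powr q \<le> q * m powr (q - 1) * (m - b)"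
    by (rule powr_tangent; use assms in \<open>simp add: m_def\<close>)+
  then have "2 * m powr q - (a powr q + b powr q) \<le> q * m powr (q - 1) * ((m - a) + (m - b))"
    unfolding distrib_left by linarith
  also have "(m - a) + (m - b) = 0" by (simp add: m_def field_simps)
  finally show ?thesis by (simp add: powr_gap_def m_def)
qed

text \<open>Uniform convexity in a form that survives integration without Clarkson's inequalities;
  the constant comes from compactness of the unit interval after scaling.\<close>

lemma powr_gap_uniform:
  assumes q: "q > 1" and \<epsilon>: "\<epsilon> > 0"
  obtains C where "C \<ge> 0" "\<And>a b. a \<ge> 0 \<Longrightarrow> b \<ge> 0 \<Longrightarrow>
    \<bar>a - b\<bar> powr q \<le> \<epsilon> * (a powr q + b powr q) + C * powr_gap q a b"
proof -
  \<comment> \<open>Off \<open>K\<close> the term with \<epsilon> suffices alone. On the compact set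
    \<open>K\<close>, which omits 1, the defect has a positive minimum \<delta>, and C = 1/\<delta>
    works since |s - 1|^q is at most 1 there.\<close>
  define K where "K = {s \<in> {0..1::real}. \<epsilon> \<le> \<bar>s - 1\<bar> powr q}"
  have cont: "continuous_on {0..1} (\<lambda>s::real. \<bar>s - 1\<bar> powr q)"
    using q by (intro continuous_on_powr' continuous_intros) auto
  have "closedin (top_of_set {0..1}) ({0..1} \<inter> (\<lambda>s. \<bar>s - 1\<bar> powr q) -` {\<epsilon>..})"
    by (rule continuous_closedin_preimage[OF cont]) auto
  moreover have "{0..1} \<inter> (\<lambda>s. \<bar>s - 1\<bar> powr q) -` {\<epsilon>..} = K" by (auto simp: K_def)
  ultimately have "compact K" using closedin_compact[OF compact_Icc] by simp
  have contg: "continuous_on K (\<lambda>s. powr_gap q s 1)"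
    unfolding powr_gap_def using q
    by (intro continuous_intros continuous_on_powr') (auto simp: K_def)
  have "\<exists>C\<ge>0. \<forall>s\<in>{0..1}. \<bar>s - 1\<bar> powr q \<le> \<epsilon> * (s powr q + 1) + C * powr_gap q s 1"
  proof (cases "K = {}")
    case True
    have "\<bar>s - 1\<bar> powr q \<le> \<epsilon> * (s powr q + 1)" if "s \<in> {0..1}" for s
    proof -
      have "\<bar>s - 1\<bar> powr q \<le> \<epsilon>" using True that by (force simp: K_def)
      moreover have "\<epsilon> * 1 \<le> \<epsilon> * (s powr q + 1)" using \<epsilon> by (intro mult_left_mono) auto
      ultimately show ?thesis by simp
    qed
    then show ?thesis by (intro exI[of _ 0]) auto
  next
    case False
    obtain s0 where s0: "s0 \<in> K" "\<And>s. s \<in> K \<Longrightarrow> powr_gap q s0 1 \<le> powr_gap q s 1"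
      using continuous_attains_inf[OF \<open>compact K\<close> False contg] by auto
    define \<delta> where "\<delta> = powr_gap q s0 1"
    have "s0 \<noteq> 1" using s0(1) \<epsilon> by (auto simp: K_def)
    then have \<delta>: "\<delta> > 0" unfolding \<delta>_def using s0(1) q by (intro powr_gap_pos_unit) (auto simp: K_def)
    have "\<bar>s - 1\<bar> powr q \<le> \<epsilon> * (s powr q + 1) + 1/\<delta> * powr_gap q s 1" if s: "s \<in> {0..1}" for s
    proof (cases "s \<in> K")
      case True
      have "\<bar>s - 1\<bar> powr q \<le> 1 powr q" using s q by (intro powr_mono2) auto
      also have "1 powr q \<le> 1/\<delta> * powr_gap q s 1" using s0(2)[OF True] \<delta> by (simp add: \<delta>_def[symmetric] field_simps)
      finally show ?thesis using \<epsilon> by (simp add: add_increasing)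
    next
      case False
      then have "\<bar>s - 1\<bar> powr q \<le> \<epsilon>" using s by (force simp: K_def)
      moreover have "\<epsilon> * 1 \<le> \<epsilon> * (s powr q + 1)" using \<epsilon> by (intro mult_left_mono) auto
      moreover have "1/\<delta> * powr_gap q s 1 \<ge> 0" using \<delta> powr_gap_nonneg[OF q, of s 1] s by auto
      ultimately show ?thesis by linarith
    qed
    then show ?thesis using \<delta> by (intro exI[of _ "1/\<delta>"]) auto
  qed
  then obtain C where C: "C \<ge> 0" "\<And>s. 0 \<le> s \<Longrightarrow> s \<le> 1 \<Longrightarrow> \<bar>s - 1\<bar> powr q \<le> \<epsilon> * (s powr q + 1) + C * powr_gap q s 1"
    by auto
  have main: "\<bar>a - b\<bar> powr q \<le> \<epsilon> * (a powr q + b powr q) + C * powr_gap q a b" if ab: "0 \<le> a" "a \<le> b" for a b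
  proof (cases "b = 0")
    case True
    then show ?thesis using ab by (simp add: powr_gap_def)
  next
    case False
    then have b: "b > 0" using ab by simp
    have sc: "(b * x) powr q = b powr q * x powr q" for x by (simp add: powr_mult)
    have g: "powr_gap q a b = b powr q * powr_gap q (a/b) 1"
    proof -
      have "(a + b) / 2 = b * ((a/b + 1) / 2)" using b by (simp add: field_simps)
      then have "((a + b) / 2) powr q = b powr q * ((a/b + 1) / 2) powr q" by (simp only: sc)
      moreover have "a powr q = b powr q * (a/b) powr q" using sc[of "a/b"] b by simp
      ultimately show ?thesis by (simp add: powr_gap_def algebra_simps add_divide_distrib)
    qed
    have "\<bar>a - b\<bar> = b * \<bar>a/b - 1\<bar>" using b by (simp add: field_simps abs_if)
    then have e1: "\<bar>a - b\<bar> powr q = b powr q * \<bar>a/b - 1\<bar> powr q" by (simp only: sc)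
    have e2: "a powr q = b powr q * (a/b) powr q" using sc[of "a/b"] b by simp
    have "b powr q * \<bar>a/b - 1\<bar> powr q \<le> b powr q * (\<epsilon> * ((a/b) powr q + 1) + C * powr_gap q (a/b) 1)"
      using ab b by (intro mult_left_mono C) (auto simp: field_simps)
    also have "\<dots> = \<epsilon> * (b powr q * (a/b) powr q + b powr q) + C * (b powr q * powr_gap q (a/b) 1)"
      by (simp add: algebra_simps)
    finally show ?thesis by (simp only: e1 g e2[symmetric])
  qed
  show ?thesis
  proof (rule that[of C])
    fix a b :: real assume "a \<ge> 0" "b \<ge> 0"
    then show "\<bar>a - b\<bar> powr q \<le> \<epsilon> * (a powr q + b powr q) + C * powr_gap q a b"
      using main[of a b] main[of b a] by (cases "a \<le> b") (auto simp: powr_gap_sym[of q a b] abs_minus_commute add.commute)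
  qed (use C in auto)
qed

section \<open>Fourier transforms of integrable functions\<close>

definition cft :: "(real^'n \<Rightarrow> complex) \<Rightarrow> real^'n \<Rightarrow> complex" where
  "cft u \<xi> = (\<integral>x. cis (- 2 * pi * (x \<bullet> \<xi>)) * u x \<partial>lborel)"

lemma fourier_cft: "fourier u = cft (\<lambda>x. complex_of_real (u x))"
  by (simp add: fourier_def cft_def fun_eq_iff)

lemma cis_measurable [measurable]: "cis \<in> borel_measurable borel"
  by (intro borel_measurable_continuous_onI continuous_intros)

lemma integrable_cis_mult:
  fixes u :: "'a \<Rightarrow> complex" and h :: "'a \<Rightarrow> real"
  assumes u: "integrable M u" and [measurable]: "h \<in> borel_measurable M"
  shows "integrable M (\<lambda>x. cis (h x) * u x)"
  by (rule Bochner_Integration.integrable_bound[OF u]) (use u in \<open>auto simp: norm_mult\<close>)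

lemma cft_measurable [measurable (raw)]:
  assumes [measurable]: "u \<in> borel_measurable borel"
  shows "cft u \<in> borel_measurable borel"
  unfolding cft_def[abs_def] by measurable

lemma fourier_measurable [measurable (raw)]:
  "u \<in> borel_measurable borel \<Longrightarrow> fourier u \<in> borel_measurable borel"
  unfolding fourier_cft by measurable

lemma cft_bound: "cmod (cft u \<xi>) \<le> (\<integral>x. cmod (u x) \<partial>lborel)"
  unfolding cft_def using integral_norm_bound[of lborel "\<lambda>x. cis (- 2 * pi * (x \<bullet> \<xi>)) * u x"]
  by (simp add: norm_mult)

lemma cft_add:
  assumes "integrable lborel u" "integrable lborel v"
  shows "cft (\<lambda>x. u x + v x) \<xi> = cft u \<xi> + cft v \<xi>"
  using assms by (simp add: cft_def distrib_left integrable_cis_mult)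

lemma cft_cmult: "cft (\<lambda>x. c * u x) \<xi> = c * cft u \<xi>"
  by (simp add: cft_def mult.left_commute)

lemma cft_diff:
  assumes "integrable lborel u" "integrable lborel v"
  shows "cft (\<lambda>x. u x - v x) \<xi> = cft u \<xi> - cft v \<xi>"
  using assms by (simp add: cft_def right_diff_distrib integrable_cis_mult)

lemma fourier_add:
  assumes "integrable lborel u" "integrable lborel v"
  shows "fourier (\<lambda>x. u x + v x) \<xi> = fourier u \<xi> + fourier v \<xi>"
  using cft_add[of "\<lambda>x. complex_of_real (u x)" "\<lambda>x. complex_of_real (v x)"] assms by (simp add: fourier_cft)

lemma fourier_diff:
  assumes "integrable lborel u" "integrable lborel v"
  shows "fourier (\<lambda>x. u x - v x) \<xi> = fourier u \<xi> - fourier v \<xi>"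
  using cft_diff[of "\<lambda>x. complex_of_real (u x)" "\<lambda>x. complex_of_real (v x)"] assms by (simp add: fourier_cft)

lemma fourier_cmult: "fourier (\<lambda>x. c * u x) \<xi> = complex_of_real c * fourier u \<xi>"
  using cft_cmult[of "complex_of_real c" "\<lambda>x. complex_of_real (u x)"] by (simp add: fourier_cft)

lemma fourier_uminus_arg: "fourier u (- \<xi>) = cnj (fourier u \<xi>)"
  unfolding fourier_def by (subst Bochner_Integration.integral_cnj[symmetric]) (simp add: cis_cnj)

lemma integrable_pair_kernel:
  fixes u v :: "'a::euclidean_space \<Rightarrow> complex"
  assumes u: "integrable lborel u" and v: "integrable lborel v"
    and k[measurable]: "(\<lambda>(x,y). k x y) \<in> borel_measurable (borel \<Otimes>\<^sub>M borel)"
    and b: "\<And>x y. cmod (k x y) \<le> 1"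
  shows "integrable (lborel \<Otimes>\<^sub>M lborel) (\<lambda>(x,y). k x y * u x * v y)"
proof (rule lborel_pair.Fubini_integrable)
  have [measurable]: "u \<in> borel_measurable borel" "v \<in> borel_measurable borel" using u v by auto
  have b': "cmod (k x y) * (cmod (u x) * cmod (v y)) \<le> cmod (u x) * cmod (v y)" for x y
    using mult_right_mono[OF b[of x y], of "cmod (u x) * cmod (v y)"] by simp
  show "(\<lambda>(x,y). k x y * u x * v y) \<in> borel_measurable (lborel \<Otimes>\<^sub>M lborel)" by measurable
  have inner: "integrable lborel (\<lambda>y. k x y * u x * v y)" for x
  proof (rule Bochner_Integration.integrable_bound)
    show "integrable lborel (\<lambda>y. u x * v y)" using v by simp
    show "AE y in lborel. cmod (k x y * u x * v y) \<le> cmod (u x * v y)"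
      using b' by (intro AE_I2) (simp add: norm_mult mult.assoc)
  qed measurable
  then show "AE x in lborel. integrable lborel (\<lambda>y. case (x, y) of (x, y) \<Rightarrow> k x y * u x * v y)" by simp
  show "integrable lborel (\<lambda>x. \<integral>y. cmod (case (x, y) of (x, y) \<Rightarrow> k x y * u x * v y) \<partial>lborel)"
  proof (rule Bochner_Integration.integrable_bound)
    show "integrable lborel (\<lambda>x. cmod (u x) * (\<integral>y. cmod (v y) \<partial>lborel))"
      using u by (intro integrable_mult_left integrable_norm)
    show "AE x in lborel. norm (\<integral>y. cmod (case (x, y) of (x, y) \<Rightarrow> k x y * u x * v y) \<partial>lborel)
        \<le> norm (cmod (u x) * (\<integral>y. cmod (v y) \<partial>lborel))"
    proof (rule AE_I2)
      fix x
      have "(\<integral>y. cmod (k x y * u x * v y) \<partial>lborel) \<le> (\<integral>y. cmod (u x) * cmod (v y) \<partial>lborel)"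
      proof (rule integral_mono)
        show "integrable lborel (\<lambda>y. cmod (k x y * u x * v y))" by (rule integrable_norm[OF inner])
        show "integrable lborel (\<lambda>y. cmod (u x) * cmod (v y))" using v by simp
        show "cmod (k x y * u x * v y) \<le> cmod (u x) * cmod (v y)" for y
          using b'[of x y] by (simp add: norm_mult mult.assoc)
      qed
      moreover have "(\<integral>y. cmod (k x y * u x * v y) \<partial>lborel) \<ge> 0" by (intro integral_nonneg_AE) auto
      ultimately show "norm (\<integral>y. cmod (case (x, y) of (x, y) \<Rightarrow> k x y * u x * v y) \<partial>lborel)
        \<le> norm (cmod (u x) * (\<integral>y. cmod (v y) \<partial>lborel))" by simp
    qed
  qed measurable
qed

text \<open>Duality and the product formula below are both instances: the kernels are the characters
  in x \<bullet> y and, for fixed x, in (x - y) \<bullet> \<xi>.\<close>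

lemma Fubini_kernel:
  fixes u v :: "'a::euclidean_space \<Rightarrow> complex"
  assumes u: "integrable lborel u" and v: "integrable lborel v"
    and k: "(\<lambda>(x,y). k x y) \<in> borel_measurable (borel \<Otimes>\<^sub>M borel)"
    and b: "\<And>x y. cmod (k x y) \<le> 1"
  shows "(\<integral>y. (\<integral>x. k x y * u x \<partial>lborel) * v y \<partial>lborel) = (\<integral>x. u x * (\<integral>y. k x y * v y \<partial>lborel) \<partial>lborel)"
proof -
  have "(\<integral>y. (\<integral>x. k x y * u x \<partial>lborel) * v y \<partial>lborel) = (\<integral>y. (\<integral>x. k x y * u x * v y \<partial>lborel) \<partial>lborel)"
    by simp
  also have "\<dots> = (\<integral>x. (\<integral>y. k x y * u x * v y \<partial>lborel) \<partial>lborel)"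
    using lborel_pair.Fubini_integral[OF integrable_pair_kernel[OF u v k b]] by simp
  also have "\<dots> = (\<integral>x. u x * (\<integral>y. k x y * v y \<partial>lborel) \<partial>lborel)"
    by (simp add: mult.assoc mult.left_commute[of "k _ _"])
  finally show ?thesis .
qed

lemma cft_duality:
  fixes u v :: "real^'n \<Rightarrow> complex"
  assumes "integrable lborel u" "integrable lborel v"
  shows "(\<integral>x. cft u x * v x \<partial>lborel) = (\<integral>x. u x * cft v x \<partial>lborel)"
proof -
  have "(\<lambda>(x, y). cis (- 2 * pi * (x \<bullet> y))) \<in> borel_measurable (borel \<Otimes>\<^sub>M (borel :: (real^'n) measure))"
    by measurable
  from Fubini_kernel[OF assms this] show ?thesis
    unfolding cft_def by (simp add: inner_commute)
qed

text \<open>The transform of a product is a convolution; only Fubini is needed because one factor is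
  already written as a transform.\<close>

lemma cft_mult_cft:
  fixes u v :: "real^'n \<Rightarrow> complex"
  assumes u: "integrable lborel u" and v: "integrable lborel v"
  shows "cft (\<lambda>\<xi>. cft u (- \<xi>) * v \<xi>) x = (\<integral>y. u y * cft v (x - y) \<partial>lborel)"
proof -
  have m: "(\<lambda>(y, \<xi>). cis (- 2 * pi * ((x - y) \<bullet> \<xi>))) \<in> borel_measurable (borel \<Otimes>\<^sub>M (borel :: (real^'n) measure))"
    by measurable
  have "cft (\<lambda>\<xi>. cft u (- \<xi>) * v \<xi>) x = (\<integral>\<xi>. (\<integral>y. cis (- 2 * pi * ((x - y) \<bullet> \<xi>)) * u y \<partial>lborel) * v \<xi> \<partial>lborel)"
  proof -
    have "cis (- 2 * pi * (\<xi> \<bullet> x)) * (cft u (- \<xi>) * v \<xi>) = (\<integral>y. cis (- 2 * pi * ((x - y) \<bullet> \<xi>)) * u y \<partial>lborel) * v \<xi>" for \<xi>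
    proof -
      have "cis (- 2 * pi * (\<xi> \<bullet> x)) * cft u (- \<xi>) = (\<integral>y. cis (- 2 * pi * ((x - y) \<bullet> \<xi>)) * u y \<partial>lborel)"
      proof -
        have "cis (- 2 * pi * (\<xi> \<bullet> x)) * (cis (- 2 * pi * (y \<bullet> - \<xi>)) * u y) = cis (- 2 * pi * ((x - y) \<bullet> \<xi>)) * u y" for y
          by (subst mult.assoc[symmetric], subst cis_mult) (simp add: inner_diff_left inner_diff_right inner_commute right_diff_distrib)
        then show ?thesis unfolding cft_def by (subst integral_mult_right_zero[symmetric]) (simp only:)
      qed
      then show ?thesis by (simp only: mult.assoc[symmetric])
    qed
    then show ?thesis by (simp only: cft_def[of "\<lambda>\<xi>. cft u (- \<xi>) * v \<xi>"])
  qed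
  also have "\<dots> = (\<integral>y. u y * (\<integral>\<xi>. cis (- 2 * pi * ((x - y) \<bullet> \<xi>)) * v \<xi> \<partial>lborel) \<partial>lborel)"
    by (rule Fubini_kernel[OF u v m]) simp
  also have "\<dots> = (\<integral>y. u y * cft v (x - y) \<partial>lborel)"
    by (simp add: cft_def inner_commute)
  finally show ?thesis .
qed

lemma cft_scale:
  fixes v :: "real^'n \<Rightarrow> complex"
  assumes c: "c > 0" and [measurable]: "v \<in> borel_measurable borel"
  shows "cft (\<lambda>\<xi>. v (c *\<^sub>R \<xi>)) x = (1/c) ^ CARD('n) *\<^sub>R cft v ((1/c) *\<^sub>R x)"
proof -
  have "cft v ((1/c) *\<^sub>R x) = \<bar>c\<bar> ^ DIM(real^'n) *\<^sub>R (\<integral>\<xi>. cis (- 2 * pi * ((0 + c *\<^sub>R \<xi>) \<bullet> ((1/c) *\<^sub>R x))) * v (0 + c *\<^sub>R \<xi>) \<partial>lborel)"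
    unfolding cft_def using c by (intro lborel_integral_affine) auto
  also have "\<dots> = c ^ CARD('n) *\<^sub>R cft (\<lambda>\<xi>. v (c *\<^sub>R \<xi>)) x"
    using c by (simp add: cft_def)
  finally show ?thesis using c by (simp add: power_one_over)
qed

text \<open>Under y = x - c z the Jacobian cancels the factor from \<open>cft_scale\<close>.
  Dilating the cut-off on the Fourier side thus becomes averaging \<open>u\<close> over translates
  that shrink with c, which is an approximate identity as c tends to 0.\<close>

lemma convolution_cft_scale:
  fixes v :: "real^'n \<Rightarrow> complex" and u :: "real^'n \<Rightarrow> complex"
  assumes c: "c > 0" and [measurable]: "v \<in> borel_measurable borel" "u \<in> borel_measurable borel"
  shows "(\<integral>y. u y * cft (\<lambda>\<xi>. v (c *\<^sub>R \<xi>)) (x - y) \<partial>lborel) = (\<integral>z. u (x - c *\<^sub>R z) * cft v z \<partial>lborel)"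
proof -
  have [measurable]: "cft (\<lambda>\<xi>. v (c *\<^sub>R \<xi>)) \<in> borel_measurable borel" by (intro cft_measurable) measurable
  have "(\<integral>y. u y * cft (\<lambda>\<xi>. v (c *\<^sub>R \<xi>)) (x - y) \<partial>lborel)
      = \<bar>- c\<bar> ^ DIM(real^'n) *\<^sub>R (\<integral>z. u (x + (- c) *\<^sub>R z) * cft (\<lambda>\<xi>. v (c *\<^sub>R \<xi>)) (x - (x + (- c) *\<^sub>R z)) \<partial>lborel)"
    using c by (intro lborel_integral_affine) (auto, measurable)
  also have "\<dots> = c ^ CARD('n) *\<^sub>R (\<integral>z. (1/c) ^ CARD('n) *\<^sub>R (u (x - c *\<^sub>R z) * cft v z) \<partial>lborel)"
    using c by (simp add: cft_scale)
  also have "\<dots> = (\<integral>z. u (x - c *\<^sub>R z) * cft v z \<partial>lborel)"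
    using c by (simp add: power_one_over)
  finally show ?thesis .
qed

subsection \<open>Decay of the Fourier transform of a test function\<close>

lemma fourier_translate:
  assumes "integrable lborel u"
  shows "fourier (\<lambda>x. u (x + t)) \<xi> = cis (2 * pi * (t \<bullet> \<xi>)) * fourier u \<xi>"
proof -
  have [measurable]: "u \<in> borel_measurable borel" using assms by auto
  have "(\<integral>x. cis (- 2 * pi * (((x + t) - t) \<bullet> \<xi>)) * complex_of_real (u (x + t)) \<partial>lborel)
     = (\<integral>x. cis (- 2 * pi * ((x - t) \<bullet> \<xi>)) * complex_of_real (u x) \<partial>lborel)"
    by (rule lborel_integral_translate) measurable
  also have "\<dots> = (\<integral>x. cis (2 * pi * (t \<bullet> \<xi>)) * (cis (- 2 * pi * (x \<bullet> \<xi>)) * complex_of_real (u x)) \<partial>lborel)"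
  proof (rule Bochner_Integration.integral_cong[OF refl])
    fix x
    show "cis (- 2 * pi * ((x - t) \<bullet> \<xi>)) * complex_of_real (u x) = cis (2 * pi * (t \<bullet> \<xi>)) * (cis (- 2 * pi * (x \<bullet> \<xi>)) * complex_of_real (u x))"
      by (subst mult.assoc[symmetric], subst cis_mult) (simp add: inner_diff_left right_diff_distrib)
  qed
  finally show ?thesis by (simp add: fourier_def)
qed

lemma test_fun_frechet_deriv:
  "test_fun \<phi> \<Longrightarrow> (\<phi> has_derivative frechet_derivative \<phi> (at x)) (at x)"
  using frechet_derivativeD smooth_fun_differentiable test_fun_smooth by blast

lemma test_fun_line_deriv:
  assumes "test_fun \<phi>"
  shows "((\<lambda>t. \<phi> (x + t *\<^sub>R v)) has_real_derivative frechet_derivative \<phi> (at (x + t *\<^sub>R v)) v) (at t)"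
proof -
  have 1: "((\<lambda>t. x + t *\<^sub>R v) has_derivative (\<lambda>h. h *\<^sub>R v)) (at t)"
    by (auto intro!: derivative_eq_intros)
  have 2: "(\<phi> has_derivative frechet_derivative \<phi> (at (x + t *\<^sub>R v))) (at (x + t *\<^sub>R v))"
    using test_fun_frechet_deriv assms by blast
  show ?thesis
    using has_derivative_compose[OF 1 2] linear_scale[OF has_derivative_linear[OF 2]]
    by (simp add: has_field_derivative_def mult_commute_abs)
qed

text \<open>The transform of a difference quotient is explicit by \<open>fourier_translate\<close>.
  Its limit is computed twice: by dominated convergence under the integral, and from the derivative
  of the character at 0.\<close>

lemma fourier_derivative:
  assumes \<phi>: "test_fun \<phi>"
  shows "fourier (\<lambda>x. frechet_derivative \<phi> (at x) v) \<xi> = 2 * pi * \<i> * (v \<bullet> \<xi>) * fourier \<phi> \<xi>"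
proof -
  let ?D = "\<lambda>x. frechet_derivative \<phi> (at x) v"
  define h where "h = (\<lambda>k::nat. inverse (real (Suc k)))"
  have h: "0 < h k" "h k \<le> 1" for k by (simp_all add: h_def field_simps)
  have h0: "h \<longlonglongrightarrow> 0" unfolding h_def by (rule LIMSEQ_inverse_real_of_nat)
  have h1: "filterlim h (at 0) sequentially"
    using h0 h(1) by (auto simp: filterlim_at intro!: always_eventually) (metis less_irrefl)
  have D: "test_fun ?D" by (rule test_fun_derivative[OF \<phi>])
  obtain B where B: "B > 0" "\<And>x. \<bar>?D x\<bar> \<le> B" using test_fun_bounded[OF D] by blast
  obtain R where R: "R > 0" "\<And>x. norm x > R \<Longrightarrow> \<phi> x = 0" using test_fun_support[OF \<phi>] by blast
  have [measurable]: "\<phi> \<in> borel_measurable borel" "?D \<in> borel_measurable borel"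
    using test_fun_measurable \<phi> D by blast+
  define Q where "Q = (\<lambda>k x. (\<phi> (x + h k *\<^sub>R v) - \<phi> x) / h k)"
  have [measurable]: "Q k \<in> borel_measurable borel" for k unfolding Q_def by measurable
  \<comment> \<open>The mean value theorem bounds the quotient by the supremum of the derivative. As
    the step size is at most 1, the support grows by at most \<open>norm v\<close>.\<close>
  have Qb: "\<bar>Q k x\<bar> \<le> B * indicator (cball 0 (R + norm v)) x" for k x
  proof (cases "norm x \<le> R + norm v")
    case True
    obtain z where z: "0 < z" "z < h k" "\<phi> (x + h k *\<^sub>R v) - \<phi> (x + 0 *\<^sub>R v) = (h k - 0) * ?D (x + z *\<^sub>R v)"
      using MVT2[of 0 "h k" "\<lambda>t. \<phi> (x + t *\<^sub>R v)" "\<lambda>t. ?D (x + t *\<^sub>R v)"] h(1)[of k] test_fun_line_deriv[OF \<phi>, of x v]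
      by auto
    then show ?thesis using True B(2)[of "x + z *\<^sub>R v"] h(1)[of k] by (simp add: Q_def)
  next
    case False
    have "norm x \<le> norm (x + h k *\<^sub>R v) + norm (h k *\<^sub>R v)"
      using norm_triangle_ineq4[of "x + h k *\<^sub>R v" "h k *\<^sub>R v"] by simp
    moreover have "norm (h k *\<^sub>R v) \<le> norm v"
      using h[of k] by (simp add: mult_left_le_one_le)
    ultimately have "norm (x + h k *\<^sub>R v) > R" "norm x > R" using False norm_ge_zero[of v] by linarith+
    then show ?thesis using False R(2) by (simp add: Q_def)
  qed
  have L1: "(\<lambda>k. fourier (Q k) \<xi>) \<longlonglongrightarrow> fourier ?D \<xi>"
    unfolding fourier_def
  proof (rule integral_dominated_convergence[where w="\<lambda>x. B * indicator (cball 0 (R + norm v)) x"])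
    show "integrable lborel (\<lambda>x. B * indicator (cball 0 (R + norm v)) x :: real)"
      using emeasure_bounded_finite[OF bounded_cball[of 0 "R + norm v"]] by auto
    show "AE x in lborel. (\<lambda>k. cis (- 2 * pi * (x \<bullet> \<xi>)) * complex_of_real (Q k x)) \<longlonglongrightarrow> cis (- 2 * pi * (x \<bullet> \<xi>)) * complex_of_real (?D x)"
    proof (intro AE_I2 tendsto_intros)
      fix x
      have "((\<lambda>t. (\<phi> (x + t *\<^sub>R v) - \<phi> x) / t) \<longlongrightarrow> ?D x) (at 0)"
        using test_fun_line_deriv[OF \<phi>, of x v 0] by (simp add: DERIV_def)
      from filterlim_compose[OF this h1] show "(\<lambda>k. Q k x) \<longlonglongrightarrow> ?D x" by (simp add: Q_def)
    qed
    show "AE x in lborel. norm (cis (- 2 * pi * (x \<bullet> \<xi>)) * complex_of_real (Q k x)) \<le> B * indicator (cball 0 (R + norm v)) x" for k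
      using Qb[of k] by (intro AE_I2) (simp add: norm_mult)
  qed measurable
  have eq: "fourier (Q k) \<xi> = (cis (2 * pi * (v \<bullet> \<xi>) * h k) - 1) / h k * fourier \<phi> \<xi>" for k
  proof -
    have i: "integrable lborel \<phi>" by (rule test_fun_integrable[OF \<phi>])
    have "integrable lborel (\<lambda>x. \<phi> (x + h k *\<^sub>R v))" using i by (subst lborel_integrable_translate) auto
    from fourier_diff[OF this i] have "fourier (\<lambda>x. \<phi> (x + h k *\<^sub>R v) - \<phi> x) \<xi>
        = (cis (2 * pi * (v \<bullet> \<xi>) * h k) - 1) * fourier \<phi> \<xi>"
      by (simp only: fourier_translate[OF i]) (simp add: algebra_simps)
    moreover have "Q k = (\<lambda>x. (1 / h k) * (\<phi> (x + h k *\<^sub>R v) - \<phi> x))" by (simp add: Q_def)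
    ultimately show ?thesis
      using fourier_cmult[of "1 / h k" "\<lambda>x. \<phi> (x + h k *\<^sub>R v) - \<phi> x" \<xi>] by simp
  qed
  have L2: "(\<lambda>k. (cis (2 * pi * (v \<bullet> \<xi>) * h k) - 1) / h k * fourier \<phi> \<xi>) \<longlonglongrightarrow> (2 * pi * (v \<bullet> \<xi>) * \<i>) * fourier \<phi> \<xi>"
  proof (intro tendsto_mult tendsto_const)
    define a where "a = 2 * pi * (v \<bullet> \<xi>)"
    have "((\<lambda>t. cos (a * t)) has_real_derivative 0) (at 0)" "((\<lambda>t. sin (a * t)) has_real_derivative a) (at 0)"
      by (auto intro!: derivative_eq_intros)
    then have "((\<lambda>t. Complex ((cos (a * t) - 1) / t) (sin (a * t) / t)) \<longlongrightarrow> Complex 0 a) (at 0)"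
      by (intro tendsto_Complex) (simp_all add: DERIV_def)
    moreover have "Complex ((cos (a * t) - 1) / t) (sin (a * t) / t) = (cis (a * t) - 1) / t" for t
      by (auto simp: complex_eq_iff)
    moreover have "Complex 0 a = a * \<i>" by (simp add: complex_eq_iff)
    ultimately have "((\<lambda>t. (cis (a * t) - 1) / t) \<longlongrightarrow> a * \<i>) (at 0)"
      by (simp only:)
    from filterlim_compose[OF this h1]
    show "(\<lambda>k. (cis (2 * pi * (v \<bullet> \<xi>) * h k) - 1) / h k) \<longlonglongrightarrow> (2 * pi * (v \<bullet> \<xi>) * \<i>)"
      by (simp add: a_def)
  qed
  have "fourier ?D \<xi> = (2 * pi * (v \<bullet> \<xi>) * \<i>) * fourier \<phi> \<xi>"
    by (rule LIMSEQ_unique[OF L1[unfolded eq] L2])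
  then show ?thesis by (simp add: mult_ac)
qed

text \<open>The operator 1 - Laplacian/(4 pi^2) maps test functions to test functions and multiplies
  transforms by 1 + |\<xi>|^2. Each application therefore gains one such factor over the trivial
  bound by the L^1 norm.\<close>

lemma fourier_decay:
  assumes "test_fun \<phi>"
  shows "\<exists>C\<ge>0. \<forall>\<xi>. (1 + (norm \<xi>)\<^sup>2) ^ N * cmod (fourier \<phi> \<xi>) \<le> C"
  using assms
proof (induction N arbitrary: \<phi>)
  case 0
  have "\<exists>C. \<forall>\<xi>. cmod (fourier \<phi> \<xi>) \<le> C" unfolding fourier_cft using cft_bound by blast
  then show ?case by (auto intro: order_trans[OF norm_ge_zero])
next
  case (Suc N)
  define D where "D = (\<lambda>b x. frechet_derivative \<phi> (at x) b)"
  define DD where "DD = (\<lambda>b x. frechet_derivative (D b) (at x) b)"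
  have tD: "test_fun (D b)" for b unfolding D_def by (rule test_fun_derivative[OF Suc.prems])
  have tDD: "test_fun (DD b)" for b unfolding DD_def by (rule test_fun_derivative[OF tD])
  have fDD: "fourier (DD b) \<xi> = of_real (- 4 * pi\<^sup>2 * (b \<bullet> \<xi>)\<^sup>2) * fourier \<phi> \<xi>" for b \<xi>
    unfolding DD_def by (subst fourier_derivative[OF tD], unfold D_def, subst fourier_derivative[OF Suc.prems])
      (simp add: power2_eq_square algebra_simps)
  define S where "S = (\<lambda>A x. \<Sum>b\<in>A. DD b x)"
  have S: "test_fun (S A) \<and> (\<forall>\<xi>. fourier (S A) \<xi> = of_real (- 4 * pi\<^sup>2 * (\<Sum>b\<in>A. (b \<bullet> \<xi>)\<^sup>2)) * fourier \<phi> \<xi>)"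
    if "finite A" for A
    using that
  proof (induction A rule: finite_induct)
    case empty
    have "S {} = (\<lambda>x. 0)" by (simp add: S_def)
    then show ?case using test_fun_zero by (simp add: fourier_def)
  next
    case (insert b A)
    then have "S (insert b A) = (\<lambda>x. DD b x + S A x)" by (simp add: S_def)
    then show ?case
      using insert by (auto simp: fourier_add test_fun_integrable tDD fDD test_fun_add algebra_simps)
  qed
  define L where "L = (\<lambda>x. \<phi> x - 1 / (4 * pi\<^sup>2) * S Basis x)"
  have tS: "test_fun (S Basis)" and fS: "\<And>\<xi>. fourier (S Basis) \<xi> = of_real (- 4 * pi\<^sup>2 * (\<Sum>b\<in>Basis. (b \<bullet> \<xi>)\<^sup>2)) * fourier \<phi> \<xi>"
    using S[of Basis] by auto
  have L: "test_fun L" unfolding L_def using tS Suc.prems by (intro test_fun_diff test_fun_cmult)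
  have "fourier L \<xi> = fourier \<phi> \<xi> - of_real (1 / (4 * pi\<^sup>2)) * fourier (S Basis) \<xi>" for \<xi>
    unfolding L_def by (subst fourier_diff)
      (intro test_fun_integrable test_fun_cmult tS Suc.prems, intro test_fun_integrable test_fun_cmult tS Suc.prems, simp only: fourier_cmult)
  moreover have "(\<Sum>b\<in>Basis. (b \<bullet> \<xi>)\<^sup>2) = (norm \<xi>)\<^sup>2" for \<xi> :: "real^'a"
    by (simp add: norm_eq_sqrt_inner euclidean_inner[of \<xi> \<xi>] sum_nonneg inner_commute power2_eq_square)
  ultimately have FL: "fourier L \<xi> = of_real (1 + (norm \<xi>)\<^sup>2) * fourier \<phi> \<xi>" for \<xi>
    by (simp add: fS field_simps)
  obtain C where "C \<ge> 0" "\<forall>\<xi>. (1 + (norm \<xi>)\<^sup>2) ^ N * cmod (fourier L \<xi>) \<le> C" using Suc.IH[OF L] by blast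
  moreover have "(1 + (norm \<xi>)\<^sup>2) ^ N * cmod (fourier L \<xi>) = (1 + (norm \<xi>)\<^sup>2) ^ Suc N * cmod (fourier \<phi> \<xi>)" for \<xi>
    unfolding FL norm_mult norm_of_real using norm2_pos[of \<xi>] by (simp add: abs_of_pos mult_ac)
  ultimately show ?case by auto
qed

lemma fourier_decay_weight:
  assumes "test_fun (\<phi> :: real^'n \<Rightarrow> real)"
  obtains C where "C > 0" "\<And>\<xi>. cmod (fourier \<phi> \<xi>) \<le> C * weight \<xi> ^ m"
proof -
  \<comment> \<open>One factor \<open>weight\<close> is worth d factors 1 + |\<xi>|^2, hence the
    exponent d m.\<close>
  obtain C where C: "C \<ge> 0" "\<And>\<xi>. (1 + (norm \<xi>)\<^sup>2) ^ (CARD('n) * m) * cmod (fourier \<phi> \<xi>) \<le> C"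
    using fourier_decay[OF assms] by blast
  have "cmod (fourier \<phi> \<xi>) \<le> (C + 1) * weight \<xi> ^ m" for \<xi>
  proof -
    have e: "weight \<xi> ^ m = inverse ((1 + (norm \<xi>)\<^sup>2) ^ (CARD('n) * m))"
      by (simp add: weight_def power_mult power_inverse)
    have "(1 + (norm \<xi>)\<^sup>2) ^ (CARD('n) * m) > 0" using norm2_pos by (rule zero_less_power)
    then have "cmod (fourier \<phi> \<xi>) \<le> C * weight \<xi> ^ m" using C(2)[of \<xi>] by (simp add: e field_simps)
    also have "\<dots> \<le> (C + 1) * weight \<xi> ^ m" by (intro mult_right_mono) auto
    finally show ?thesis .
  qed
  then show ?thesis using C(1) by (intro that[of "C + 1"]) auto
qed

subsection \<open>Smoothness of the Fourier transform\<close>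

text \<open>Minus sine is written as cosine with the phase advanced by pi/2. The derivative then has
  the same form, with phase c + pi/2 and density (v \<bullet> y) w(y), and the family becomes closed
  under differentiation. The Taylor remainder is quadratic, uniformly on the ball that carries
  \<open>w\<close>.\<close>

lemma has_derivative_cos_integral:
  fixes w :: "real^'n \<Rightarrow> real"
  assumes w: "integrable lborel w" and R: "\<And>y. norm y > R \<Longrightarrow> w y = 0"
  shows "((\<lambda>x. \<integral>y. cos (x \<bullet> y + c) * w y \<partial>lborel) has_derivative
     (\<lambda>v. \<integral>y. cos (x \<bullet> y + (c + pi/2)) * ((v \<bullet> y) * w y) \<partial>lborel)) (at x)"
proof -
  have [measurable]: "w \<in> borel_measurable borel" using w by auto
  have iw: "integrable lborel (\<lambda>y. g y * w y)" if [measurable]: "g \<in> borel_measurable borel"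
    and B: "\<And>y. norm y \<le> R \<Longrightarrow> \<bar>g y\<bar> \<le> B" for g B
  proof (rule Bochner_Integration.integrable_bound)
    show "integrable lborel (\<lambda>y. B * w y)" using w by simp
    show "AE y in lborel. norm (g y * w y) \<le> norm (B * w y)"
    proof (rule AE_I2)
      fix y show "norm (g y * w y) \<le> norm (B * w y)"
        using B[of y] R[of y] by (cases "norm y > R") (auto simp: abs_mult intro!: mult_right_mono)
    qed
  qed measurable
  have sc: "cos (t + (c + pi/2)) = - sin (t + c)" for t
    by (simp add: cos_add sin_add add.assoc[symmetric])
  have i1: "integrable lborel (\<lambda>y. cos (x \<bullet> y + c) * w y)" for x c
    by (rule iw[where B=1]) auto
  have inn: "\<bar>v \<bullet> y\<bar> \<le> norm v * \<bar>R\<bar>" if "norm y \<le> R" for v y :: "real^'n"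
  proof -
    have "norm y \<le> \<bar>R\<bar>" using that by linarith
    then have "norm v * norm y \<le> norm v * \<bar>R\<bar>" by (rule mult_left_mono) simp
    then show ?thesis by (rule order_trans[OF Cauchy_Schwarz_ineq2])
  qed
  have i2: "integrable lborel (\<lambda>y. cos (x \<bullet> y + c) * ((v \<bullet> y) * w y))" for x c v
    unfolding mult.assoc[symmetric]
  proof (rule iw[where B="norm v * \<bar>R\<bar>"])
    fix y :: "real^'n" assume "norm y \<le> R"
    have "\<bar>cos (x \<bullet> y + c)\<bar> * \<bar>v \<bullet> y\<bar> \<le> 1 * (norm v * \<bar>R\<bar>)"
      by (intro mult_mono inn \<open>norm y \<le> R\<close>) auto
    then show "\<bar>cos (x \<bullet> y + c) * (v \<bullet> y)\<bar> \<le> norm v * \<bar>R\<bar>" by (simp add: abs_mult)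
  qed measurable
  show ?thesis
    unfolding has_derivative_iff_norm
  proof (intro conjI)
    show "bounded_linear (\<lambda>v. \<integral>y. cos (x \<bullet> y + (c + pi/2)) * ((v \<bullet> y) * w y) \<partial>lborel)"
    proof (rule bounded_linear_intro[where K="\<bar>R\<bar> * (\<integral>y. \<bar>w y\<bar> \<partial>lborel)"])
      fix v u :: "real^'n" and r :: real
      show "(\<integral>y. cos (x \<bullet> y + (c + pi/2)) * (((v + u) \<bullet> y) * w y) \<partial>lborel)
        = (\<integral>y. cos (x \<bullet> y + (c + pi/2)) * ((v \<bullet> y) * w y) \<partial>lborel) + (\<integral>y. cos (x \<bullet> y + (c + pi/2)) * ((u \<bullet> y) * w y) \<partial>lborel)"
        by (subst Bochner_Integration.integral_add[symmetric, OF i2 i2]) (simp add: inner_add_left algebra_simps)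
      show "(\<integral>y. cos (x \<bullet> y + (c + pi/2)) * (((r *\<^sub>R v) \<bullet> y) * w y) \<partial>lborel)
        = r *\<^sub>R (\<integral>y. cos (x \<bullet> y + (c + pi/2)) * ((v \<bullet> y) * w y) \<partial>lborel)"
        by (simp add: mult_ac)
      have "norm (\<integral>y. cos (x \<bullet> y + (c + pi/2)) * ((v \<bullet> y) * w y) \<partial>lborel)
          \<le> (\<integral>y. norm (cos (x \<bullet> y + (c + pi/2)) * ((v \<bullet> y) * w y)) \<partial>lborel)"
        by (rule integral_norm_bound)
      also have "\<dots> \<le> (\<integral>y. (norm v * \<bar>R\<bar>) * \<bar>w y\<bar> \<partial>lborel)"
      proof (rule integral_mono)
        fix y
        show "norm (cos (x \<bullet> y + (c + pi/2)) * ((v \<bullet> y) * w y)) \<le> norm v * \<bar>R\<bar> * \<bar>w y\<bar>"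
        proof (cases "norm y \<le> R")
          case True
          have "\<bar>cos (x \<bullet> y + (c + pi/2))\<bar> * (\<bar>v \<bullet> y\<bar> * \<bar>w y\<bar>) \<le> 1 * ((norm v * \<bar>R\<bar>) * \<bar>w y\<bar>)"
            by (intro mult_mono inn True) auto
          then show ?thesis by (simp add: abs_mult)
        qed (use R[of y] in simp)
      qed (use w i2 in \<open>auto intro!: integrable_norm\<close>)
      finally show "norm (\<integral>y. cos (x \<bullet> y + (c + pi/2)) * ((v \<bullet> y) * w y) \<partial>lborel) \<le> norm v * (\<bar>R\<bar> * (\<integral>y. \<bar>w y\<bar> \<partial>lborel))"
        by (simp add: mult.assoc)
    qed
    define K where "K = R\<^sup>2 * (\<integral>y. \<bar>w y\<bar> \<partial>lborel)"
    have main: "norm ((\<integral>y. cos (x' \<bullet> y + c) * w y \<partial>lborel) - (\<integral>y. cos (x \<bullet> y + c) * w y \<partial>lborel) -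
        (\<integral>y. cos (x \<bullet> y + (c + pi/2)) * (((x' - x) \<bullet> y) * w y) \<partial>lborel)) \<le> K * (norm (x' - x))\<^sup>2" for x'
    proof -
      have eq: "(\<integral>y. cos (x' \<bullet> y + c) * w y \<partial>lborel) - (\<integral>y. cos (x \<bullet> y + c) * w y \<partial>lborel) -
        (\<integral>y. cos (x \<bullet> y + (c + pi/2)) * (((x' - x) \<bullet> y) * w y) \<partial>lborel)
        = (\<integral>y. cos (x' \<bullet> y + c) * w y - cos (x \<bullet> y + c) * w y - cos (x \<bullet> y + (c + pi/2)) * (((x' - x) \<bullet> y) * w y) \<partial>lborel)"
        by (simp add: i1 i2)
      have "norm (\<integral>y. cos (x' \<bullet> y + c) * w y - cos (x \<bullet> y + c) * w y - cos (x \<bullet> y + (c + pi/2)) * (((x' - x) \<bullet> y) * w y) \<partial>lborel)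
        \<le> (\<integral>y. norm (cos (x' \<bullet> y + c) * w y - cos (x \<bullet> y + c) * w y - cos (x \<bullet> y + (c + pi/2)) * (((x' - x) \<bullet> y) * w y)) \<partial>lborel)"
        by (rule integral_norm_bound)
      also have "\<dots> \<le> (\<integral>y. ((norm (x' - x))\<^sup>2 * R\<^sup>2) * \<bar>w y\<bar> \<partial>lborel)"
      proof (rule integral_mono)
        fix y
        show "norm (cos (x' \<bullet> y + c) * w y - cos (x \<bullet> y + c) * w y - cos (x \<bullet> y + (c + pi/2)) * (((x' - x) \<bullet> y) * w y))
           \<le> ((norm (x' - x))\<^sup>2 * R\<^sup>2) * \<bar>w y\<bar>"
        proof (cases "norm y \<le> R")
          case True
          define a where "a = x \<bullet> y + c"
          define s where "s = (x' - x) \<bullet> y"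
          have s: "\<bar>s\<bar> \<le> norm (x' - x) * \<bar>R\<bar>" unfolding s_def by (rule inn[OF True])
          have e: "x' \<bullet> y + c = a + s" by (simp add: a_def s_def inner_diff_left)
          \<comment> \<open>The second-order remainder of cosine, split as (cos s - 1) cos a - sin a
            (sin s - s); each part is at most s^2/2.\<close>
          have "\<bar>cos (a + s) - cos a + sin a * s\<bar> \<le> s\<^sup>2"
          proof -
            have "cos (a + s) - cos a + sin a * s = - (2 * (sin (s/2))\<^sup>2) * cos a - sin a * (sin s - s)"
            proof -
              have "cos s - 1 = - (2 * (sin (s/2))\<^sup>2)" using cos_double_sin[of "s/2"] by simp
              moreover have "cos (a + s) - cos a + sin a * s = (cos s - 1) * cos a - sin a * (sin s - s)"
                by (simp add: cos_add algebra_simps)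
              ultimately show ?thesis by (simp only:)
            qed
            moreover have "\<bar>(2 * (sin (s/2))\<^sup>2) * cos a\<bar> \<le> s\<^sup>2 / 2 * 1"
            proof -
              have "(sin (s/2))\<^sup>2 \<le> (s/2)\<^sup>2" using abs_sin_x_le_abs_x[of "s/2"] abs_le_square_iff by blast
              then have "2 * (sin (s/2))\<^sup>2 \<le> s\<^sup>2 / 2" by (simp add: power_divide)
              then show ?thesis unfolding abs_mult by (intro mult_mono) auto
            qed
            moreover have "\<bar>sin a * (sin s - s)\<bar> \<le> 1 * (s\<^sup>2 / 2)"
              unfolding abs_mult using Maclaurin_sin_bound[of s 2]
              by (intro mult_mono) (auto simp: numeral_2_eq_2 sin_coeff_def)
            ultimately show ?thesis by linarith
          qed
          also have "s\<^sup>2 \<le> (norm (x' - x) * \<bar>R\<bar>)\<^sup>2" using s by (metis abs_ge_zero power2_abs power_mono)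
          also have "\<dots> = (norm (x' - x))\<^sup>2 * R\<^sup>2" by (simp add: power_mult_distrib)
          finally have "\<bar>cos (a + s) - cos a + sin a * s\<bar> * \<bar>w y\<bar> \<le> ((norm (x' - x))\<^sup>2 * R\<^sup>2) * \<bar>w y\<bar>"
            by (rule mult_right_mono) simp
          moreover have "cos (x' \<bullet> y + c) * w y - cos (x \<bullet> y + c) * w y - cos (x \<bullet> y + (c + pi/2)) * (((x' - x) \<bullet> y) * w y)
             = (cos (a + s) - cos a + sin a * s) * w y"
            by (simp only: e sc a_def[symmetric] s_def[symmetric]) (simp add: algebra_simps)
          ultimately show ?thesis by (simp add: abs_mult)
        qed (use R[of y] in simp)
      qed (use w in \<open>auto intro!: integrable_norm Bochner_Integration.integrable_diff i1 i2\<close>)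
      finally show ?thesis unfolding eq by (simp add: K_def mult_ac)
    qed
    show "((\<lambda>x'. norm ((\<integral>y. cos (x' \<bullet> y + c) * w y \<partial>lborel) - (\<integral>y. cos (x \<bullet> y + c) * w y \<partial>lborel) -
        (\<integral>y. cos (x \<bullet> y + (c + pi/2)) * (((x' - x) \<bullet> y) * w y) \<partial>lborel)) / norm (x' - x)) \<longlongrightarrow> 0) (at x)"
    proof (rule Lim_null_comparison)
      show "\<forall>\<^sub>F x' in at x. norm (norm ((\<integral>y. cos (x' \<bullet> y + c) * w y \<partial>lborel) - (\<integral>y. cos (x \<bullet> y + c) * w y \<partial>lborel) -
        (\<integral>y. cos (x \<bullet> y + (c + pi/2)) * (((x' - x) \<bullet> y) * w y) \<partial>lborel)) / norm (x' - x)) \<le> K * norm (x' - x)"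
      proof (rule eventually_at_topological[THEN iffD2], intro exI[of _ UNIV] conjI ballI impI)
        fix x' assume "x' \<noteq> x"
        then have "norm (x' - x) > 0" by simp
        then show "norm (norm ((\<integral>y. cos (x' \<bullet> y + c) * w y \<partial>lborel) - (\<integral>y. cos (x \<bullet> y + c) * w y \<partial>lborel) -
        (\<integral>y. cos (x \<bullet> y + (c + pi/2)) * (((x' - x) \<bullet> y) * w y) \<partial>lborel)) / norm (x' - x)) \<le> K * norm (x' - x)"
          using main[of x'] by (simp add: pos_divide_le_eq power2_eq_square mult.assoc)
      qed auto
      have "((\<lambda>x'. K * norm (x' - x)) \<longlongrightarrow> K * norm (x - x)) (at x)" by (intro tendsto_intros)
      then show "((\<lambda>x'. K * norm (x' - x)) \<longlongrightarrow> 0) (at x)" by simp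
    qed
  qed
qed

lemma smooth_cos_integral:
  fixes w :: "real^'n \<Rightarrow> real"
  assumes "integrable lborel w" and "\<And>y. norm y > R \<Longrightarrow> w y = 0"
  shows "smooth_fun (\<lambda>x. \<integral>y. cos (x \<bullet> y + c) * w y \<partial>lborel)"
proof -
  define S where "S = (\<lambda>g. \<exists>w c. integrable lborel w \<and> (\<forall>y. norm y > R \<longrightarrow> w y = 0)
     \<and> g = (\<lambda>x::real^'n. \<integral>y. cos (x \<bullet> y + c) * w y \<partial>lborel))"
  show ?thesis
  proof (rule alg_closure_smooth[of S])
    show "g differentiable (at x)" if "S g" for g x
      using that has_derivative_cos_integral unfolding S_def differentiable_def by blast
    show "alg_closure S (\<lambda>x. frechet_derivative g (at x) v)" if "S g" for g v
    proof -
      from that obtain w c where w: "integrable lborel w" "\<And>y. norm y > R \<Longrightarrow> w y = 0"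
        and g: "g = (\<lambda>x. \<integral>y. cos (x \<bullet> y + c) * w y \<partial>lborel)" by (auto simp: S_def)
      have [measurable]: "w \<in> borel_measurable borel" using w by auto
      have "integrable lborel (\<lambda>y. (v \<bullet> y) * w y)"
      proof (rule Bochner_Integration.integrable_bound)
        show "integrable lborel (\<lambda>y. (norm v * \<bar>R\<bar>) * w y)" using w by simp
        show "AE y in lborel. norm ((v \<bullet> y) * w y) \<le> norm ((norm v * \<bar>R\<bar>) * w y)"
        proof (rule AE_I2)
          fix y show "norm ((v \<bullet> y) * w y) \<le> norm ((norm v * \<bar>R\<bar>) * w y)"
          proof (cases "norm y \<le> R")
            case True
            have "\<bar>v \<bullet> y\<bar> \<le> norm v * \<bar>R\<bar>"
              by (rule order_trans[OF Cauchy_Schwarz_ineq2 mult_left_mono]) (use True in auto)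
            then show ?thesis by (simp add: abs_mult mult_right_mono)
          qed (use w(2)[of y] in simp)
        qed
      qed measurable
      then have "S (\<lambda>x. \<integral>y. cos (x \<bullet> y + (c + pi/2)) * ((v \<bullet> y) * w y) \<partial>lborel)"
        using w(2) unfolding S_def by (intro exI[of _ "\<lambda>y. (v \<bullet> y) * w y"] exI[of _ "c + pi/2"]) auto
      moreover have "frechet_derivative g (at x) v = (\<integral>y. cos (x \<bullet> y + (c + pi/2)) * ((v \<bullet> y) * w y) \<partial>lborel)" for x
        unfolding g by (subst frechet_derivativeI[OF has_derivative_cos_integral[OF w]]) auto
      ultimately show ?thesis by (auto intro: alg_closure.base)
    qed
    show "alg_closure S (\<lambda>x. \<integral>y. cos (x \<bullet> y + c) * w y \<partial>lborel)"
      using assms by (intro alg_closure.base) (auto simp: S_def)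
  qed
qed

text \<open>Both parts are cosine integrals dilated by - 2 pi; the phases 0 and - pi/2 select cosine
  and sine.\<close>

lemma
  assumes "test_fun \<phi>"
  shows smooth_Re_fourier: "smooth_fun (\<lambda>\<xi>. Re (fourier \<phi> \<xi>))"
    and smooth_Im_fourier: "smooth_fun (\<lambda>\<xi>. Im (fourier \<phi> \<xi>))"
proof -
  obtain R where R: "R > 0" "\<And>x. norm x > R \<Longrightarrow> \<phi> x = 0" using test_fun_support[OF assms] by blast
  have i: "integrable lborel \<phi>" by (rule test_fun_integrable[OF assms])
  have s: "smooth_fun (\<lambda>\<xi>. \<integral>x. cos (((- 2 * pi) *\<^sub>R \<xi> + 0) \<bullet> x + c) * \<phi> x \<partial>lborel)" for c
    by (rule smooth_fun_affine[OF smooth_cos_integral[OF i R(2)]])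
  have ic: "integrable lborel (\<lambda>x. cis (- 2 * pi * (x \<bullet> \<xi>)) * complex_of_real (\<phi> x))" for \<xi>
    by (intro integrable_cis_mult) (auto intro: i)
  have "Re (fourier \<phi> \<xi>) = (\<integral>x. cos (((- 2 * pi) *\<^sub>R \<xi> + 0) \<bullet> x + 0) * \<phi> x \<partial>lborel)" for \<xi>
    unfolding fourier_def by (subst integral_Re[OF ic, symmetric]) (simp add: inner_commute)
  then show "smooth_fun (\<lambda>\<xi>. Re (fourier \<phi> \<xi>))" using s[of 0] by simp
  have "Im (fourier \<phi> \<xi>) = (\<integral>x. cos (((- 2 * pi) *\<^sub>R \<xi> + 0) \<bullet> x + (- pi/2)) * \<phi> x \<partial>lborel)" for \<xi>
    unfolding fourier_def by (subst integral_Im[OF ic, symmetric]) (simp add: inner_commute cos_diff)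
  then show "smooth_fun (\<lambda>\<xi>. Im (fourier \<phi> \<xi>))" using s[of "- pi/2"] by simp
qed

subsection \<open>The Gaussian and its consequences\<close>

definition gauss :: "real^'n \<Rightarrow> real" where
  "gauss x = exp (- (norm x)\<^sup>2 / 2)"

text \<open>This is the transform of \<open>gauss\<close>. Written as a product of normal densities
  it visibly has integral 1, so its dilates form an approximate identity.\<close>

definition gauss_hat :: "real^'n \<Rightarrow> real" where
  "gauss_hat x = (\<Prod>b\<in>Basis. normal_density 0 (1 / (2 * pi)) (x \<bullet> b))"

lemma gauss_pos: "0 < gauss x" and gauss_le1: "gauss x \<le> 1"
  by (auto simp: gauss_def)

lemma abs_gauss [simp]: "\<bar>gauss x\<bar> = gauss x"
  using gauss_pos[of x] by simp

lemma gauss_nonneg [simp]: "0 \<le> gauss x"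
  using gauss_pos[of x] by simp

lemma gauss_measurable [measurable]: "gauss \<in> borel_measurable borel"
  unfolding gauss_def[abs_def] by measurable

lemma gauss_hat_measurable [measurable]: "gauss_hat \<in> borel_measurable borel"
  unfolding gauss_hat_def[abs_def] by measurable

lemma gauss_prod: "gauss x = (\<Prod>b\<in>Basis. exp (- (x \<bullet> b)\<^sup>2 / 2))"
proof -
  have "(norm x)\<^sup>2 = (\<Sum>b\<in>Basis. (x \<bullet> b)\<^sup>2)"
    by (simp add: norm_eq_sqrt_inner euclidean_inner[of x x] sum_nonneg power2_eq_square)
  then show ?thesis by (simp add: gauss_def exp_sum[symmetric] sum_divide_distrib sum_negf)
qed

lemma std_normal_exp: "std_normal_density x = exp (- x\<^sup>2 / 2) / sqrt (2 * pi)"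
  by (simp add: normal_density_def)

lemma integrable_exp_square: "integrable lborel (\<lambda>x::real. exp (- x\<^sup>2 / 2))"
proof -
  have "integrable lborel (\<lambda>x. sqrt (2 * pi) * std_normal_density x)" by (intro integrable_mult_right) auto
  then show ?thesis by (simp add: std_normal_exp)
qed

lemma integrable_gauss: "integrable lborel gauss"
  unfolding gauss_prod[abs_def] by (intro integrable_lborel_prod integrable_exp_square)

lemma gauss_hat_nonneg: "0 \<le> gauss_hat x"
  unfolding gauss_hat_def by (intro prod_nonneg) auto

lemma abs_gauss_hat [simp]: "\<bar>gauss_hat x\<bar> = gauss_hat x"
  using gauss_hat_nonneg[of x] by simp

lemma integrable_gauss_hat: "integrable lborel gauss_hat"
  unfolding gauss_hat_def[abs_def] by (intro integrable_lborel_prod) auto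

lemma integral_gauss_hat: "(\<integral>x. gauss_hat x \<partial>lborel) = 1"
  unfolding gauss_hat_def by (subst integral_lborel_prod) auto

text \<open>Up to the factor sqrt (2 pi) the integral is the characteristic function of the standard
  normal distribution at - 2 pi s.\<close>

lemma cft_gauss_1: "(\<integral>t. cis (- 2 * pi * (t * s)) * complex_of_real (exp (- t\<^sup>2 / 2)) \<partial>lborel)
    = complex_of_real (normal_density 0 (1 / (2 * pi)) s)"
proof -
  have "char std_normal_distribution (- 2 * pi * s) = (\<integral>x. std_normal_density x *\<^sub>R iexp (- 2 * pi * s * x) \<partial>lborel)"
    unfolding char_def by (subst integral_density) auto
  also have "\<dots> = (\<integral>t. complex_of_real (1 / sqrt (2 * pi)) * (cis (- 2 * pi * (t * s)) * complex_of_real (exp (- t\<^sup>2 / 2))) \<partial>lborel)"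
    by (intro Bochner_Integration.integral_cong refl)
      (simp add: std_normal_exp cis_conv_exp scaleR_conv_of_real mult_ac)
  finally have "(\<integral>t. cis (- 2 * pi * (t * s)) * complex_of_real (exp (- t\<^sup>2 / 2)) \<partial>lborel)
     = complex_of_real (sqrt (2 * pi)) * char std_normal_distribution (- 2 * pi * s)"
    by simp
  also have "\<dots> = complex_of_real (sqrt (2 * pi) * exp (- (2 * pi * s)\<^sup>2 / 2))"
    by (simp add: char_std_normal_distribution)
  also have "sqrt (2 * pi) * exp (- (2 * pi * s)\<^sup>2 / 2) = normal_density 0 (1 / (2 * pi)) s"
  proof -
    have "1 / sqrt (2 * pi * (1 / (2 * pi))\<^sup>2) = sqrt (2 * pi)"
      by (simp add: power2_eq_square real_sqrt_divide)
    moreover have "- s\<^sup>2 / (2 * (1 / (2 * pi))\<^sup>2) = - (2 * pi * s)\<^sup>2 / 2"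
      by (simp add: power2_eq_square)
    ultimately show ?thesis by (simp only: normal_density_def diff_0_right)
  qed
  finally show ?thesis .
qed

lemma cis_sum: "finite A \<Longrightarrow> cis (\<Sum>x\<in>A. f x) = (\<Prod>x\<in>A. cis (f x))"
  by (induction A rule: finite_induct) (auto simp: cis_mult[symmetric])

lemma cft_gauss: "cft (\<lambda>x. complex_of_real (gauss x)) \<xi> = complex_of_real (gauss_hat \<xi>)"
proof -
  have "cis (- 2 * pi * (x \<bullet> \<xi>)) * complex_of_real (gauss x)
      = (\<Prod>b\<in>Basis. cis (- 2 * pi * ((x \<bullet> b) * (\<xi> \<bullet> b))) * complex_of_real (exp (- (x \<bullet> b)\<^sup>2 / 2)))" for x
  proof -
    have "- 2 * pi * (x \<bullet> \<xi>) = (\<Sum>b\<in>Basis. - 2 * pi * ((x \<bullet> b) * (\<xi> \<bullet> b)))"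
      by (subst euclidean_inner) (simp only: sum_distrib_left)
    then have "cis (- 2 * pi * (x \<bullet> \<xi>)) = (\<Prod>b\<in>Basis. cis (- 2 * pi * ((x \<bullet> b) * (\<xi> \<bullet> b))))"
      by (simp only: cis_sum[OF finite_Basis])
    then show ?thesis by (simp only: gauss_prod of_real_prod prod.distrib)
  qed
  then have "cft (\<lambda>x. complex_of_real (gauss x)) \<xi>
     = (\<Prod>b\<in>Basis. \<integral>t. cis (- 2 * pi * (t * (\<xi> \<bullet> b))) * complex_of_real (exp (- t\<^sup>2 / 2)) \<partial>lborel)"
    unfolding cft_def
    by (simp only:, intro integral_lborel_prod integrable_cis_mult integrable_of_real integrable_exp_square) measurable
  then show ?thesis by (simp only: cft_gauss_1 gauss_hat_def of_real_prod)
qed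

text \<open>Every term, including the one for \<open>k = 0\<close>, lies in the interval (0, 1];
  domination and convex combinations along the sequence thus hold from the start.\<close>

definition scale_seq :: "nat \<Rightarrow> real" where "scale_seq k = inverse (real (Suc k))"

lemma scale_seq_pos: "0 < scale_seq k" and scale_seq_le1: "scale_seq k \<le> 1"
  by (simp_all add: scale_seq_def field_simps)

lemma scale_seq_lim: "scale_seq \<longlonglongrightarrow> 0"
  unfolding scale_seq_def[abs_def] by (rule LIMSEQ_inverse_real_of_nat)

lemma scale_seq_scaleR_lim: "(\<lambda>k. scale_seq k *\<^sub>R (z::'a::real_normed_vector)) \<longlonglongrightarrow> 0"
  using tendsto_scaleR[OF scale_seq_lim tendsto_const[of z]] by simp

lemma gauss_scale_lim: "(\<lambda>k. gauss (scale_seq k *\<^sub>R x)) \<longlonglongrightarrow> 1"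
proof -
  have "(\<lambda>k. gauss (scale_seq k *\<^sub>R x)) \<longlonglongrightarrow> exp (- (norm (0::real^'a))\<^sup>2 / 2)"
    unfolding gauss_def by (intro tendsto_intros scale_seq_scaleR_lim) auto
  then show ?thesis by simp
qed

lemma integrable_gauss_scale: "integrable lborel (\<lambda>x. complex_of_real (gauss (scale_seq k *\<^sub>R x)))"
  using lborel_integrable_affine[of "scale_seq k" gauss 0] scale_seq_pos[of k] integrable_gauss
  by (intro integrable_of_real) auto

text \<open>Fourier inversion at the origin. A Gaussian factor is inserted, moved to the other side
  by duality, and becomes an average of \<eta> near 0. For a bump with \<eta> 0 = 1 it says that the
  mollifier \<open>fourier \<eta>\<close> has integral 1.\<close>

lemma integral_fourier_test_fun:
  assumes \<eta>: "test_fun (\<eta> :: real^'n \<Rightarrow> real)"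
  shows "integrable lborel (fourier \<eta>)" "(\<integral>\<xi>. fourier \<eta> \<xi> \<partial>lborel) = complex_of_real (\<eta> 0)"
proof -
  have [measurable]: "\<eta> \<in> borel_measurable borel" using \<eta> by (rule test_fun_measurable)
  obtain C where C: "C > 0" "\<And>\<xi>. cmod (fourier \<eta> \<xi>) \<le> C * weight \<xi> ^ 1" using fourier_decay_weight[OF \<eta>] by blast
  show int: "integrable lborel (fourier \<eta>)"
  proof (rule Bochner_Integration.integrable_bound)
    show "integrable lborel (\<lambda>x::real^'n. C * weight x)" by (intro integrable_mult_right integrable_weight)
    show "AE x in lborel. norm (fourier \<eta> x) \<le> norm (C * weight x)"
      using C by (intro AE_I2) (auto intro: order_trans[OF _ abs_ge_self])
  qed measurable
  obtain B where B: "B > 0" "\<And>x. \<bar>\<eta> x\<bar> \<le> B" using test_fun_bounded[OF \<eta>] by blast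
  let ?g = "\<lambda>k \<xi>. complex_of_real (gauss (scale_seq k *\<^sub>R \<xi>))"
  have i: "integrable lborel (\<lambda>x. complex_of_real (\<eta> x))" using test_fun_integrable[OF \<eta>] by simp
  have "(\<lambda>k. \<integral>\<xi>. fourier \<eta> \<xi> * ?g k \<xi> \<partial>lborel) \<longlonglongrightarrow> (\<integral>\<xi>. fourier \<eta> \<xi> * complex_of_real 1 \<partial>lborel)"
  proof (rule integral_dominated_convergence[where w="\<lambda>\<xi>. cmod (fourier \<eta> \<xi>)"])
    show "AE \<xi> in lborel. (\<lambda>k. fourier \<eta> \<xi> * ?g k \<xi>) \<longlonglongrightarrow> fourier \<eta> \<xi> * complex_of_real 1"
      by (intro AE_I2 tendsto_intros gauss_scale_lim)
    show "AE \<xi> in lborel. norm (fourier \<eta> \<xi> * ?g k \<xi>) \<le> cmod (fourier \<eta> \<xi>)" for k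
      using gauss_le1 by (intro AE_I2) (auto simp: norm_mult intro!: mult_left_le)
  qed (use int in \<open>auto\<close>)
  moreover have "(\<integral>\<xi>. fourier \<eta> \<xi> * ?g k \<xi> \<partial>lborel) = (\<integral>z. complex_of_real (\<eta> (scale_seq k *\<^sub>R z)) * complex_of_real (gauss_hat z) \<partial>lborel)" for k
  proof -
    let ?v = "\<lambda>\<xi>. complex_of_real (gauss \<xi>)"
    have "(\<integral>\<xi>. fourier \<eta> \<xi> * ?g k \<xi> \<partial>lborel) = (\<integral>x. complex_of_real (\<eta> x) * cft (?g k) x \<partial>lborel)"
      unfolding fourier_cft by (rule cft_duality[OF i integrable_gauss_scale])
    also have "\<dots> = (\<integral>x. complex_of_real (\<eta> (- x)) * cft (?g k) (0 - x) \<partial>lborel)"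
      using lborel_integral_uminus[of "\<lambda>x. complex_of_real (\<eta> x) * cft (?g k) x"] by simp
    also have "\<dots> = (\<integral>z. complex_of_real (\<eta> (- (0 - scale_seq k *\<^sub>R z))) * cft ?v z \<partial>lborel)"
      by (rule convolution_cft_scale[OF scale_seq_pos, of ?v "\<lambda>x. complex_of_real (\<eta> (- x))"]) measurable
    finally show ?thesis by (simp add: cft_gauss)
  qed
  moreover have "(\<lambda>k. \<integral>z. complex_of_real (\<eta> (scale_seq k *\<^sub>R z)) * complex_of_real (gauss_hat z) \<partial>lborel)
     \<longlonglongrightarrow> (\<integral>z. complex_of_real (\<eta> 0) * complex_of_real (gauss_hat (z::real^'n)) \<partial>lborel)"
  proof (rule integral_dominated_convergence[where w="\<lambda>z::real^'n. B * gauss_hat z"])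
    have "isCont \<eta> 0" using test_fun_continuous[OF \<eta>, of UNIV] by (simp add: continuous_on_eq_continuous_at)
    then show "AE z in lborel. (\<lambda>k. complex_of_real (\<eta> (scale_seq k *\<^sub>R z)) * complex_of_real (gauss_hat z)) \<longlonglongrightarrow> complex_of_real (\<eta> 0) * complex_of_real (gauss_hat z)"
      by (intro AE_I2 tendsto_intros isCont_tendsto_compose[of 0 \<eta>] scale_seq_scaleR_lim)
    show "AE z in lborel. norm (complex_of_real (\<eta> (scale_seq k *\<^sub>R z)) * complex_of_real (gauss_hat z)) \<le> B * gauss_hat z" for k
      using B gauss_hat_nonneg by (intro AE_I2) (auto simp: norm_mult intro!: mult_right_mono)
  qed (use integrable_gauss_hat in auto)
  ultimately have "(\<integral>\<xi>. fourier \<eta> \<xi> * complex_of_real 1 \<partial>lborel) = (\<integral>z. complex_of_real (\<eta> 0) * complex_of_real (gauss_hat (z::real^'n)) \<partial>lborel)"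
    using LIMSEQ_unique by (simp only:) blast
  then show "(\<integral>\<xi>. fourier \<eta> \<xi> \<partial>lborel) = complex_of_real (\<eta> 0)"
    by (simp add: integral_gauss_hat)
qed

text \<open>Also true without integrability, since the Bochner integral is then 0 by
  convention.\<close>

lemma integral_norm_bound_ennreal_any:
  fixes f :: "'a \<Rightarrow> 'b::{banach,second_countable_topology}"
  shows "ennreal (norm (integral\<^sup>L M f)) \<le> (\<integral>\<^sup>+x. ennreal (norm (f x)) \<partial>M)"
  by (cases "integrable M f") (auto simp: integral_norm_bound_ennreal not_integrable_integral_eq)

text \<open>The inequality half of Plancherel. With a Gaussian factor, the integral of |fourier f|^2
  becomes the correlation of \<open>f\<close> with an average of its translates, and translations
  preserve the L^2 norm. Fatou's lemma then removes the Gaussian.\<close>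

lemma Bessel_fourier:
  fixes f :: "real^'n \<Rightarrow> real"
  assumes f: "integrable lborel f" and f2: "integrable lborel (\<lambda>x. (f x)\<^sup>2)"
  shows "integrable lborel (\<lambda>\<xi>. (cmod (fourier f \<xi>))\<^sup>2)"
    and "(\<integral>\<xi>. (cmod (fourier f \<xi>))\<^sup>2 \<partial>lborel) \<le> (\<integral>x. (f x)\<^sup>2 \<partial>lborel)"
proof -
  have [measurable]: "f \<in> borel_measurable borel" using f by auto
  let ?u = "\<lambda>x. complex_of_real (f x)"
  let ?g = "\<lambda>k \<xi>. complex_of_real (gauss (scale_seq k *\<^sub>R \<xi>))"
  let ?v = "\<lambda>\<xi>. complex_of_real (gauss \<xi>)"
  have u: "integrable lborel ?u" using f by simp
  have [measurable]: "cft ?u \<in> borel_measurable borel" "fourier f \<in> borel_measurable borel"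
    by (intro cft_measurable fourier_measurable; measurable)+
  have le: "(\<integral>\<^sup>+\<xi>. ennreal ((cmod (fourier f \<xi>))\<^sup>2 * gauss (scale_seq k *\<^sub>R \<xi>)) \<partial>lborel) \<le> ennreal (\<integral>x. (f x)\<^sup>2 \<partial>lborel)" for k
  proof -
    let ?s = "scale_seq k"
    have cg: "cft (?g k) z = complex_of_real ((1 / ?s) ^ CARD('n) * gauss_hat ((1/?s) *\<^sub>R z))" for z :: "real^'n"
    proof -
      have "cft (?g k) z = (1 / ?s) ^ CARD('n) *\<^sub>R cft ?v ((1/?s) *\<^sub>R z)"
        by (rule cft_scale[OF scale_seq_pos, of ?v]) measurable
      then show ?thesis by (simp add: cft_gauss scaleR_conv_of_real[where 'a=complex])
    qed
    have vi: "integrable lborel (\<lambda>\<xi>. cft ?u (- \<xi>) * ?g k \<xi>)"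
    proof (rule Bochner_Integration.integrable_bound)
      show "integrable lborel (\<lambda>\<xi>. complex_of_real (\<integral>x. cmod (?u x) \<partial>lborel) * ?g k \<xi>)"
        by (intro integrable_mult_right integrable_gauss_scale)
      show "AE \<xi> in lborel. norm (cft ?u (- \<xi>) * ?g k \<xi>) \<le> norm (complex_of_real (\<integral>x. cmod (?u x) \<partial>lborel) * ?g k \<xi>)"
      proof (rule AE_I2)
        fix \<xi>
        have "cmod (cft ?u (- \<xi>)) \<le> \<bar>\<integral>x. cmod (?u x) \<partial>lborel\<bar>"
          by (rule order_trans[OF cft_bound abs_ge_self])
        then show "norm (cft ?u (- \<xi>) * ?g k \<xi>) \<le> norm (complex_of_real (\<integral>x. cmod (?u x) \<partial>lborel) * ?g k \<xi>)"
          unfolding norm_mult norm_of_real by (intro mult_right_mono) auto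
      qed
    qed measurable
    have I: "integrable lborel (\<lambda>\<xi>. (cmod (fourier f \<xi>))\<^sup>2 * gauss (?s *\<^sub>R \<xi>))"
      and E: "complex_of_real (\<integral>\<xi>. (cmod (fourier f \<xi>))\<^sup>2 * gauss (?s *\<^sub>R \<xi>) \<partial>lborel)
        = (\<integral>x. ?u x * (\<integral>z. ?u (x - ?s *\<^sub>R z) * complex_of_real (gauss_hat z) \<partial>lborel) \<partial>lborel)"
    proof -
      \<comment> \<open>For real \<open>f\<close> the transform at - \<xi> is the conjugate, so the
        square modulus is a product to which \<open>cft_mult_cft\<close> applies.\<close>
      have e: "complex_of_real ((cmod (fourier f \<xi>))\<^sup>2 * gauss (?s *\<^sub>R \<xi>)) = cft ?u \<xi> * (cft ?u (- \<xi>) * ?g k \<xi>)" for \<xi>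
        by (simp add: fourier_cft[symmetric] fourier_uminus_arg mult.assoc[symmetric] complex_norm_square[symmetric])
      have "integrable lborel (\<lambda>\<xi>. cft ?u \<xi> * (cft ?u (- \<xi>) * ?g k \<xi>))"
      proof (rule Bochner_Integration.integrable_bound)
        show "integrable lborel (\<lambda>\<xi>. complex_of_real (\<integral>x. cmod (?u x) \<partial>lborel) * (cft ?u (- \<xi>) * ?g k \<xi>))"
          by (intro integrable_mult_right vi)
        show "AE \<xi> in lborel. norm (cft ?u \<xi> * (cft ?u (- \<xi>) * ?g k \<xi>)) \<le> norm (complex_of_real (\<integral>x. cmod (?u x) \<partial>lborel) * (cft ?u (- \<xi>) * ?g k \<xi>))"
        proof (rule AE_I2)
          fix \<xi>
          have "cmod (cft ?u \<xi>) \<le> \<bar>\<integral>x. cmod (?u x) \<partial>lborel\<bar>"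
            by (rule order_trans[OF cft_bound abs_ge_self])
          then show "norm (cft ?u \<xi> * (cft ?u (- \<xi>) * ?g k \<xi>)) \<le> norm (complex_of_real (\<integral>x. cmod (?u x) \<partial>lborel) * (cft ?u (- \<xi>) * ?g k \<xi>))"
            unfolding norm_mult norm_of_real by (intro mult_right_mono) auto
        qed
      qed measurable
      then have "integrable lborel (\<lambda>\<xi>. complex_of_real ((cmod (fourier f \<xi>))\<^sup>2 * gauss (?s *\<^sub>R \<xi>)))" by (simp only: e)
      then show I: "integrable lborel (\<lambda>\<xi>. (cmod (fourier f \<xi>))\<^sup>2 * gauss (?s *\<^sub>R \<xi>))"
        using integrable_Re by fastforce
      have "complex_of_real (\<integral>\<xi>. (cmod (fourier f \<xi>))\<^sup>2 * gauss (?s *\<^sub>R \<xi>) \<partial>lborel)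
         = (\<integral>\<xi>. cft ?u \<xi> * (cft ?u (- \<xi>) * ?g k \<xi>) \<partial>lborel)"
        by (subst integral_complex_of_real[symmetric]) (simp only: e)
      also have "\<dots> = (\<integral>x. ?u x * cft (\<lambda>\<xi>. cft ?u (- \<xi>) * ?g k \<xi>) x \<partial>lborel)"
        by (rule cft_duality[OF u vi])
      also have "\<dots> = (\<integral>x. ?u x * (\<integral>y. ?u y * cft (?g k) (x - y) \<partial>lborel) \<partial>lborel)"
        by (simp only: cft_mult_cft[OF u integrable_gauss_scale])
      also have "\<dots> = (\<integral>x. ?u x * (\<integral>z. ?u (x - ?s *\<^sub>R z) * complex_of_real (gauss_hat z) \<partial>lborel) \<partial>lborel)"
        by (subst convolution_cft_scale[OF scale_seq_pos, of ?v ?u]) (auto simp: cft_gauss)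
      finally show "complex_of_real (\<integral>\<xi>. (cmod (fourier f \<xi>))\<^sup>2 * gauss (?s *\<^sub>R \<xi>) \<partial>lborel)
        = (\<integral>x. ?u x * (\<integral>z. ?u (x - ?s *\<^sub>R z) * complex_of_real (gauss_hat z) \<partial>lborel) \<partial>lborel)" .
    qed
    define A where "A = (\<integral>x. (f x)\<^sup>2 \<partial>lborel)"
    have A0: "A \<ge> 0" unfolding A_def by simp
    have nnA: "(\<integral>\<^sup>+x. ennreal ((f x)\<^sup>2) \<partial>lborel) = ennreal A"
      unfolding A_def by (rule nn_integral_eq_integral[OF f2]) simp
    have nnA': "(\<integral>\<^sup>+x. ennreal ((f (x - t))\<^sup>2) \<partial>lborel) = ennreal A" for t
    proof -
      have "integrable lborel (\<lambda>x. (f (x + (- t)))\<^sup>2)" using f2 by (subst lborel_integrable_translate) auto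
      then have "(\<integral>\<^sup>+x. ennreal ((f (x + (- t)))\<^sup>2) \<partial>lborel) = ennreal (\<integral>x. (f (x + (- t)))\<^sup>2 \<partial>lborel)"
        by (rule nn_integral_eq_integral) simp
      also have "(\<integral>x. (f (x + (- t)))\<^sup>2 \<partial>lborel) = A" unfolding A_def by (rule lborel_integral_translate) measurable
      finally show ?thesis by simp
    qed
    have gh: "(\<integral>\<^sup>+z. ennreal (gauss_hat (z::real^'n)) \<partial>lborel) = 1"
      by (subst nn_integral_eq_integral) (auto simp: integrable_gauss_hat integral_gauss_hat gauss_hat_nonneg)
    have "ennreal (\<integral>\<xi>. (cmod (fourier f \<xi>))\<^sup>2 * gauss (?s *\<^sub>R \<xi>) \<partial>lborel)
       \<le> ennreal (cmod (\<integral>x. ?u x * (\<integral>z. ?u (x - ?s *\<^sub>R z) * complex_of_real (gauss_hat z) \<partial>lborel) \<partial>lborel))"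
      by (intro ennreal_leI) (simp only: E[symmetric] norm_of_real abs_ge_self)
    also have "\<dots> \<le> (\<integral>\<^sup>+x. ennreal (cmod (?u x * (\<integral>z. ?u (x - ?s *\<^sub>R z) * complex_of_real (gauss_hat z) \<partial>lborel))) \<partial>lborel)"
      by (rule integral_norm_bound_ennreal_any)
    also have "\<dots> \<le> (\<integral>\<^sup>+x. (\<integral>\<^sup>+z. ennreal (\<bar>f x\<bar> * (\<bar>f (x - ?s *\<^sub>R z)\<bar> * gauss_hat z)) \<partial>lborel) \<partial>lborel)"
    proof (rule nn_integral_mono)
      fix x
      have "ennreal (cmod (\<integral>z. ?u (x - ?s *\<^sub>R z) * complex_of_real (gauss_hat z) \<partial>lborel))
         \<le> (\<integral>\<^sup>+z. ennreal (cmod (?u (x - ?s *\<^sub>R z) * complex_of_real (gauss_hat z))) \<partial>lborel)"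
        by (rule integral_norm_bound_ennreal_any)
      then have "ennreal \<bar>f x\<bar> * ennreal (cmod (\<integral>z. ?u (x - ?s *\<^sub>R z) * complex_of_real (gauss_hat z) \<partial>lborel))
         \<le> ennreal \<bar>f x\<bar> * (\<integral>\<^sup>+z. ennreal (cmod (?u (x - ?s *\<^sub>R z) * complex_of_real (gauss_hat z))) \<partial>lborel)"
        by (rule mult_left_mono) simp
      also have "\<dots> = (\<integral>\<^sup>+z. ennreal \<bar>f x\<bar> * ennreal (cmod (?u (x - ?s *\<^sub>R z) * complex_of_real (gauss_hat z))) \<partial>lborel)"
        by (rule nn_integral_cmult[symmetric]) measurable
      also have "\<dots> = (\<integral>\<^sup>+z. ennreal (\<bar>f x\<bar> * (\<bar>f (x - ?s *\<^sub>R z)\<bar> * gauss_hat z)) \<partial>lborel)"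
        by (simp add: norm_mult ennreal_mult'[symmetric])
      finally show "ennreal (cmod (?u x * (\<integral>z. ?u (x - ?s *\<^sub>R z) * complex_of_real (gauss_hat z) \<partial>lborel)))
        \<le> (\<integral>\<^sup>+z. ennreal (\<bar>f x\<bar> * (\<bar>f (x - ?s *\<^sub>R z)\<bar> * gauss_hat z)) \<partial>lborel)"
        by (simp add: norm_mult ennreal_mult)
    qed
    \<comment> \<open>By a b \<le> a^2/2 + b^2/2, both summands have the same integral in x for
      every z, which is half of \<open>A\<close>; integrating in x first leaves only the mass of
      \<open>gauss_hat\<close>.\<close>
    also have "\<dots> \<le> (\<integral>\<^sup>+x. (\<integral>\<^sup>+z. ennreal (gauss_hat z) * (ennreal ((f x)\<^sup>2 / 2) + ennreal ((f (x - ?s *\<^sub>R z))\<^sup>2 / 2)) \<partial>lborel) \<partial>lborel)"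
    proof (intro nn_integral_mono)
      fix x z
      have "\<bar>f x\<bar> * \<bar>f (x - ?s *\<^sub>R z)\<bar> \<le> (f x)\<^sup>2 / 2 + (f (x - ?s *\<^sub>R z))\<^sup>2 / 2"
        using sum_squares_bound[of "\<bar>f x\<bar>" "\<bar>f (x - ?s *\<^sub>R z)\<bar>"] by simp
      then have "gauss_hat z * (\<bar>f x\<bar> * \<bar>f (x - ?s *\<^sub>R z)\<bar>) \<le> gauss_hat z * ((f x)\<^sup>2 / 2 + (f (x - ?s *\<^sub>R z))\<^sup>2 / 2)"
        using gauss_hat_nonneg by (intro mult_left_mono)
      then have "ennreal (\<bar>f x\<bar> * (\<bar>f (x - ?s *\<^sub>R z)\<bar> * gauss_hat z)) \<le> ennreal (gauss_hat z * ((f x)\<^sup>2 / 2 + (f (x - ?s *\<^sub>R z))\<^sup>2 / 2))"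
        by (intro ennreal_leI) (simp add: mult_ac)
      then show "ennreal (\<bar>f x\<bar> * (\<bar>f (x - ?s *\<^sub>R z)\<bar> * gauss_hat z)) \<le> ennreal (gauss_hat z) * (ennreal ((f x)\<^sup>2 / 2) + ennreal ((f (x - ?s *\<^sub>R z))\<^sup>2 / 2))"
        using gauss_hat_nonneg[of z] by (simp add: ennreal_mult ennreal_plus[symmetric] del: ennreal_plus)
    qed
    also have "\<dots> = (\<integral>\<^sup>+z. (\<integral>\<^sup>+x. ennreal (gauss_hat z) * (ennreal ((f x)\<^sup>2 / 2) + ennreal ((f (x - ?s *\<^sub>R z))\<^sup>2 / 2)) \<partial>lborel) \<partial>lborel)"
      by (rule lborel_pair.Fubini') measurable
    also have "\<dots> = (\<integral>\<^sup>+z. ennreal (gauss_hat (z::real^'n)) * ennreal A \<partial>lborel)"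
    proof (rule nn_integral_cong)
      fix z
      have half: "ennreal (c\<^sup>2 / 2) = ennreal (1/2) * ennreal (c\<^sup>2)" for c :: real
        by (subst ennreal_mult[symmetric]) auto
      have "(\<integral>\<^sup>+x. ennreal ((f x)\<^sup>2 / 2) + ennreal ((f (x - ?s *\<^sub>R z))\<^sup>2 / 2) \<partial>lborel) = ennreal (1/2) * ennreal A + ennreal (1/2) * ennreal A"
        unfolding half by (subst nn_integral_add) (simp_all add: nn_integral_cmult nnA nnA')
      also have "\<dots> = ennreal A" using A0
        by (subst ennreal_mult[symmetric], simp, simp, subst ennreal_mult[symmetric], simp, simp, subst ennreal_plus[symmetric]) auto
      finally show "(\<integral>\<^sup>+x. ennreal (gauss_hat z) * (ennreal ((f x)\<^sup>2 / 2) + ennreal ((f (x - ?s *\<^sub>R z))\<^sup>2 / 2)) \<partial>lborel) = ennreal (gauss_hat z) * ennreal A"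
        by (subst nn_integral_cmult) auto
    qed
    also have "\<dots> = ennreal A" by (subst nn_integral_multc) (auto simp: gh)
    finally have "ennreal (\<integral>\<xi>. (cmod (fourier f \<xi>))\<^sup>2 * gauss (?s *\<^sub>R \<xi>) \<partial>lborel) \<le> ennreal A" .
    then show ?thesis unfolding A_def
      by (subst nn_integral_eq_integral[OF I]) (use gauss_pos[THEN less_imp_le] in auto)
  qed
  have "(\<integral>\<^sup>+\<xi>. ennreal ((cmod (fourier f \<xi>))\<^sup>2) \<partial>lborel) \<le> (\<integral>\<^sup>+\<xi>. liminf (\<lambda>k. ennreal ((cmod (fourier f \<xi>))\<^sup>2 * gauss (scale_seq k *\<^sub>R \<xi>))) \<partial>lborel)"
  proof (rule nn_integral_mono)
    fix \<xi>
    have "(\<lambda>k. ennreal ((cmod (fourier f \<xi>))\<^sup>2 * gauss (scale_seq k *\<^sub>R \<xi>))) \<longlonglongrightarrow> ennreal ((cmod (fourier f \<xi>))\<^sup>2 * 1)"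
      by (intro tendsto_ennrealI tendsto_mult tendsto_const gauss_scale_lim)
    from lim_imp_Liminf[OF _ this] show "ennreal ((cmod (fourier f \<xi>))\<^sup>2) \<le> liminf (\<lambda>k. ennreal ((cmod (fourier f \<xi>))\<^sup>2 * gauss (scale_seq k *\<^sub>R \<xi>)))"
      by simp
  qed
  also have "\<dots> \<le> liminf (\<lambda>k. \<integral>\<^sup>+\<xi>. ennreal ((cmod (fourier f \<xi>))\<^sup>2 * gauss (scale_seq k *\<^sub>R \<xi>)) \<partial>lborel)"
    by (intro nn_integral_liminf) measurable
  also have "\<dots> \<le> ennreal (\<integral>x. (f x)\<^sup>2 \<partial>lborel)"
    by (rule Liminf_le) (use le in auto)
  finally have fin: "(\<integral>\<^sup>+\<xi>. ennreal ((cmod (fourier f \<xi>))\<^sup>2) \<partial>lborel) \<le> ennreal (\<integral>x. (f x)\<^sup>2 \<partial>lborel)" .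
  then show I: "integrable lborel (\<lambda>\<xi>. (cmod (fourier f \<xi>))\<^sup>2)"
    by (intro integrableI_bounded) (auto simp: le_less_trans)
  show "(\<integral>\<xi>. (cmod (fourier f \<xi>))\<^sup>2 \<partial>lborel) \<le> (\<integral>x. (f x)\<^sup>2 \<partial>lborel)"
    using fin by (subst (asm) nn_integral_eq_integral[OF I]) auto
qed

subsection \<open>Inverse transforms of test functions\<close>

text \<open>The inverse transform of a test function is not a test function; cutting it off at scale
  \<open>k\<close> mollifies its transform, which keeps the support essentially fixed and yields domination.\<close>

lemma test_fun_fourier_inverse:
  fixes \<psi> :: "real^'n \<Rightarrow> real"
  assumes \<psi>: "test_fun \<psi>"
  obtains a b C where "\<And>k::nat. test_fun (a k)" "\<And>k. test_fun (b k)" "C > 0"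
    "\<And>x. (\<lambda>k. fourier (a k) x + \<i> * fourier (b k) x) \<longlonglongrightarrow> complex_of_real (\<psi> x)"
    "\<And>k x. cmod (fourier (a k) x + \<i> * fourier (b k) x) \<le> C * weight x"
    "\<And>\<xi>. (\<lambda>k. Complex (a k \<xi>) (b k \<xi>)) \<longlonglongrightarrow> cnj (fourier \<psi> \<xi>)"
    "\<And>k \<xi>. cmod (Complex (a k \<xi>) (b k \<xi>)) \<le> cmod (fourier \<psi> \<xi>)"
proof -
  obtain \<eta> :: "real^'n \<Rightarrow> real" where \<eta>: "test_fun \<eta>" "\<eta> 0 = 1" "\<And>x. 0 \<le> \<eta> x" "\<And>x. \<eta> x \<le> 1"
  proof -
    \<comment> \<open>In one variable the product exp (-1/(1+t)) exp (-1/(1-t)) is largest at t = 0,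
      where it equals exp (-2); the factor \<open>exp 2\<close> normalises this maximum to
      1.\<close>
    define \<eta> where "\<eta> = (\<lambda>x::real^'n. \<Prod>i\<in>Basis. exp 2 * (flat_exp 0 (x \<bullet> i + 1) * flat_exp 0 (x \<bullet> (- i) + 1)))"
    have le: "flat_exp 0 (t + 1) * flat_exp 0 (- t + 1) \<le> exp (- 2)" for t
    proof (cases "-1 < t \<and> t < 1")
      case True
      then have t: "t + 1 > 0" "1 - t > 0" by auto
      then have "flat_exp 0 (t + 1) * flat_exp 0 (- t + 1) = exp (- (inverse (t + 1) + inverse (1 - t)))"
        by (simp add: flat_exp_def exp_add[symmetric])
      also have "\<dots> \<le> exp (- 2)"
      proof -
        have "2 * ((t + 1) * (1 - t)) \<le> 2" by (simp add: algebra_simps power2_eq_square[symmetric])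
        then have "2 \<le> 2 / ((t + 1) * (1 - t))" using t by (simp add: pos_le_divide_eq)
        also have "\<dots> = inverse (t + 1) + inverse (1 - t)" using t by (simp add: field_simps)
        finally show ?thesis by simp
      qed
      finally show ?thesis .
    qed (auto simp: flat_exp_def)
    have le1: "exp 2 * (flat_exp 0 (t + 1) * flat_exp 0 (- t + 1)) \<le> 1" for t
    proof -
      have "exp 2 * (flat_exp 0 (t + 1) * flat_exp 0 (- t + 1)) \<le> exp 2 * exp (- 2)"
        using le[of t] by (rule mult_left_mono) simp
      then show ?thesis by (simp add: exp_minus)
    qed
    have nn: "0 \<le> exp 2 * (flat_exp 0 (t + 1) * flat_exp 0 (- t + 1))" for t
      by (auto simp: flat_exp_def)
    have "smooth_fun \<eta>" unfolding \<eta>_def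
      by (intro smooth_fun_prod smooth_fun_cmult smooth_fun_mult smooth_flat_ridge) auto
    moreover have "{x. \<eta> x \<noteq> 0} \<subseteq> cbox (- One) One"
    proof (rule subsetI, rule ccontr)
      fix x assume x: "x \<in> {x. \<eta> x \<noteq> 0}" "x \<notin> cbox (- One) (One :: real^'n)"
      then obtain i where i: "i \<in> Basis" "x \<bullet> i < -1 \<or> x \<bullet> i > 1"
        unfolding mem_box by (force simp: not_le)
      then have "exp 2 * (flat_exp 0 (x \<bullet> i + 1) * flat_exp 0 (x \<bullet> (- i) + 1)) = 0" by (auto simp: flat_exp_def)
      then have "\<eta> x = 0" unfolding \<eta>_def using i(1) by (intro prod_zero) auto
      then show False using x by simp
    qed
    ultimately have "test_fun \<eta>" unfolding test_fun_def using bounded_subset bounded_cbox by blast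
    moreover have "\<eta> 0 = 1" by (simp add: \<eta>_def flat_exp_def exp_add[symmetric])
    moreover have "0 \<le> \<eta> x" for x unfolding \<eta>_def using nn[of "x \<bullet> _"] by (intro prod_nonneg) simp
    moreover have "\<eta> x \<le> 1" for x unfolding \<eta>_def using nn[of "x \<bullet> _"] le1[of "x \<bullet> _"] by (intro prod_le_1) simp
    ultimately show thesis using that by blast
  qed
  define c where "c = (\<lambda>k \<xi>. \<eta> (scale_seq k *\<^sub>R \<xi>))"
  \<comment> \<open>Since \<psi> is real, its inverse transform is the conjugate of its transform;
    \<open>a\<close> and \<open>b\<close> are the cut-off real and imaginary parts, whence the minus
    sign in \<open>b\<close>.\<close>
  define a where "a = (\<lambda>k \<xi>. c k \<xi> * Re (fourier \<psi> \<xi>))"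
  define b where "b = (\<lambda>k \<xi>. c k \<xi> * (- 1 * Im (fourier \<psi> \<xi>)))"
  have c: "test_fun (c k)" for k
    unfolding c_def using test_fun_scale[OF \<eta>(1), of "scale_seq k" 0] scale_seq_pos[of k] by auto
  have a: "test_fun (a k)" for k
    unfolding a_def by (rule test_fun_mult[OF c smooth_Re_fourier[OF \<psi>]])
  have b: "test_fun (b k)" for k
    unfolding b_def by (rule test_fun_mult[OF c smooth_fun_cmult[OF smooth_Im_fourier[OF \<psi>]]])
  have C: "Complex (a k \<xi>) (b k \<xi>) = cnj (fourier \<psi> \<xi>) * complex_of_real (c k \<xi>)" for k \<xi>
    by (simp add: a_def b_def complex_eq_iff)
  have clim: "(\<lambda>k. c k \<xi>) \<longlonglongrightarrow> 1" for \<xi>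
  proof -
    have "isCont \<eta> 0" using test_fun_continuous[OF \<eta>(1), of UNIV] by (simp add: continuous_on_eq_continuous_at)
    then have "(\<lambda>k. c k \<xi>) \<longlonglongrightarrow> \<eta> 0" unfolding c_def by (rule isCont_tendsto_compose[OF _ scale_seq_scaleR_lim])
    then show ?thesis using \<eta>(2) by simp
  qed
  let ?X = "\<lambda>x. complex_of_real (\<eta> x)"
  let ?P = "\<lambda>x. complex_of_real (\<psi> x)"
  have [measurable]: "\<eta> \<in> borel_measurable borel" "\<psi> \<in> borel_measurable borel"
    using \<eta>(1) \<psi> test_fun_measurable by auto
  have F: "fourier (a k) x + \<i> * fourier (b k) x = (\<integral>z. ?P (x - scale_seq k *\<^sub>R z) * fourier \<eta> z \<partial>lborel)" for k x
  proof -
    have "fourier (a k) x + \<i> * fourier (b k) x = cft (\<lambda>\<xi>. complex_of_real (a k \<xi>) + \<i> * complex_of_real (b k \<xi>)) x"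
      unfolding fourier_cft using a b test_fun_integrable by (subst cft_add) (auto simp: cft_cmult)
    also have "(\<lambda>\<xi>. complex_of_real (a k \<xi>) + \<i> * complex_of_real (b k \<xi>)) = (\<lambda>\<xi>. cft ?P (- \<xi>) * complex_of_real (c k \<xi>))"
      using C by (simp add: fun_eq_iff Complex_eq fourier_cft[symmetric] fourier_uminus_arg)
    also have "cft \<dots> x = (\<integral>y. ?P y * cft (\<lambda>\<xi>. complex_of_real (c k \<xi>)) (x - y) \<partial>lborel)"
      using test_fun_integrable[OF \<psi>] test_fun_integrable[OF c] by (intro cft_mult_cft) auto
    also have "\<dots> = (\<integral>z. ?P (x - scale_seq k *\<^sub>R z) * cft ?X z \<partial>lborel)"
      unfolding c_def by (rule convolution_cft_scale[OF scale_seq_pos]) measurable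
    finally show ?thesis by (simp only: fourier_cft)
  qed
  obtain R where R: "R > 0" "\<And>x. norm x > R \<Longrightarrow> \<psi> x = 0" using test_fun_support[OF \<psi>] by blast
  obtain B where B: "B > 0" "\<And>x. \<bar>\<psi> x\<bar> \<le> B" using test_fun_bounded[OF \<psi>] by blast
  \<comment> \<open>Two powers of the weight are requested: one is integrated in z, the other is
    traded for decay in x.\<close>
  obtain C1 where C1: "C1 > 0" "\<And>\<xi>. cmod (fourier \<eta> \<xi>) \<le> C1 * weight \<xi> ^ 2" using fourier_decay_weight[OF \<eta>(1)] by blast
  \<comment> \<open>On the support of the integrand |x| \<le> R + |z|, hence 1 + |x|^2 \<le> (2 + 2
    R^2) (1 + |z|^2); the d-th power compares the two weights.\<close>
  define K where "K = (2 + 2 * R\<^sup>2) ^ CARD('n)"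
  have K: "K > 0" unfolding K_def by (intro zero_less_power) (simp add: add_pos_nonneg)
  have wle: "weight z \<le> K * weight x" if "norm (x - s *\<^sub>R z) \<le> R" "0 \<le> s" "s \<le> 1" for x z :: "real^'n" and s
  proof -
    have "norm x \<le> norm (x - s *\<^sub>R z) + norm (s *\<^sub>R z)" using norm_triangle_ineq[of "x - s *\<^sub>R z" "s *\<^sub>R z"] by simp
    moreover have "norm (s *\<^sub>R z) \<le> norm z" using that by (simp add: mult_left_le_one_le)
    ultimately have "norm x \<le> R + norm z" using that by linarith
    then have "(norm x)\<^sup>2 \<le> (R + norm z)\<^sup>2" by (intro power_mono) auto
    also have "\<dots> \<le> 2 * R\<^sup>2 + 2 * (norm z)\<^sup>2"
      using sum_squares_bound[of R "norm z"] by (simp add: power2_sum)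
    finally have "1 + (norm x)\<^sup>2 \<le> (2 + 2 * R\<^sup>2) * (1 + (norm z)\<^sup>2)"
    proof -
      assume h: "(norm x)\<^sup>2 \<le> 2 * R\<^sup>2 + 2 * (norm z)\<^sup>2"
      have "0 \<le> R\<^sup>2 * (norm z)\<^sup>2" by simp
      moreover have "(2 + 2 * R\<^sup>2) * (1 + (norm z)\<^sup>2) = 2 + 2 * R\<^sup>2 + 2 * (norm z)\<^sup>2 + 2 * (R\<^sup>2 * (norm z)\<^sup>2)"
        by (simp add: algebra_simps)
      ultimately show ?thesis using h by linarith
    qed
    then have "inverse (1 + (norm z)\<^sup>2) \<le> (2 + 2 * R\<^sup>2) * inverse (1 + (norm x)\<^sup>2)"
      using norm2_pos[of x] norm2_pos[of z] by (simp add: field_simps)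
    then have "inverse (1 + (norm z)\<^sup>2) ^ CARD('n) \<le> ((2 + 2 * R\<^sup>2) * inverse (1 + (norm x)\<^sup>2)) ^ CARD('n)"
      by (rule power_mono) simp
    then show ?thesis by (simp add: weight_def K_def power_mult_distrib)
  qed
  have bd: "cmod (?P (x - scale_seq k *\<^sub>R z) * fourier \<eta> z) \<le> (B * C1 * K * weight x) * weight z" for k x z
  proof (cases "norm (x - scale_seq k *\<^sub>R z) \<le> R")
    case True
    have w: "weight z \<le> K * weight x"
      using wle[OF True] scale_seq_pos[of k] scale_seq_le1[of k] by simp
    have "cmod (?P (x - scale_seq k *\<^sub>R z) * fourier \<eta> z) \<le> B * (C1 * weight z ^ 2)"
      unfolding norm_mult by (rule mult_mono) (use B C1 in auto)
    also have "\<dots> = (B * C1 * weight z) * weight z" by (simp add: power2_eq_square)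
    also have "\<dots> \<le> (B * C1 * (K * weight x)) * weight z"
      using B C1 w by (intro mult_right_mono mult_left_mono) auto
    finally show ?thesis by (simp add: mult_ac)
  next
    case False
    then show ?thesis using R(2)[of "x - scale_seq k *\<^sub>R z"] B C1 K by simp
  qed
  define W where "W = (\<integral>z. weight (z::real^'n) \<partial>lborel)"
  have W0: "W \<ge> 0" unfolding W_def by simp
  show thesis
  \<comment> \<open>\<open>W + 1\<close> in place of \<open>W\<close> makes the constant strictly
    positive from \<open>W \<ge> 0\<close> alone.\<close>
  proof (rule that[of a b "B * C1 * K * (W + 1)", OF a b])
    show "B * C1 * K * (W + 1) > 0" using B C1 K W0 by simp
    have iw: "integrable lborel (\<lambda>z::real^'n. (B * C1 * K * weight x) * weight z)" for x :: "real^'n"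
      by (intro integrable_mult_right integrable_weight)
    show "(\<lambda>k. fourier (a k) x + \<i> * fourier (b k) x) \<longlonglongrightarrow> complex_of_real (\<psi> x)" for x
    proof -
      have "(\<lambda>k. \<integral>z. ?P (x - scale_seq k *\<^sub>R z) * fourier \<eta> z \<partial>lborel) \<longlonglongrightarrow> (\<integral>z. ?P x * fourier \<eta> z \<partial>lborel)"
      proof (rule integral_dominated_convergence[where w="\<lambda>z. (B * C1 * K * weight x) * weight z"])
        have "isCont \<psi> x" using test_fun_continuous[OF \<psi>, of UNIV] by (simp add: continuous_on_eq_continuous_at)
        moreover have "(\<lambda>k. x - scale_seq k *\<^sub>R z) \<longlonglongrightarrow> x" for z
          using tendsto_diff[OF tendsto_const[of x] scale_seq_scaleR_lim[of z]] by simp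
        ultimately show "AE z in lborel. (\<lambda>k. ?P (x - scale_seq k *\<^sub>R z) * fourier \<eta> z) \<longlonglongrightarrow> ?P x * fourier \<eta> z"
          by (intro AE_I2 tendsto_intros isCont_tendsto_compose[of x \<psi>])
      qed (use bd iw in auto)
      then show ?thesis using integral_fourier_test_fun[OF \<eta>(1)] \<eta>(2) by (simp add: F)
    qed
    show "cmod (fourier (a k) x + \<i> * fourier (b k) x) \<le> B * C1 * K * (W + 1) * weight x" for k x
    proof -
      have "cmod (fourier (a k) x + \<i> * fourier (b k) x) \<le> (\<integral>z. cmod (?P (x - scale_seq k *\<^sub>R z) * fourier \<eta> z) \<partial>lborel)"
        unfolding F by (rule integral_norm_bound)
      also have "\<dots> \<le> (\<integral>z. (B * C1 * K * weight x) * weight (z::real^'n) \<partial>lborel)"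
      proof (rule integral_mono)
        show "integrable lborel (\<lambda>z. cmod (?P (x - scale_seq k *\<^sub>R z) * fourier \<eta> z))"
          by (rule Bochner_Integration.integrable_bound[OF iw[of x]])
            (use bd in \<open>auto intro!: AE_I2 intro: order_trans[OF _ abs_ge_self]\<close>)
      qed (rule iw, rule bd)
      also have "\<dots> = B * C1 * K * W * weight x" by (simp add: W_def)
      also have "\<dots> \<le> B * C1 * K * (W + 1) * weight x"
        using B C1 K by (intro mult_right_mono mult_left_mono) auto
      finally show ?thesis .
    qed
    show "(\<lambda>k. Complex (a k \<xi>) (b k \<xi>)) \<longlonglongrightarrow> cnj (fourier \<psi> \<xi>)" for \<xi>
      using tendsto_mult[OF tendsto_const[of "cnj (fourier \<psi> \<xi>)"] tendsto_of_real[OF clim[of \<xi>]]]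
      by (simp add: C)
    show "cmod (Complex (a k \<xi>) (b k \<xi>)) \<le> cmod (fourier \<psi> \<xi>)" for k \<xi>
      using \<eta>(3,4)[of "scale_seq k *\<^sub>R \<xi>"] unfolding C norm_mult by (auto simp: c_def intro!: mult_left_le)
  qed
qed

subsection \<open>Square integrable functions\<close>

lemma cnj_measurable [measurable]: "cnj \<in> borel_measurable borel"
  by (intro borel_measurable_continuous_onI continuous_intros)

definition L2 :: "(real^'n \<Rightarrow> complex) set" where
  "L2 = {u. u \<in> borel_measurable borel \<and> integrable lborel (\<lambda>x. (cmod (u x))\<^sup>2)}"

text \<open>On complex numbers \<open>\<bullet>\<close> is the real inner product, so this is the
  real part of the Hermitian product. The variational arguments live in a real Hilbert space; the
  imaginary part is recovered by pairing with \<open>\<i> * v\<close>, see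
  \<open>ip_Im\<close>.\<close>

definition ip :: "(real^'n \<Rightarrow> complex) \<Rightarrow> (real^'n \<Rightarrow> complex) \<Rightarrow> real" where
  "ip u v = (\<integral>x. u x \<bullet> v x \<partial>lborel)"

lemma ip_self: "ip u u = (\<integral>x. (cmod (u x))\<^sup>2 \<partial>lborel)"
  by (simp add: ip_def power2_norm_eq_inner)

lemma ip_nonneg [simp]: "0 \<le> ip u u"
  by (simp add: ip_self)

lemma ip_commute: "ip u v = ip v u"
  by (simp add: ip_def inner_commute)

lemma L2_measurable [measurable_dest]: "u \<in> L2 \<Longrightarrow> u \<in> borel_measurable borel"
  by (simp add: L2_def)

lemma L2_norm_mult_integrable:
  assumes "u \<in> L2" "v \<in> L2"
  shows "integrable lborel (\<lambda>x. cmod (u x) * cmod (v x))"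
proof (rule Bochner_Integration.integrable_bound)
  show "integrable lborel (\<lambda>x. (cmod (u x))\<^sup>2 + (cmod (v x))\<^sup>2)" using assms by (auto simp: L2_def)
  have "cmod a * cmod b \<le> (cmod a)\<^sup>2 + (cmod b)\<^sup>2" for a b
    using sum_squares_bound[of "cmod a" "cmod b"] mult_nonneg_nonneg[of "cmod a" "cmod b"] by (simp del: mult_nonneg_nonneg)
  then show "AE x in lborel. norm (cmod (u x) * cmod (v x)) \<le> norm ((cmod (u x))\<^sup>2 + (cmod (v x))\<^sup>2)"
    by (intro AE_I2) (simp add: abs_mult)
qed (use assms in measurable)

lemma L2_mult_integrable:
  assumes "u \<in> L2" "v \<in> L2"
  shows "integrable lborel (\<lambda>x. u x * cnj (v x))"
proof (rule Bochner_Integration.integrable_bound[OF L2_norm_mult_integrable[OF assms]])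
  show "AE x in lborel. norm (u x * cnj (v x)) \<le> norm (cmod (u x) * cmod (v x))"
    by (simp add: norm_mult)
qed (use assms in measurable)

lemma ip_integrable:
  assumes "u \<in> L2" "v \<in> L2"
  shows "integrable lborel (\<lambda>x. u x \<bullet> v x)"
proof (rule Bochner_Integration.integrable_bound[OF L2_norm_mult_integrable[OF assms]])
  show "AE x in lborel. norm (u x \<bullet> v x) \<le> norm (cmod (u x) * cmod (v x))"
    using Cauchy_Schwarz_ineq2 by (intro AE_I2) (auto simp: abs_mult)
qed (use assms in measurable)

lemma inner_complex_eq: "a \<bullet> b = Re (a * cnj b)"
  by (simp add: inner_complex_def)

lemma ip_Re: "u \<in> L2 \<Longrightarrow> v \<in> L2 \<Longrightarrow> ip u v = Re (\<integral>x. u x * cnj (v x) \<partial>lborel)"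
  by (subst integral_Re[OF L2_mult_integrable, symmetric]) (auto simp: ip_def inner_complex_eq)

lemma L2_cmult: "u \<in> L2 \<Longrightarrow> (\<lambda>x. c * u x) \<in> L2"
  by (auto simp: L2_def norm_mult power_mult_distrib)

lemma L2_add: "u \<in> L2 \<Longrightarrow> v \<in> L2 \<Longrightarrow> (\<lambda>x. u x + v x) \<in> L2"
  using integrable_powr_add[of u lborel v 2] by (auto simp: L2_def)

lemma L2_diff: "u \<in> L2 \<Longrightarrow> v \<in> L2 \<Longrightarrow> (\<lambda>x. u x - v x) \<in> L2"
  using L2_add[of u "\<lambda>x. (-1) * v x"] L2_cmult[of v "-1"] by simp

lemma ip_add_left: "u \<in> L2 \<Longrightarrow> v \<in> L2 \<Longrightarrow> w \<in> L2 \<Longrightarrow> ip (\<lambda>x. u x + v x) w = ip u w + ip v w"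
  by (simp add: ip_def inner_add_left ip_integrable)

lemma ip_diff_left: "u \<in> L2 \<Longrightarrow> v \<in> L2 \<Longrightarrow> w \<in> L2 \<Longrightarrow> ip (\<lambda>x. u x - v x) w = ip u w - ip v w"
  by (simp add: ip_def inner_diff_left ip_integrable)

lemma ip_cmult_left: "ip (\<lambda>x. complex_of_real c * u x) w = c * ip u w"
  by (simp add: ip_def scaleR_conv_of_real[where 'a=complex, symmetric])

lemma ip_add_right: "u \<in> L2 \<Longrightarrow> v \<in> L2 \<Longrightarrow> w \<in> L2 \<Longrightarrow> ip w (\<lambda>x. u x + v x) = ip w u + ip w v"
  by (simp add: ip_commute[of w] ip_add_left)

lemma ip_diff_right: "u \<in> L2 \<Longrightarrow> v \<in> L2 \<Longrightarrow> w \<in> L2 \<Longrightarrow> ip w (\<lambda>x. u x - v x) = ip w u - ip w v"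
  by (simp add: ip_commute[of w] ip_diff_left)

lemma ip_cmult_right: "ip w (\<lambda>x. complex_of_real c * u x) = c * ip w u"
  by (simp add: ip_commute[of w] ip_cmult_left)

lemma ip_cong:
  assumes "AE x in lborel. u x = u' x" "AE x in lborel. v x = v' x"
    and "u \<in> borel_measurable borel" "u' \<in> borel_measurable borel" "v \<in> borel_measurable borel" "v' \<in> borel_measurable borel"
  shows "ip u v = ip u' v'"
  unfolding ip_def using assms by (intro integral_cong_AE) (measurable, auto)

lemma L2_cong:
  assumes "u \<in> L2" "AE x in lborel. v x = u x" "v \<in> borel_measurable borel"
  shows "v \<in> L2"
proof -
  have "integrable lborel (\<lambda>x. (cmod (v x))\<^sup>2) \<longleftrightarrow> integrable lborel (\<lambda>x. (cmod (u x))\<^sup>2)"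
    using assms by (intro integrable_cong_AE) (auto simp: L2_def)
  then show ?thesis using assms by (simp add: L2_def)
qed

lemma ip_expand:
  assumes "u \<in> L2" "v \<in> L2"
  shows "ip (\<lambda>x. u x + complex_of_real t * v x) (\<lambda>x. u x + complex_of_real t * v x) = ip u u + 2 * t * ip u v + t\<^sup>2 * ip v v"
  using assms by (simp add: ip_add_left ip_add_right L2_add L2_cmult ip_cmult_left ip_cmult_right ip_commute[of v u]
      power2_eq_square algebra_simps)

lemma quadratic_nonneg_linear_zero:
  fixes b c :: real
  assumes "\<And>t. 0 \<le> 2 * t * b + t\<^sup>2 * c"
  shows "b = 0"
proof (rule ccontr)
  assume b: "b \<noteq> 0"
  \<comment> \<open>At t = - b/s the quadratic term is at most half of the modulus of the linear
    one, because s \<ge> c; taking s \<ge> 1 covers c = 0 as well.\<close>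
  define s where "s = 1 + \<bar>c\<bar>"
  have s: "s > 0" "c \<le> s" "s \<ge> 1" by (auto simp: s_def)
  have "0 \<le> 2 * (- b / s) * b + (- b / s)\<^sup>2 * c" by (rule assms)
  also have "\<dots> \<le> 2 * (- b / s) * b + (- b / s)\<^sup>2 * s"
    using s by (intro add_left_mono mult_left_mono) auto
  also have "\<dots> = - b\<^sup>2 / s" using s by (simp add: power2_eq_square field_simps)
  finally show False using b s by (simp add: divide_le_0_iff)
qed

lemma ip_Cauchy_Schwarz:
  assumes u: "u \<in> L2" and v: "v \<in> L2"
  shows "\<bar>ip u v\<bar> \<le> sqrt (ip u u) * sqrt (ip v v)"
proof (cases "ip v v = 0")
  case True
  have "0 \<le> ip u u + 2 * t * ip u v" for t
    using ip_nonneg[of "\<lambda>x. u x + complex_of_real t * v x"] unfolding ip_expand[OF u v] True by simp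
  note nn = this
  have "ip u v = 0"
  proof (rule ccontr)
    assume n: "ip u v \<noteq> 0"
    have "0 \<le> ip u u + 2 * (- (ip u u + 1) / (2 * ip u v)) * ip u v" by (rule nn)
    also have "\<dots> = - 1" using n by (simp add: field_simps)
    finally show False by simp
  qed
  then show ?thesis by simp
next
  case False
  then have p: "ip v v > 0" using ip_nonneg[of v] by linarith
  define t where "t = - ip u v / ip v v"
  have "0 \<le> ip u u + 2 * t * ip u v + t\<^sup>2 * ip v v"
    using ip_nonneg[of "\<lambda>x. u x + complex_of_real t * v x"] unfolding ip_expand[OF u v] .
  also have "\<dots> = ip u u - (ip u v)\<^sup>2 / ip v v" using p by (simp add: t_def power2_eq_square field_simps)
  finally have "(ip u v)\<^sup>2 \<le> ip u u * ip v v" using p by (simp add: field_simps)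
  then have "sqrt ((ip u v)\<^sup>2) \<le> sqrt (ip u u * ip v v)" by (rule real_sqrt_le_mono)
  then show ?thesis by (simp add: real_sqrt_mult)
qed

lemma ip_parallelogram:
  assumes "u \<in> L2" "v \<in> L2"
  shows "ip (\<lambda>x. u x - v x) (\<lambda>x. u x - v x) + ip (\<lambda>x. u x + v x) (\<lambda>x. u x + v x) = 2 * ip u u + 2 * ip v v"
  using assms by (simp add: ip_add_left ip_add_right ip_diff_left ip_diff_right L2_add L2_diff)

lemma L2_complete:
  assumes u: "\<And>n. u n \<in> L2"
    and C: "\<And>e. e > 0 \<Longrightarrow> \<exists>N. \<forall>m\<ge>N. \<forall>n\<ge>N. ip (\<lambda>x. u m x - u n x) (\<lambda>x. u m x - u n x) < e"
  obtains G where "G \<in> L2" "(\<lambda>n::nat. ip (\<lambda>x. u n x - G x) (\<lambda>x. u n x - G x)) \<longlonglongrightarrow> 0"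
proof -
  from u have m: "u n \<in> borel_measurable lborel" and i: "integrable lborel (\<lambda>x. norm (u n x) powr 2)" for n
    by (auto simp: L2_def)
  have c: "\<exists>N. \<forall>m\<ge>N. \<forall>n\<ge>N. (\<integral>x. norm (u m x - u n x) powr 2 \<partial>lborel) < e" if "e > 0" for e
    using C[OF that] by (simp add: ip_self)
  obtain G r where "G \<in> borel_measurable lborel" "integrable lborel (\<lambda>x. norm (G x) powr 2)" "strict_mono r"
    "AE x in lborel. (\<lambda>k. u (r k) x) \<longlonglongrightarrow> G x"
     "(\<lambda>n. \<integral>x. norm (u n x - G x) powr 2 \<partial>lborel) \<longlonglongrightarrow> 0"
    by (rule Lp_complete[of 2 u lborel, OF zero_less_numeral m i c])
  then show ?thesis by (intro that[of G]) (auto simp: L2_def ip_self)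
qed

lemma ip_tendsto:
  assumes u: "\<And>n. u n \<in> L2" and G: "G \<in> L2" and v: "v \<in> L2"
    and lim: "(\<lambda>n::nat. ip (\<lambda>x. u n x - G x) (\<lambda>x. u n x - G x)) \<longlonglongrightarrow> 0"
  shows "(\<lambda>n. ip (u n) v) \<longlonglongrightarrow> ip G v"
proof -
  have "(\<lambda>n. ip (u n) v - ip G v) \<longlonglongrightarrow> 0"
  proof (rule Lim_null_comparison)
    show "\<forall>\<^sub>F n in sequentially. norm (ip (u n) v - ip G v) \<le> sqrt (ip (\<lambda>x. u n x - G x) (\<lambda>x. u n x - G x)) * sqrt (ip v v)"
      using ip_Cauchy_Schwarz[OF L2_diff[OF u G] v] ip_diff_left[OF u G v] by (intro always_eventually) simp
    have "(\<lambda>n. sqrt (ip (\<lambda>x. u n x - G x) (\<lambda>x. u n x - G x)) * sqrt (ip v v)) \<longlonglongrightarrow> sqrt 0 * sqrt (ip v v)"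
      by (intro tendsto_intros lim)
    then show "(\<lambda>n. sqrt (ip (\<lambda>x. u n x - G x) (\<lambda>x. u n x - G x)) * sqrt (ip v v)) \<longlonglongrightarrow> 0" by simp
  qed
  then show ?thesis by (simp add: LIM_zero_iff)
qed

lemma ip_self_tendsto:
  assumes u: "\<And>n. u n \<in> L2" and G: "G \<in> L2"
    and lim: "(\<lambda>n::nat. ip (\<lambda>x. u n x - G x) (\<lambda>x. u n x - G x)) \<longlonglongrightarrow> 0"
  shows "(\<lambda>n. ip (u n) (u n)) \<longlonglongrightarrow> ip G G"
proof -
  have e: "ip (u n) (u n) = ip (\<lambda>x. u n x - G x) (\<lambda>x. u n x - G x) + 2 * ip (u n) G - ip G G" for n
    using u[of n] G by (simp add: ip_diff_left ip_diff_right L2_diff ip_commute[of G "u n"])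
  have "(\<lambda>n. ip (\<lambda>x. u n x - G x) (\<lambda>x. u n x - G x) + 2 * ip (u n) G - ip G G) \<longlonglongrightarrow> 0 + 2 * ip G G - ip G G"
    by (intro tendsto_intros lim ip_tendsto[OF u G G lim])
  then show ?thesis by (simp add: e)
qed

lemma ip_Im:
  assumes "u \<in> L2" "v \<in> L2"
  shows "ip u (\<lambda>x. \<i> * v x) = Im (\<integral>x. u x * cnj (v x) \<partial>lborel)"
  by (subst integral_Im[OF L2_mult_integrable[OF assms], symmetric])
    (simp add: ip_def inner_complex_eq algebra_simps)

subsection \<open>Homogeneous Sobolev spaces on the Fourier side\<close>

text \<open>The multipliers \<open>\<bar>2\<pi>\<xi>\<bar>\<close> to the power \<open>\<plusminus>\<alpha>/2\<close> identify both Sobolev products with the product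
  \<open>ip\<close> of \<open>L2\<close>.\<close>

definition hs :: "real \<Rightarrow> (real^'n \<Rightarrow> real) \<Rightarrow> real^'n \<Rightarrow> complex" where
  "hs \<alpha> \<psi> \<xi> = complex_of_real ((2 * pi * norm \<xi>) powr (\<alpha>/2)) * fourier \<psi> \<xi>"

definition ht :: "real \<Rightarrow> (real^'n \<Rightarrow> real) \<Rightarrow> real^'n \<Rightarrow> complex" where
  "ht \<alpha> \<rho> \<xi> = complex_of_real ((2 * pi * norm \<xi>) powr (-\<alpha>/2)) * fourier_d \<rho> \<xi>"

lemma powr_half_square: "(x powr (a/2))\<^sup>2 = x powr (a::real)"
  by (simp add: power2_eq_square powr_add[symmetric])

lemma powr_norm_weight:
  fixes \<xi> :: "real^'n"
  assumes "0 < \<alpha>" "\<alpha> < real CARD('n)"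
  shows "(2 * pi * norm \<xi>) powr \<alpha> * weight \<xi> \<le> (2 * pi) powr \<alpha>"
proof -
  have p: "0 < (1 + (norm \<xi>)\<^sup>2) ^ CARD('n)" using norm2_pos[of \<xi>] by (rule zero_less_power)
  have "norm \<xi> powr \<alpha> \<le> (1 + (norm \<xi>)\<^sup>2) ^ CARD('n)"
  proof (cases "norm \<xi> \<le> 1")
    case True
    have "norm \<xi> powr \<alpha> \<le> 1 powr \<alpha>" using True assms by (intro powr_mono2) auto
    also have "\<dots> \<le> (1 + (norm \<xi>)\<^sup>2) ^ CARD('n)" by (simp add: one_le_power)
    finally show ?thesis .
  next
    case False
    have "norm \<xi> powr \<alpha> \<le> norm \<xi> powr real (2 * CARD('n))"
      using False assms by (intro powr_mono) auto
    also have "\<dots> = norm \<xi> ^ (2 * CARD('n))" using False by (subst powr_realpow) auto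
    also have "\<dots> = ((norm \<xi>)\<^sup>2) ^ CARD('n)" by (rule power_mult)
    also have "\<dots> \<le> (1 + (norm \<xi>)\<^sup>2) ^ CARD('n)" by (intro power_mono) auto
    finally show ?thesis .
  qed
  then have "norm \<xi> powr \<alpha> * weight \<xi> \<le> 1"
    using p by (simp add: weight_def power_inverse field_simps)
  then have "(2 * pi) powr \<alpha> * (norm \<xi> powr \<alpha> * weight \<xi>) \<le> (2 * pi) powr \<alpha> * 1"
    by (intro mult_left_mono) auto
  then show ?thesis by (simp add: powr_mult mult_ac)
qed

text \<open>Squaring the bound gives two factors \<open>weight\<close>: one absorbs the growth of
  the multiplier by \<open>powr_norm_weight\<close>, the other is integrable.\<close>

lemma weight_multiplier_L2:
  fixes u :: "real^'n \<Rightarrow> complex"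
  assumes \<alpha>: "0 < \<alpha>" "\<alpha> < real CARD('n)" and [measurable]: "u \<in> borel_measurable borel"
    and C: "\<And>\<xi>. cmod (u \<xi>) \<le> C * weight \<xi>"
  shows "(\<lambda>\<xi>. complex_of_real ((2 * pi * norm \<xi>) powr (\<alpha>/2)) * u \<xi>) \<in> L2"
proof -
  have "integrable lborel (\<lambda>\<xi>. (2 * pi * norm \<xi>) powr \<alpha> * (cmod (u \<xi>))\<^sup>2)"
  proof (rule Bochner_Integration.integrable_bound)
    show "integrable lborel (\<lambda>\<xi>::real^'n. (2 * pi) powr \<alpha> * C\<^sup>2 * weight \<xi>)"
      by (intro integrable_mult_right integrable_weight)
    show "AE \<xi> in lborel. norm ((2 * pi * norm \<xi>) powr \<alpha> * (cmod (u \<xi>))\<^sup>2) \<le> norm ((2 * pi) powr \<alpha> * C\<^sup>2 * weight \<xi>)"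
    proof (rule AE_I2)
      fix \<xi>
      have "(cmod (u \<xi>))\<^sup>2 \<le> (C * weight \<xi>)\<^sup>2" by (intro power_mono C) simp
      then have "(2 * pi * norm \<xi>) powr \<alpha> * (cmod (u \<xi>))\<^sup>2 \<le> (2 * pi * norm \<xi>) powr \<alpha> * (C * weight \<xi>)\<^sup>2"
        by (intro mult_left_mono) auto
      also have "\<dots> = ((2 * pi * norm \<xi>) powr \<alpha> * weight \<xi>) * (C\<^sup>2 * weight \<xi>)" by (simp add: power2_eq_square)
      also have "\<dots> \<le> (2 * pi) powr \<alpha> * (C\<^sup>2 * weight \<xi>)"
        by (intro mult_right_mono powr_norm_weight \<alpha>) auto
      finally show "norm ((2 * pi * norm \<xi>) powr \<alpha> * (cmod (u \<xi>))\<^sup>2) \<le> norm ((2 * pi) powr \<alpha> * C\<^sup>2 * weight \<xi>)"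
        by (simp add: abs_mult)
    qed
  qed measurable
  then show ?thesis by (simp add: L2_def norm_mult power_mult_distrib powr_half_square)
qed

lemma hs_L2:
  fixes \<psi> :: "real^'n \<Rightarrow> real"
  assumes "0 < \<alpha>" "\<alpha> < real CARD('n)" "test_fun \<psi>"
  shows "hs \<alpha> \<psi> \<in> L2"
proof -
  obtain C where "\<And>\<xi>. cmod (fourier \<psi> \<xi>) \<le> C * weight \<xi> ^ 1" using fourier_decay_weight[OF assms(3)] by blast
  moreover have "fourier \<psi> \<in> borel_measurable borel"
    using test_fun_measurable[OF assms(3)] by (rule fourier_measurable)
  ultimately show ?thesis unfolding hs_def[abs_def] using assms by (intro weight_multiplier_L2) auto
qed

lemma hs_diff: "test_fun \<psi> \<Longrightarrow> test_fun \<phi> \<Longrightarrow> hs \<alpha> (\<lambda>x. \<psi> x - \<phi> x) = (\<lambda>\<xi>. hs \<alpha> \<psi> \<xi> - hs \<alpha> \<phi> \<xi>)"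
  by (simp add: hs_def fun_eq_iff fourier_diff test_fun_integrable right_diff_distrib)

lemma hs_add: "test_fun \<psi> \<Longrightarrow> test_fun \<phi> \<Longrightarrow> hs \<alpha> (\<lambda>x. \<psi> x + \<phi> x) = (\<lambda>\<xi>. hs \<alpha> \<psi> \<xi> + hs \<alpha> \<phi> \<xi>)"
  by (simp add: hs_def fun_eq_iff fourier_add test_fun_integrable distrib_left)

lemma hs_cmult: "hs \<alpha> (\<lambda>x. c * \<psi> x) = (\<lambda>\<xi>. complex_of_real c * hs \<alpha> \<psi> \<xi>)"
  by (simp add: hs_def fun_eq_iff fourier_cmult)

lemma hs_uminus_arg: "hs \<alpha> \<psi> (- \<xi>) = cnj (hs \<alpha> \<psi> \<xi>)"
  by (simp add: hs_def fourier_uminus_arg)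

lemma hdot_norm2_ip: "hdot_norm2 \<alpha> \<psi> = ip (hs \<alpha> \<psi>) (hs \<alpha> \<psi>)"
  by (simp add: hdot_norm2_def ip_self hs_def norm_mult power_mult_distrib powr_half_square)

lemma hdot_inner_ip:
  fixes \<psi> :: "real^'n \<Rightarrow> real"
  assumes "0 < \<alpha>" "\<alpha> < real CARD('n)" "test_fun \<psi>" "test_fun \<phi>"
  shows "hdot_inner \<alpha> \<psi> \<phi> = ip (hs \<alpha> \<psi>) (hs \<alpha> \<phi>)"
proof -
  have "complex_of_real ((2 * pi * norm \<xi>) powr \<alpha>) * fourier \<psi> \<xi> * cnj (fourier \<phi> \<xi>) = hs \<alpha> \<psi> \<xi> * cnj (hs \<alpha> \<phi> \<xi>)" for \<xi>
    by (simp add: hs_def powr_half_square[of _ \<alpha>, symmetric] power2_eq_square del: powr_half_square)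
  then show ?thesis using assms by (simp add: hdot_inner_def ip_Re hs_L2)
qed

text \<open>Transforms of real functions are Hermitian, so the imaginary part of the Sobolev product is odd.\<close>

lemma hs_ip_imaginary:
  fixes \<psi> :: "real^'n \<Rightarrow> real"
  assumes "test_fun \<psi>" "test_fun \<phi>"
  shows "ip (hs \<alpha> \<psi>) (\<lambda>\<xi>. \<i> * hs \<alpha> \<phi> \<xi>) = 0"
proof -
  have [measurable]: "fourier \<psi> \<in> borel_measurable borel" "fourier \<phi> \<in> borel_measurable borel"
    using assms by (auto intro: fourier_measurable test_fun_measurable)
  let ?h = "\<lambda>\<xi>. hs \<alpha> \<psi> \<xi> \<bullet> (\<i> * hs \<alpha> \<phi> \<xi>)"
  have "?h (- \<xi>) = - ?h \<xi>" for \<xi> by (simp add: hs_uminus_arg inner_complex_def)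
  moreover have "(\<integral>\<xi>. ?h (- \<xi>) \<partial>lborel) = (\<integral>\<xi>. ?h \<xi> \<partial>lborel)"
    by (rule lborel_integral_uminus) (unfold hs_def, measurable)
  ultimately show ?thesis by (simp add: ip_def)
qed

text \<open>This makes the choice in \<open>fourier_d\<close> harmless: it agrees almost everywhere
  with any transform that has been computed explicitly.\<close>

lemma is_fourier_of_unique:
  assumes "is_fourier_of \<rho> g" "is_fourier_of \<rho> g'"
  shows "AE \<xi> in lborel. g \<xi> = g' \<xi>"
proof -
  have l: "loc_integrable_c g" "loc_integrable_c g'" using assms by (auto simp: is_fourier_of_def)
  then have "loc_integrable_c (\<lambda>\<xi>. g \<xi> - g' \<xi>)"
    by (auto simp: loc_integrable_c_def set_integrable_def scaleR_diff_right)
  moreover have "(\<integral>\<xi>. (g \<xi> - g' \<xi>) * complex_of_real (\<phi> \<xi>) \<partial>lborel) = 0" if "test_fun \<phi>" for \<phi>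
    using assms that loc_integrable_c_test_fun[OF l(1) that] loc_integrable_c_test_fun[OF l(2) that]
    by (simp add: is_fourier_of_def left_diff_distrib)
  ultimately have "AE \<xi> in lborel. g \<xi> - g' \<xi> = 0" by (rule fundamental_lemma_test_fun)
  then show ?thesis by simp
qed

lemma is_fourier_of_fourier_d: "is_fourier_of \<rho> g \<Longrightarrow> is_fourier_of \<rho> (fourier_d \<rho>)"
  unfolding fourier_d_def by (rule someI[of "is_fourier_of \<rho>"])

lemma fourier_d_eq: "is_fourier_of \<rho> g \<Longrightarrow> AE \<xi> in lborel. fourier_d \<rho> \<xi> = g \<xi>"
  by (rule is_fourier_of_unique[OF is_fourier_of_fourier_d])

lemma Hneg_fourier: "\<rho> \<in> Hneg \<alpha> \<Longrightarrow> is_fourier_of \<rho> (fourier_d \<rho>)"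
  by (auto simp: Hneg_def intro: is_fourier_of_fourier_d)

lemma Hneg_ht:
  assumes "\<rho> \<in> Hneg \<alpha>" shows "ht \<alpha> \<rho> \<in> L2"
proof -
  have [measurable]: "fourier_d \<rho> \<in> borel_measurable borel"
    using Hneg_fourier[OF assms] by (simp add: is_fourier_of_def loc_integrable_c_def)
  have "(\<lambda>\<xi>. complex_of_real ((2 * pi * norm \<xi>) powr (-\<alpha>/2)) * fourier_d \<rho> \<xi>) \<in> borel_measurable borel"
    by measurable
  moreover have "((2 * pi * norm \<xi>) powr (- \<alpha>/2))\<^sup>2 = (2 * pi * norm \<xi>) powr (- \<alpha>)" for \<xi> :: "real^'a"
    by (rule powr_half_square)
  ultimately show ?thesis using assms
    by (simp add: Hneg_def L2_def ht_def[abs_def] norm_mult power_mult_distrib)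
qed

text \<open>Membership can be checked on an explicit transform \<open>g\<close>; the identity for
  \<open>ht\<close> transports all later \<open>ip\<close> computations back to
  \<open>g\<close>.\<close>

lemma HnegI:
  fixes g :: "real^'n \<Rightarrow> complex"
  assumes g: "is_fourier_of \<rho> g"
    and i: "(\<lambda>\<xi>. complex_of_real ((2 * pi * norm \<xi>) powr (-\<alpha>/2)) * g \<xi>) \<in> L2"
  shows "\<rho> \<in> Hneg \<alpha>" "AE \<xi> in lborel. ht \<alpha> \<rho> \<xi> = complex_of_real ((2 * pi * norm \<xi>) powr (-\<alpha>/2)) * g \<xi>"
proof -
  have [measurable]: "fourier_d \<rho> \<in> borel_measurable borel" "g \<in> borel_measurable borel"
    using g is_fourier_of_fourier_d[OF g] by (auto simp: is_fourier_of_def loc_integrable_c_def)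
  show ae: "AE \<xi> in lborel. ht \<alpha> \<rho> \<xi> = complex_of_real ((2 * pi * norm \<xi>) powr (-\<alpha>/2)) * g \<xi>"
    using fourier_d_eq[OF g] by eventually_elim (simp add: ht_def)
  have "(\<lambda>\<xi>. complex_of_real ((2 * pi * norm \<xi>) powr (-\<alpha>/2)) * fourier_d \<rho> \<xi>) \<in> borel_measurable borel"
    by measurable
  then have "ht \<alpha> \<rho> \<in> L2" using L2_cong[OF i ae] by (simp add: ht_def[abs_def])
  moreover have "((2 * pi * norm \<xi>) powr (- \<alpha>/2))\<^sup>2 = (2 * pi * norm \<xi>) powr (- \<alpha>)" for \<xi> :: "real^'n"
    by (rule powr_half_square)
  ultimately show "\<rho> \<in> Hneg \<alpha>"
    using g by (auto simp: Hneg_def L2_def ht_def[abs_def] norm_mult power_mult_distrib)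
qed

lemma hneg_norm2_ip: "hneg_norm2 \<alpha> \<rho> = ip (ht \<alpha> \<rho>) (ht \<alpha> \<rho>)"
proof -
  have "((2 * pi * norm \<xi>) powr (- \<alpha>/2))\<^sup>2 = (2 * pi * norm \<xi>) powr (- \<alpha>)" for \<xi> :: "real^'a"
    by (rule powr_half_square)
  then show ?thesis by (simp add: hneg_norm2_def ip_self ht_def norm_mult power_mult_distrib)
qed

lemma hneg_inner_ip:
  assumes "\<rho> \<in> Hneg \<alpha>" "\<sigma> \<in> Hneg \<alpha>"
  shows "hneg_inner \<alpha> \<rho> \<sigma> = ip (ht \<alpha> \<rho>) (ht \<alpha> \<sigma>)"
proof -
  have "(2 * pi * norm \<xi>) powr (- \<alpha>) = (2 * pi * norm \<xi>) powr (- \<alpha>/2) * (2 * pi * norm \<xi>) powr (- \<alpha>/2)" for \<xi> :: "real^'a"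
    by (simp add: powr_add[symmetric])
  then have "complex_of_real ((2 * pi * norm \<xi>) powr (- \<alpha>)) * fourier_d \<rho> \<xi> * cnj (fourier_d \<sigma> \<xi>) = ht \<alpha> \<rho> \<xi> * cnj (ht \<alpha> \<sigma> \<xi>)" for \<xi>
    by (simp add: ht_def)
  then show ?thesis using assms by (simp add: hneg_inner_def ip_Re Hneg_ht)
qed

section \<open>Pairing densities with test functions\<close>

text \<open>Where |\<rho>| \<le> 1 the weight dominates the product; where |\<rho>| > 1 the power
  |\<rho>|^q does, as the weight is at most 1.\<close>

lemma Lp_weight_integrable:
  assumes "\<rho> \<in> Lp q" "q > 1"
  shows "integrable lborel (\<lambda>x. \<rho> x * weight (x::real^'n))"
proof (rule Bochner_Integration.integrable_bound)
  show "integrable lborel (\<lambda>x. \<bar>\<rho> x\<bar> powr q + weight x)"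
    using assms integrable_weight by (auto simp: Lp_def)
  show "AE x in lborel. norm (\<rho> x * weight x) \<le> norm (\<bar>\<rho> x\<bar> powr q + weight x)"
  proof (rule AE_I2)
    fix x
    have "\<bar>\<rho> x\<bar> * weight x \<le> \<bar>\<rho> x\<bar> powr q + weight x"
    proof (cases "\<bar>\<rho> x\<bar> \<le> 1")
      case True
      then have "\<bar>\<rho> x\<bar> * weight x \<le> 1 * weight x" by (intro mult_right_mono) auto
      then show ?thesis by (simp add: add_increasing)
    next
      case False
      have "\<bar>\<rho> x\<bar> * weight x \<le> \<bar>\<rho> x\<bar> * 1" using weight_le1 by (intro mult_left_mono) auto
      also have "\<dots> = \<bar>\<rho> x\<bar> powr 1" by simp
      also have "\<dots> \<le> \<bar>\<rho> x\<bar> powr q" using False assms by (intro powr_mono) auto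
      finally show ?thesis by (simp add: add_increasing2)
    qed
    then show "norm (\<rho> x * weight x) \<le> norm (\<bar>\<rho> x\<bar> powr q + weight x)" by (simp add: abs_mult)
  qed
qed (use assms in \<open>auto simp: Lp_def\<close>)

lemma Lp_bounded_weight_integrable:
  fixes u :: "real^'n \<Rightarrow> complex"
  assumes \<rho>: "\<rho> \<in> Lp q" "q > 1" and [measurable]: "u \<in> borel_measurable borel"
    and C: "\<And>x. cmod (u x) \<le> C * weight x"
  shows "integrable lborel (\<lambda>x. complex_of_real (\<rho> x) * u x)"
proof (rule Bochner_Integration.integrable_bound)
  have [measurable]: "\<rho> \<in> borel_measurable borel" using \<rho> by (simp add: Lp_def)
  show "integrable lborel (\<lambda>x. C * (\<rho> x * weight x))" using Lp_weight_integrable[OF \<rho>] by simp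
  show "AE x in lborel. norm (complex_of_real (\<rho> x) * u x) \<le> norm (C * (\<rho> x * weight x))"
  proof (rule AE_I2)
    fix x
    have "\<bar>\<rho> x\<bar> * cmod (u x) \<le> \<bar>\<rho> x\<bar> * \<bar>C * weight x\<bar>"
      by (intro mult_left_mono order_trans[OF C abs_ge_self]) simp
    then show "norm (complex_of_real (\<rho> x) * u x) \<le> norm (C * (\<rho> x * weight x))"
      by (simp add: norm_mult abs_mult mult_ac)
  qed
  show "(\<lambda>x. complex_of_real (\<rho> x) * u x) \<in> borel_measurable lborel" by measurable
qed

lemma Lp_fourier_integrable:
  fixes \<phi> :: "real^'n \<Rightarrow> real"
  assumes \<rho>: "\<rho> \<in> Lp q" "q > 1" and \<phi>: "test_fun \<phi>"
  shows "integrable lborel (\<lambda>x. complex_of_real (\<rho> x) * fourier \<phi> x)"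
proof -
  obtain C where "\<And>\<xi>. cmod (fourier \<phi> \<xi>) \<le> C * weight \<xi> ^ 1" using fourier_decay_weight[OF \<phi>] by blast
  then show ?thesis using \<phi> by (intro Lp_bounded_weight_integrable[OF \<rho>, of _ C])
    (auto intro: fourier_measurable test_fun_measurable)
qed

text \<open>The defining identity of \<open>fourier_d \<rho>\<close> is applied to the cut-off
  inverse transforms of \<psi> and passed to the limit on both sides. The majorant on the left is
  |\<rho>| times the weight; on the right it is a product of two functions in \<open>L2\<close>,
  once the multipliers of order \<alpha>/2 and - \<alpha>/2 have been inserted.\<close>

lemma pairing_fourier:
  fixes \<psi> :: "real^'n \<Rightarrow> real"
  assumes \<alpha>: "0 < \<alpha>" "\<alpha> < real CARD('n)" and q: "q > 1" and \<rho>: "\<rho> \<in> Lp q" "\<rho> \<in> Hneg \<alpha>" and \<psi>: "test_fun \<psi>"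
  shows "complex_of_real (\<integral>x. \<rho> x * \<psi> x \<partial>lborel) = (\<integral>\<xi>. ht \<alpha> \<rho> \<xi> * cnj (hs \<alpha> \<psi> \<xi>) \<partial>lborel)"
proof -
  obtain a b C where ab: "\<And>k::nat. test_fun (a k)" "\<And>k. test_fun (b k)" "C > 0"
    "\<And>x. (\<lambda>k. fourier (a k) x + \<i> * fourier (b k) x) \<longlonglongrightarrow> complex_of_real (\<psi> x)"
    "\<And>k x. cmod (fourier (a k) x + \<i> * fourier (b k) x) \<le> C * weight x"
    "\<And>\<xi>. (\<lambda>k. Complex (a k \<xi>) (b k \<xi>)) \<longlonglongrightarrow> cnj (fourier \<psi> \<xi>)"
    "\<And>k \<xi>. cmod (Complex (a k \<xi>) (b k \<xi>)) \<le> cmod (fourier \<psi> \<xi>)"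
    using test_fun_fourier_inverse[OF \<psi>] by blast
  let ?g = "fourier_d \<rho>"
  have g: "is_fourier_of \<rho> ?g" by (rule Hneg_fourier[OF \<rho>(2)])
  have gl: "loc_integrable_c ?g" using g by (simp add: is_fourier_of_def)
  have [measurable]: "?g \<in> borel_measurable borel" "\<rho> \<in> borel_measurable borel" "\<psi> \<in> borel_measurable borel"
    using gl \<rho> \<psi> by (auto simp: loc_integrable_c_def Lp_def intro: test_fun_measurable)
  have [measurable]: "a k \<in> borel_measurable borel" "b k \<in> borel_measurable borel" for k
    using ab(1,2) by (auto intro: test_fun_measurable)
  have [measurable]: "fourier (a k) \<in> borel_measurable borel" "fourier (b k) \<in> borel_measurable borel" "fourier \<psi> \<in> borel_measurable borel" for k
    by (auto intro!: fourier_measurable)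
  have E: "(\<integral>x. complex_of_real (\<rho> x) * (fourier (a k) x + \<i> * fourier (b k) x) \<partial>lborel)
      = (\<integral>\<xi>. ?g \<xi> * Complex (a k \<xi>) (b k \<xi>) \<partial>lborel)" for k
  proof -
    have "(\<integral>x. complex_of_real (\<rho> x) * (fourier (a k) x + \<i> * fourier (b k) x) \<partial>lborel)
        = (\<integral>x. complex_of_real (\<rho> x) * fourier (a k) x + \<i> * (complex_of_real (\<rho> x) * fourier (b k) x) \<partial>lborel)"
      by (simp add: algebra_simps)
    also have "\<dots> = (\<integral>x. complex_of_real (\<rho> x) * fourier (a k) x \<partial>lborel) + \<i> * (\<integral>x. complex_of_real (\<rho> x) * fourier (b k) x \<partial>lborel)"
      by (simp add: Lp_fourier_integrable[OF \<rho>(1) q] ab)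
    also have "\<dots> = (\<integral>\<xi>. ?g \<xi> * complex_of_real (a k \<xi>) \<partial>lborel) + \<i> * (\<integral>\<xi>. ?g \<xi> * complex_of_real (b k \<xi>) \<partial>lborel)"
      using g ab(1,2) by (simp add: is_fourier_of_def)
    also have "\<dots> = (\<integral>\<xi>. ?g \<xi> * complex_of_real (a k \<xi>) + \<i> * (?g \<xi> * complex_of_real (b k \<xi>)) \<partial>lborel)"
      by (simp add: loc_integrable_c_test_fun[OF gl] ab)
    also have "\<dots> = (\<integral>\<xi>. ?g \<xi> * Complex (a k \<xi>) (b k \<xi>) \<partial>lborel)"
      by (simp add: Complex_eq algebra_simps)
    finally show ?thesis .
  qed
  \<comment> \<open>The multipliers are inverse to each other only off the origin: at \<xi> = 0 both
    are 0, since \<open>0 powr\<close> any exponent is 0.\<close>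
  have pw: "AE \<xi> in lborel. ?g \<xi> * cnj (fourier \<psi> \<xi>) = ht \<alpha> \<rho> \<xi> * cnj (hs \<alpha> \<psi> \<xi>)"
  proof (rule eventually_mono[OF AE_lborel_nonzero])
    fix \<xi> :: "real^'n" assume "\<xi> \<noteq> 0"
    then have "(2 * pi * norm \<xi>) powr (- \<alpha>/2) * (2 * pi * norm \<xi>) powr (\<alpha>/2) = 1"
      by (simp add: powr_add[symmetric])
    then have "complex_of_real ((2 * pi * norm \<xi>) powr (- \<alpha>/2)) * complex_of_real ((2 * pi * norm \<xi>) powr (\<alpha>/2)) = 1"
      by (simp only: of_real_mult[symmetric] of_real_1)
    moreover have "ht \<alpha> \<rho> \<xi> * cnj (hs \<alpha> \<psi> \<xi>) = (complex_of_real ((2 * pi * norm \<xi>) powr (- \<alpha>/2)) * complex_of_real ((2 * pi * norm \<xi>) powr (\<alpha>/2)))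
        * (?g \<xi> * cnj (fourier \<psi> \<xi>))"
      by (simp add: ht_def hs_def mult_ac)
    ultimately show "?g \<xi> * cnj (fourier \<psi> \<xi>) = ht \<alpha> \<rho> \<xi> * cnj (hs \<alpha> \<psi> \<xi>)" by simp
  qed
  have m: "ht \<alpha> \<rho> \<in> L2" "hs \<alpha> \<psi> \<in> L2" by (rule Hneg_ht[OF \<rho>(2)], rule hs_L2[OF \<alpha> \<psi>])
  note m(1)[measurable] m(2)[measurable]
  have gi: "integrable lborel (\<lambda>\<xi>. ?g \<xi> * cnj (fourier \<psi> \<xi>))"
    using L2_mult_integrable[OF m] by (subst integrable_cong_AE[OF _ _ pw]) measurable
  have "(\<lambda>k. \<integral>x. complex_of_real (\<rho> x) * (fourier (a k) x + \<i> * fourier (b k) x) \<partial>lborel) \<longlonglongrightarrow> (\<integral>x. complex_of_real (\<rho> x) * complex_of_real (\<psi> x) \<partial>lborel)"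
  proof (rule integral_dominated_convergence[where w="\<lambda>x. norm (C * (\<rho> x * weight x))"])
    show "integrable lborel (\<lambda>x. norm (C * (\<rho> x * weight x)))"
      by (intro integrable_norm integrable_mult_right Lp_weight_integrable[OF \<rho>(1) q])
    show "AE x in lborel. (\<lambda>k. complex_of_real (\<rho> x) * (fourier (a k) x + \<i> * fourier (b k) x)) \<longlonglongrightarrow> complex_of_real (\<rho> x) * complex_of_real (\<psi> x)"
      by (intro AE_I2 tendsto_mult tendsto_const ab)
    show "AE x in lborel. norm (complex_of_real (\<rho> x) * (fourier (a k) x + \<i> * fourier (b k) x)) \<le> norm (C * (\<rho> x * weight x))" for k
    proof (rule AE_I2)
      fix x
      have "\<bar>\<rho> x\<bar> * cmod (fourier (a k) x + \<i> * fourier (b k) x) \<le> \<bar>\<rho> x\<bar> * (C * weight x)"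
        by (intro mult_left_mono ab) simp
      then show "norm (complex_of_real (\<rho> x) * (fourier (a k) x + \<i> * fourier (b k) x)) \<le> norm (C * (\<rho> x * weight x))"
        unfolding norm_mult using ab(3) by (simp add: abs_mult mult_ac)
    qed
  qed measurable
  moreover have "(\<lambda>k. \<integral>\<xi>. ?g \<xi> * Complex (a k \<xi>) (b k \<xi>) \<partial>lborel) \<longlonglongrightarrow> (\<integral>\<xi>. ?g \<xi> * cnj (fourier \<psi> \<xi>) \<partial>lborel)"
  proof (rule integral_dominated_convergence[where w="\<lambda>\<xi>. norm (?g \<xi> * cnj (fourier \<psi> \<xi>))"])
    show "AE \<xi> in lborel. (\<lambda>k. ?g \<xi> * Complex (a k \<xi>) (b k \<xi>)) \<longlonglongrightarrow> ?g \<xi> * cnj (fourier \<psi> \<xi>)"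
      by (intro AE_I2 tendsto_mult tendsto_const ab)
    show "AE \<xi> in lborel. norm (?g \<xi> * Complex (a k \<xi>) (b k \<xi>)) \<le> norm (?g \<xi> * cnj (fourier \<psi> \<xi>))" for k
      unfolding norm_mult complex_mod_cnj by (intro AE_I2 mult_left_mono ab) simp
    show "(\<lambda>\<xi>. ?g \<xi> * Complex (a k \<xi>) (b k \<xi>)) \<in> borel_measurable lborel" for k
      unfolding Complex_eq by measurable
  qed (use gi in \<open>auto intro: integrable_norm\<close>)
  ultimately have "(\<integral>x. complex_of_real (\<rho> x) * complex_of_real (\<psi> x) \<partial>lborel) = (\<integral>\<xi>. ?g \<xi> * cnj (fourier \<psi> \<xi>) \<partial>lborel)"
    unfolding E by (rule LIMSEQ_unique)
  also have "\<dots> = (\<integral>\<xi>. ht \<alpha> \<rho> \<xi> * cnj (hs \<alpha> \<psi> \<xi>) \<partial>lborel)"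
    by (intro integral_cong_AE pw) measurable
  finally show ?thesis by (simp add: of_real_mult[symmetric] del: of_real_mult)
qed

text \<open>For integrable densities the duality formula \<open>cft_duality\<close> is exactly the
  defining identity.\<close>

lemma is_fourier_of_integrable:
  fixes f :: "real^'n \<Rightarrow> real"
  assumes f: "integrable lborel f"
  shows "is_fourier_of f (fourier f)"
  unfolding is_fourier_of_def
proof (intro conjI allI impI)
  have [measurable]: "f \<in> borel_measurable borel" using f by auto
  have fm [measurable]: "fourier f \<in> borel_measurable borel" by (rule fourier_measurable) measurable
  have u: "integrable lborel (\<lambda>x. complex_of_real (f x))" using f by simp
  show "loc_integrable_c (fourier f)"
    unfolding loc_integrable_c_def set_integrable_def
  proof (intro conjI allI impI)
    show "fourier f \<in> borel_measurable lborel" using fm by simp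
    fix K :: "(real^'n) set" assume K: "compact K"
    have [measurable]: "K \<in> sets borel" using K by (simp add: borel_compact)
    show "integrable lborel (\<lambda>x. indicat_real K x *\<^sub>R fourier f x)"
    proof (rule Bochner_Integration.integrable_bound)
      show "integrable lborel (\<lambda>x. (\<integral>x. cmod (complex_of_real (f x)) \<partial>lborel) * indicat_real K x)"
        using emeasure_compact_finite[OF K] by (intro integrable_mult_right integrable_real_indicator) auto
      show "AE x in lborel. norm (indicat_real K x *\<^sub>R fourier f x) \<le> norm ((\<integral>x. cmod (complex_of_real (f x)) \<partial>lborel) * indicat_real K x)"
      proof (rule AE_I2)
        fix x
        have "cmod (fourier f x) \<le> \<bar>\<integral>x. cmod (complex_of_real (f x)) \<partial>lborel\<bar>"
          unfolding fourier_cft by (rule order_trans[OF cft_bound abs_ge_self])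
        then show "norm (indicat_real K x *\<^sub>R fourier f x) \<le> norm ((\<integral>x. cmod (complex_of_real (f x)) \<partial>lborel) * indicat_real K x)"
          by (simp add: indicator_def)
      qed
    qed measurable
  qed
  fix \<phi> :: "real^'n \<Rightarrow> real" assume "test_fun \<phi>"
  then have "integrable lborel (\<lambda>x. complex_of_real (\<phi> x))" by (simp add: test_fun_integrable)
  from cft_duality[OF u this]
  show "(\<integral>x. complex_of_real (f x) * fourier \<phi> x \<partial>lborel) = (\<integral>\<xi>. fourier f \<xi> * complex_of_real (\<phi> \<xi>) \<partial>lborel)"
    by (simp add: fourier_cft)
qed

section \<open>Densities below the weight, and the embedding by duality\<close>

text \<open>In the unit ball the transform is bounded by the integral \<open>W\<close> of the weight
  and |\<xi>|^(-\<alpha>) has finite integral \<open>I\<close>, as \<alpha> < d. Outside,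
  |\<xi>|^(-\<alpha>) \<le> 1 and \<open>Bessel_fourier\<close> bounds the rest by \<open>W\<close>.
  The bound does not depend on \<open>f\<close>, which the duality argument relies on.\<close>

lemma Hneg_weight_dominated:
  fixes \<alpha> :: real
  assumes \<alpha>: "0 < \<alpha>" "\<alpha> < real CARD('n)"
  obtains K where "K \<ge> 0" "\<And>f :: real^'n \<Rightarrow> real. f \<in> borel_measurable borel \<Longrightarrow> (\<And>x. \<bar>f x\<bar> \<le> weight x) \<Longrightarrow>
     f \<in> Hneg \<alpha> \<and> ip (ht \<alpha> f) (ht \<alpha> f) \<le> K"
proof -
  define W where "W = (\<integral>x. weight (x::real^'n) \<partial>lborel)"
  define I where "I = (\<integral>x. indicator (cball 0 1) (x::real^'n) * norm x powr (- \<alpha>) \<partial>lborel)"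
  have ball: "integrable lborel (\<lambda>x::real^'n. indicator (cball 0 1) x * norm x powr (- \<alpha>))"
    using \<alpha> by (intro integrable_norm_powr_unit_ball) auto
  have W0: "0 \<le> W" and I0: "0 \<le> I" unfolding W_def I_def by (auto intro!: integral_nonneg_AE)
  have main: "f \<in> Hneg \<alpha> \<and> ip (ht \<alpha> f) (ht \<alpha> f) \<le> (2 * pi) powr (- \<alpha>) * (W\<^sup>2 * I + W)"
    if [measurable]: "f \<in> borel_measurable borel" and b: "\<And>x. \<bar>f x\<bar> \<le> weight x" for f :: "real^'n \<Rightarrow> real"
  proof -
    have f: "integrable lborel f"
      by (rule Bochner_Integration.integrable_bound[OF integrable_weight]) (use b in auto)
    have fb2: "(f x)\<^sup>2 \<le> weight x" for x
    proof -
      have "\<bar>f x\<bar>\<^sup>2 \<le> (weight x)\<^sup>2" by (intro power_mono b) simp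
      also have "\<dots> = weight x * weight x" by (simp add: power2_eq_square)
      also have "\<dots> \<le> 1 * weight x" by (intro mult_right_mono weight_le1) simp
      finally show ?thesis by simp
    qed
    have f2: "integrable lborel (\<lambda>x. (f x)\<^sup>2)"
      by (rule Bochner_Integration.integrable_bound[OF integrable_weight]) (use fb2 in auto)
    have fm[measurable]: "fourier f \<in> borel_measurable borel" by (rule fourier_measurable) measurable
    have c: "cmod (fourier f \<xi>) \<le> W" for \<xi>
    proof -
      have "cmod (fourier f \<xi>) \<le> (\<integral>x. \<bar>f x\<bar> \<partial>lborel)"
        using cft_bound[of "\<lambda>x. complex_of_real (f x)" \<xi>] by (simp add: fourier_cft)
      also have "\<dots> \<le> W" unfolding W_def using f b by (intro integral_mono integrable_weight) auto
      finally show ?thesis .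
    qed
    let ?m = "\<lambda>\<xi>::real^'n. (2 * pi * norm \<xi>) powr (-\<alpha>) * (cmod (fourier f \<xi>))\<^sup>2"
    let ?M = "\<lambda>\<xi>::real^'n. (2 * pi) powr (-\<alpha>) * (W\<^sup>2 * (indicator (cball 0 1) \<xi> * norm \<xi> powr (-\<alpha>)) + (cmod (fourier f \<xi>))\<^sup>2)"
    have le: "?m \<xi> \<le> ?M \<xi>" for \<xi>
    proof -
      have "norm \<xi> powr (-\<alpha>) * (cmod (fourier f \<xi>))\<^sup>2 \<le> W\<^sup>2 * (indicator (cball 0 1) \<xi> * norm \<xi> powr (-\<alpha>)) + (cmod (fourier f \<xi>))\<^sup>2"
      proof (cases "norm \<xi> \<le> 1")
        case True
        have "(cmod (fourier f \<xi>))\<^sup>2 \<le> W\<^sup>2" by (intro power_mono c) simp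
        then have "norm \<xi> powr (-\<alpha>) * (cmod (fourier f \<xi>))\<^sup>2 \<le> norm \<xi> powr (-\<alpha>) * W\<^sup>2" by (rule mult_left_mono) simp
        then show ?thesis using True by (simp add: add_increasing2 mult.commute)
      next
        case False
        then have "norm \<xi> \<ge> 1" "\<xi> \<noteq> 0" by auto
        then have "norm \<xi> powr (-\<alpha>) \<le> 1" using powr_mono[of "-\<alpha>" 0 "norm \<xi>"] \<alpha> by simp
        then have "norm \<xi> powr (-\<alpha>) * (cmod (fourier f \<xi>))\<^sup>2 \<le> 1 * (cmod (fourier f \<xi>))\<^sup>2"
          by (intro mult_right_mono) auto
        then show ?thesis using False by simp
      qed
      then have "(2 * pi) powr (-\<alpha>) * (norm \<xi> powr (-\<alpha>) * (cmod (fourier f \<xi>))\<^sup>2) \<le> ?M \<xi>"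
        by (rule mult_left_mono) simp
      then show ?thesis by (simp add: powr_mult mult.assoc)
    qed
    have iM: "integrable lborel ?M"
      by (intro integrable_mult_right Bochner_Integration.integrable_add ball Bessel_fourier f f2)
    have im: "integrable lborel ?m"
    proof (rule Bochner_Integration.integrable_bound[OF iM])
      show "AE \<xi> in lborel. norm (?m \<xi>) \<le> norm (?M \<xi>)"
        using le by (intro AE_I2) (auto intro: order_trans[OF _ abs_ge_self])
    qed measurable
    let ?h = "\<lambda>\<xi>::real^'n. complex_of_real ((2 * pi * norm \<xi>) powr (-\<alpha>/2)) * fourier f \<xi>"
    have sq: "(cmod (?h \<xi>))\<^sup>2 = ?m \<xi>" for \<xi>
    proof -
      have "((2 * pi * norm \<xi>) powr (- \<alpha>/2))\<^sup>2 = (2 * pi * norm \<xi>) powr (- \<alpha>)" by (rule powr_half_square)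
      then show ?thesis by (simp add: norm_mult power_mult_distrib)
    qed
    have hL: "?h \<in> L2" unfolding L2_def mem_Collect_eq
    proof
      show "?h \<in> borel_measurable borel" by measurable
      show "integrable lborel (\<lambda>\<xi>. (cmod (?h \<xi>))\<^sup>2)" unfolding sq by (rule im)
    qed
    note H = HnegI[OF is_fourier_of_integrable[OF f] hL]
    have "ip (ht \<alpha> f) (ht \<alpha> f) = ip ?h ?h"
      by (intro ip_cong H(2)) (use hL Hneg_ht[OF H(1)] in \<open>auto simp: L2_def\<close>)
    also have "\<dots> = (\<integral>\<xi>. ?m \<xi> \<partial>lborel)" by (simp only: ip_self sq)
    also have "\<dots> \<le> (\<integral>\<xi>. ?M \<xi> \<partial>lborel)" by (rule integral_mono[OF im iM le])
    also have "\<dots> = (2 * pi) powr (-\<alpha>) * (W\<^sup>2 * I + (\<integral>\<xi>. (cmod (fourier f \<xi>))\<^sup>2 \<partial>lborel))"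
      using ball Bessel_fourier(1)[OF f f2] by (simp add: I_def)
    also have "\<dots> \<le> (2 * pi) powr (-\<alpha>) * (W\<^sup>2 * I + W)"
    proof (intro mult_left_mono add_left_mono)
      have "(\<integral>\<xi>. (cmod (fourier f \<xi>))\<^sup>2 \<partial>lborel) \<le> (\<integral>x. (f x)\<^sup>2 \<partial>lborel)" by (rule Bessel_fourier(2)[OF f f2])
      also have "\<dots> \<le> W" unfolding W_def by (intro integral_mono f2 integrable_weight fb2)
      finally show "(\<integral>\<xi>. (cmod (fourier f \<xi>))\<^sup>2 \<partial>lborel) \<le> W" .
    qed simp
    finally show ?thesis using H(1) by simp
  qed
  show thesis
    by (rule that[of "(2 * pi) powr (- \<alpha>) * (W\<^sup>2 * I + W)"]) (use W0 I0 main in auto)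
qed

text \<open>The transform is chosen separately for each density, so linearity of \<open>ht\<close>
  can hold only almost everywhere. The combination of the two given transforms is one transform of
  the combination, and uniqueness does the rest.\<close>

lemma H_alpha_lincomb:
  fixes \<rho> \<sigma> :: "real^'n \<Rightarrow> real"
  assumes q: "q > 1" and \<rho>: "\<rho> \<in> H_alpha q \<alpha>" and \<sigma>: "\<sigma> \<in> H_alpha q \<alpha>"
  shows "(\<lambda>x. a * \<rho> x + b * \<sigma> x) \<in> H_alpha q \<alpha>"
    and "AE \<xi> in lborel. ht \<alpha> (\<lambda>x. a * \<rho> x + b * \<sigma> x) \<xi> = complex_of_real a * ht \<alpha> \<rho> \<xi> + complex_of_real b * ht \<alpha> \<sigma> \<xi>"
proof -
  have L: "\<rho> \<in> Lp q" "\<sigma> \<in> Lp q" and N: "\<rho> \<in> Hneg \<alpha>" "\<sigma> \<in> Hneg \<alpha>" using \<rho> \<sigma> by (auto simp: H_alpha_def)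
  have [measurable]: "\<rho> \<in> borel_measurable borel" "\<sigma> \<in> borel_measurable borel" using L by (auto simp: Lp_def)
  let ?s = "\<lambda>x. a * \<rho> x + b * \<sigma> x"
  have "integrable lborel (\<lambda>x. norm (a * \<rho> x + b * \<sigma> x) powr q)"
    using L q by (intro integrable_powr_add) (auto simp: Lp_def abs_mult powr_mult)
  then have sL: "?s \<in> Lp q" by (simp add: Lp_def)
  let ?g = "\<lambda>\<xi>. complex_of_real a * fourier_d \<rho> \<xi> + complex_of_real b * fourier_d \<sigma> \<xi>"
  have F: "is_fourier_of \<rho> (fourier_d \<rho>)" "is_fourier_of \<sigma> (fourier_d \<sigma>)" using N Hneg_fourier by auto
  then have l: "loc_integrable_c (fourier_d \<rho>)" "loc_integrable_c (fourier_d \<sigma>)" by (auto simp: is_fourier_of_def)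
  have g: "is_fourier_of ?s ?g"
    unfolding is_fourier_of_def
  proof (intro conjI allI impI)
    show "loc_integrable_c ?g"
      unfolding loc_integrable_c_def set_integrable_def
    proof (intro conjI allI impI)
      have [measurable]: "fourier_d \<rho> \<in> borel_measurable borel" "fourier_d \<sigma> \<in> borel_measurable borel"
        using l by (auto simp: loc_integrable_c_def)
      show "?g \<in> borel_measurable lborel" by measurable
      fix K :: "(real^'n) set" assume K: "compact K"
      have "integrable lborel (\<lambda>x. complex_of_real a * (indicat_real K x *\<^sub>R fourier_d \<rho> x) + complex_of_real b * (indicat_real K x *\<^sub>R fourier_d \<sigma> x))"
        using l K unfolding loc_integrable_c_def set_integrable_def
        by (intro Bochner_Integration.integrable_add integrable_mult_right) auto
      then show "integrable lborel (\<lambda>x. indicat_real K x *\<^sub>R ?g x)"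
        by (simp add: scaleR_add_right)
    qed
    fix \<phi> :: "real^'n \<Rightarrow> real" assume \<phi>: "test_fun \<phi>"
    have "(\<integral>x. complex_of_real (?s x) * fourier \<phi> x \<partial>lborel)
      = (\<integral>x. complex_of_real a * (complex_of_real (\<rho> x) * fourier \<phi> x) + complex_of_real b * (complex_of_real (\<sigma> x) * fourier \<phi> x) \<partial>lborel)"
      by (simp add: algebra_simps)
    also have "\<dots> = complex_of_real a * (\<integral>x. complex_of_real (\<rho> x) * fourier \<phi> x \<partial>lborel) + complex_of_real b * (\<integral>x. complex_of_real (\<sigma> x) * fourier \<phi> x \<partial>lborel)"
      by (simp add: Lp_fourier_integrable[OF L(1) q \<phi>] Lp_fourier_integrable[OF L(2) q \<phi>])
    also have "\<dots> = complex_of_real a * (\<integral>\<xi>. fourier_d \<rho> \<xi> * complex_of_real (\<phi> \<xi>) \<partial>lborel) + complex_of_real b * (\<integral>\<xi>. fourier_d \<sigma> \<xi> * complex_of_real (\<phi> \<xi>) \<partial>lborel)"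
      using F \<phi> by (simp add: is_fourier_of_def)
    also have "\<dots> = (\<integral>\<xi>. complex_of_real a * (fourier_d \<rho> \<xi> * complex_of_real (\<phi> \<xi>)) + complex_of_real b * (fourier_d \<sigma> \<xi> * complex_of_real (\<phi> \<xi>)) \<partial>lborel)"
      by (simp add: loc_integrable_c_test_fun[OF l(1) \<phi>] loc_integrable_c_test_fun[OF l(2) \<phi>])
    also have "\<dots> = (\<integral>\<xi>. ?g \<xi> * complex_of_real (\<phi> \<xi>) \<partial>lborel)" by (simp add: algebra_simps)
    finally show "(\<integral>x. complex_of_real (?s x) * fourier \<phi> x \<partial>lborel) = (\<integral>\<xi>. ?g \<xi> * complex_of_real (\<phi> \<xi>) \<partial>lborel)" .
  qed
  have e: "(\<lambda>\<xi>. complex_of_real ((2 * pi * norm \<xi>) powr (-\<alpha>/2)) * ?g \<xi>)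
     = (\<lambda>\<xi>. complex_of_real a * ht \<alpha> \<rho> \<xi> + complex_of_real b * ht \<alpha> \<sigma> \<xi>)"
    by (simp add: ht_def fun_eq_iff algebra_simps)
  have i: "(\<lambda>\<xi>. complex_of_real ((2 * pi * norm \<xi>) powr (-\<alpha>/2)) * ?g \<xi>) \<in> L2"
    unfolding e by (intro L2_add L2_cmult Hneg_ht N)
  show "?s \<in> H_alpha q \<alpha>" using sL HnegI(1)[OF g i] by (simp add: H_alpha_def)
  show "AE \<xi> in lborel. ht \<alpha> ?s \<xi> = complex_of_real a * ht \<alpha> \<rho> \<xi> + complex_of_real b * ht \<alpha> \<sigma> \<xi>"
    using HnegI(2)[OF g i] by (rule eventually_mono) (simp add: ht_def algebra_simps)
qed

lemma H_alpha_weight_dominated: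
  fixes f :: "real^'n \<Rightarrow> real"
  assumes \<alpha>: "0 < \<alpha>" "\<alpha> < real CARD('n)" and q: "q > 1" and [measurable]: "f \<in> borel_measurable borel"
    and b: "\<And>x. \<bar>f x\<bar> \<le> weight x"
  shows "f \<in> H_alpha q \<alpha>"
proof -
  have "integrable lborel (\<lambda>x. \<bar>f x\<bar> powr q)"
  proof (rule Bochner_Integration.integrable_bound[OF integrable_weight])
    show "AE x in lborel. norm (\<bar>f x\<bar> powr q) \<le> norm (weight x)"
    proof (rule AE_I2)
      fix x
      have "\<bar>f x\<bar> \<le> 1" using b[of x] weight_le1[of x] by linarith
      then have "\<bar>f x\<bar> powr q \<le> \<bar>f x\<bar>" using powr_mono'[of 1 q "\<bar>f x\<bar>"] q by simp
      then show "norm (\<bar>f x\<bar> powr q) \<le> norm (weight x)" using b[of x] by simp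
    qed
  qed measurable
  then have "f \<in> Lp q" using assms(4) by (simp add: Lp_def)
  moreover have "f \<in> Hneg \<alpha>"
  proof -
    obtain K where "\<And>f :: real^'n \<Rightarrow> real. f \<in> borel_measurable borel \<Longrightarrow> (\<And>x. \<bar>f x\<bar> \<le> weight x) \<Longrightarrow>
      f \<in> Hneg \<alpha> \<and> ip (ht \<alpha> f) (ht \<alpha> f) \<le> K"
      using Hneg_weight_dominated[OF \<alpha>] by blast
    from this[OF assms(4) b] show ?thesis by blast
  qed
  ultimately show ?thesis by (simp add: H_alpha_def)
qed

lemma weight_lower_bound:
  obtains c where "c > 0" "\<And>x::'a::euclidean_space. norm x \<le> R \<Longrightarrow> c \<le> weight x"
proof (rule that[of "inverse (1 + R\<^sup>2) ^ DIM('a)"])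
  show "inverse (1 + R\<^sup>2) ^ DIM('a) > 0" by (simp add: add_pos_nonneg)
  fix x :: 'a assume "norm x \<le> R"
  then have "(norm x)\<^sup>2 \<le> R\<^sup>2" by (intro power_mono) auto
  then show "inverse (1 + R\<^sup>2) ^ DIM('a) \<le> weight x"
    unfolding weight_def by (intro power_mono le_imp_inverse_le) (auto simp: add_pos_nonneg)
qed

text \<open>On the support the weight has a positive lower bound, so a small multiple of
  \<open>f\<close> lies below the weight; scaling back stays in the space.\<close>

lemma bounded_support_H_alpha:
  fixes f :: "real^'n \<Rightarrow> real"
  assumes \<alpha>: "0 < \<alpha>" "\<alpha> < real CARD('n)" and q: "q > 1" and [measurable]: "f \<in> borel_measurable borel"
    and B: "\<And>x. \<bar>f x\<bar> \<le> B" and R: "\<And>x. norm x > R \<Longrightarrow> f x = 0"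
  shows "f \<in> H_alpha q \<alpha>"
proof -
  obtain c where c: "c > 0" "\<And>x::real^'n. norm x \<le> R \<Longrightarrow> c \<le> weight x" using weight_lower_bound by blast
  define k where "k = c / (\<bar>B\<bar> + 1)"
  have k: "k > 0" using c by (simp add: k_def)
  have "\<bar>k * f x\<bar> \<le> weight x" for x
  proof (cases "norm x \<le> R")
    case True
    have "\<bar>k * f x\<bar> \<le> k * (\<bar>B\<bar> + 1)" using B[of x] k by (auto simp: abs_mult intro!: mult_left_mono)
    also have "\<dots> = c" by (simp add: k_def)
    finally show ?thesis using c(2)[OF True] by simp
  qed (use R in auto)
  then have "(\<lambda>x. k * f x) \<in> H_alpha q \<alpha>" by (intro H_alpha_weight_dominated \<alpha> q) auto
  from H_alpha_lincomb(1)[OF q this this, of "1/k" 0] k show ?thesis by simp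
qed

text \<open>The complex product in \<open>pairing_fourier\<close> equals a real number: its real
  part gives the first claim, its vanishing imaginary part the second.\<close>

lemma pairing_H_alpha:
  fixes \<psi> :: "real^'n \<Rightarrow> real"
  assumes \<alpha>: "0 < \<alpha>" "\<alpha> < real CARD('n)" and q: "q > 1" and \<rho>: "\<rho> \<in> H_alpha q \<alpha>" and \<psi>: "test_fun \<psi>"
  shows "(\<integral>x. \<rho> x * \<psi> x \<partial>lborel) = ip (ht \<alpha> \<rho>) (hs \<alpha> \<psi>)" "ip (ht \<alpha> \<rho>) (\<lambda>\<xi>. \<i> * hs \<alpha> \<psi> \<xi>) = 0"
proof -
  have L: "\<rho> \<in> Lp q" and N: "\<rho> \<in> Hneg \<alpha>" using \<rho> by (auto simp: H_alpha_def)
  have m: "ht \<alpha> \<rho> \<in> L2" "hs \<alpha> \<psi> \<in> L2" by (rule Hneg_ht[OF N], rule hs_L2[OF \<alpha> \<psi>])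
  note P = pairing_fourier[OF \<alpha> q L N \<psi>, symmetric]
  show "(\<integral>x. \<rho> x * \<psi> x \<partial>lborel) = ip (ht \<alpha> \<rho>) (hs \<alpha> \<psi>)"
    unfolding ip_Re[OF m] P by simp
  show "ip (ht \<alpha> \<rho>) (\<lambda>\<xi>. \<i> * hs \<alpha> \<psi> \<xi>) = 0"
    unfolding ip_Im[OF m] P by simp
qed

text \<open>By duality: pair \<open>\<psi>\<close> with \<open>sgn \<psi>\<close> times the weight.\<close>

lemma Sobolev_weight:
  fixes \<alpha> :: real
  assumes \<alpha>: "0 < \<alpha>" "\<alpha> < real CARD('n)"
  obtains C where "C \<ge> 0" "\<And>\<psi> :: real^'n \<Rightarrow> real. test_fun \<psi> \<Longrightarrow> (\<integral>x. weight x * \<bar>\<psi> x\<bar> \<partial>lborel) \<le> C * sqrt (ip (hs \<alpha> \<psi>) (hs \<alpha> \<psi>))"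
proof -
  obtain K where K: "K \<ge> 0" "\<And>f :: real^'n \<Rightarrow> real. f \<in> borel_measurable borel \<Longrightarrow> (\<And>x. \<bar>f x\<bar> \<le> weight x) \<Longrightarrow>
     f \<in> Hneg \<alpha> \<and> ip (ht \<alpha> f) (ht \<alpha> f) \<le> K" using Hneg_weight_dominated[OF \<alpha>] by blast
  show thesis
  proof (rule that[of "sqrt K"])
    fix \<psi> :: "real^'n \<Rightarrow> real" assume \<psi>: "test_fun \<psi>"
    have [measurable]: "\<psi> \<in> borel_measurable borel" using \<psi> by (rule test_fun_measurable)
    define f where "f = (\<lambda>x. sgn (\<psi> x) * weight x)"
    have fm: "f \<in> borel_measurable borel" unfolding f_def by measurable
    have fb: "\<bar>f x\<bar> \<le> weight x" for x by (simp add: f_def abs_mult sgn_if)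
    \<comment> \<open>The pairing lemma asks for some exponent above 1; here 2 is chosen.\<close>
    have fH: "f \<in> H_alpha 2 \<alpha>" by (intro H_alpha_weight_dominated \<alpha> fm fb) simp
    have Kf: "f \<in> Hneg \<alpha>" "ip (ht \<alpha> f) (ht \<alpha> f) \<le> K" using K(2)[OF fm fb] by auto
    have "(\<integral>x. weight x * \<bar>\<psi> x\<bar> \<partial>lborel) = (\<integral>x. f x * \<psi> x \<partial>lborel)"
      by (intro Bochner_Integration.integral_cong refl) (simp add: f_def sgn_if)
    also have "\<dots> = ip (ht \<alpha> f) (hs \<alpha> \<psi>)" by (rule pairing_H_alpha[OF \<alpha> _ fH \<psi>]) simp
    also have "\<dots> \<le> sqrt (ip (ht \<alpha> f) (ht \<alpha> f)) * sqrt (ip (hs \<alpha> \<psi>) (hs \<alpha> \<psi>))"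
      using ip_Cauchy_Schwarz[OF Hneg_ht[OF Kf(1)] hs_L2[OF \<alpha> \<psi>]] by linarith
    also have "\<dots> \<le> sqrt K * sqrt (ip (hs \<alpha> \<psi>) (hs \<alpha> \<psi>))"
      by (intro mult_right_mono real_sqrt_le_mono Kf) simp
    finally show "(\<integral>x. weight x * \<bar>\<psi> x\<bar> \<partial>lborel) \<le> sqrt K * sqrt (ip (hs \<alpha> \<psi>) (hs \<alpha> \<psi>))" .
  qed (use K in simp)
qed

text \<open>By \<open>Sobolev_weight\<close> the sequence is also Cauchy in L^1 with the weight as
  density. Dividing the limit of the weighted functions by the weight gives \<open>U\<close>, and
  the lower bound of the weight on compact sets turns weighted convergence into L^1_loc
  convergence.\<close>

lemma hdot_approx_exists:
  fixes \<psi> :: "nat \<Rightarrow> real^'n \<Rightarrow> real"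
  assumes \<alpha>: "0 < \<alpha>" "\<alpha> < real CARD('n)" and \<psi>: "\<And>k. test_fun (\<psi> k)"
    and C: "\<And>e. e > 0 \<Longrightarrow> \<exists>N. \<forall>m\<ge>N. \<forall>n\<ge>N. ip (\<lambda>x. hs \<alpha> (\<psi> m) x - hs \<alpha> (\<psi> n) x) (\<lambda>x. hs \<alpha> (\<psi> m) x - hs \<alpha> (\<psi> n) x) < e"
  shows "\<exists>U. hdot_approx \<alpha> \<psi> U"
proof -
  obtain S where S: "S \<ge> 0" "\<And>\<psi> :: real^'n \<Rightarrow> real. test_fun \<psi> \<Longrightarrow> (\<integral>x. weight x * \<bar>\<psi> x\<bar> \<partial>lborel) \<le> S * sqrt (ip (hs \<alpha> \<psi>) (hs \<alpha> \<psi>))"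
    using Sobolev_weight[OF \<alpha>] by blast
  define f where "f = (\<lambda>k x. weight x * \<psi> k x)"
  have [measurable]: "\<psi> k \<in> borel_measurable borel" for k using \<psi> by (rule test_fun_measurable)
  have fm: "f k \<in> borel_measurable lborel" for k unfolding f_def by measurable
  have fi: "integrable lborel (f k)" for k
    by (rule Bochner_Integration.integrable_bound[OF test_fun_integrable[OF \<psi>[of k]]])
      (use weight_le1 fm in \<open>auto simp: f_def abs_mult intro!: AE_I2 mult_left_le_one_le\<close>)
  have "\<exists>N. \<forall>m\<ge>N. \<forall>n\<ge>N. (\<integral>x. norm (f m x - f n x) powr 1 \<partial>lborel) < e" if e: "e > 0" for e
  proof -
    \<comment> \<open>\<open>S + 1\<close> keeps the quotient defined when \<open>S = 0\<close> and
      makes the final estimate strict.\<close>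
    obtain N where N: "\<forall>m\<ge>N. \<forall>n\<ge>N. ip (\<lambda>x. hs \<alpha> (\<psi> m) x - hs \<alpha> (\<psi> n) x) (\<lambda>x. hs \<alpha> (\<psi> m) x - hs \<alpha> (\<psi> n) x) < (e / (S + 1))\<^sup>2"
      using C[of "(e / (S + 1))\<^sup>2"] e S(1) by auto
    have "(\<integral>x. norm (f m x - f n x) powr 1 \<partial>lborel) < e" if "m \<ge> N" "n \<ge> N" for m n
    proof -
      have t: "test_fun (\<lambda>x. \<psi> m x - \<psi> n x)" using \<psi> by (intro test_fun_diff)
      have "(\<integral>x. norm (f m x - f n x) powr 1 \<partial>lborel) = (\<integral>x. weight x * \<bar>\<psi> m x - \<psi> n x\<bar> \<partial>lborel)"
        by (simp add: f_def right_diff_distrib[symmetric] abs_mult)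
      also have "\<dots> \<le> S * sqrt (ip (hs \<alpha> (\<lambda>x. \<psi> m x - \<psi> n x)) (hs \<alpha> (\<lambda>x. \<psi> m x - \<psi> n x)))" by (rule S(2)[OF t])
      also have "\<dots> \<le> S * (e / (S + 1))"
      proof (rule mult_left_mono[OF _ S(1)])
        have "sqrt (ip (hs \<alpha> (\<lambda>x. \<psi> m x - \<psi> n x)) (hs \<alpha> (\<lambda>x. \<psi> m x - \<psi> n x))) \<le> sqrt ((e / (S + 1))\<^sup>2)"
          unfolding hs_diff[OF \<psi> \<psi>] using N that by (intro real_sqrt_le_mono less_imp_le) blast
        then show "sqrt (ip (hs \<alpha> (\<lambda>x. \<psi> m x - \<psi> n x)) (hs \<alpha> (\<lambda>x. \<psi> m x - \<psi> n x))) \<le> e / (S + 1)"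
          using e S(1) by simp
      qed
      also have "\<dots> < e" using e S(1) by (simp add: field_simps)
      finally show ?thesis .
    qed
    then show ?thesis by blast
  qed
  from Lp_complete[of 1 f lborel, OF _ fm _ this] fi
  obtain g where gm[measurable]: "g \<in> borel_measurable lborel" and gi: "integrable lborel (\<lambda>x. norm (g x) powr 1)"
    and glim: "(\<lambda>n. \<integral>x. norm (f n x - g x) powr 1 \<partial>lborel) \<longlonglongrightarrow> 0" by (auto intro: integrable_norm)
  define U where "U = (\<lambda>x. g x / weight x)"
  have Um[measurable]: "U \<in> borel_measurable borel" using gm unfolding U_def by measurable
  have gU: "g x = weight x * U x" for x using weight_pos[of x] by (simp add: U_def)
  have ig: "integrable lborel (\<lambda>x. weight x * \<bar>U x\<bar>)" using gi by (simp add: gU abs_mult)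
  have "hdot_approx \<alpha> \<psi> U"
    unfolding hdot_approx_def
  proof (intro conjI allI impI \<psi>)
    fix e :: real assume "e > 0"
    from C[OF this] show "\<exists>N. \<forall>m\<ge>N. \<forall>n\<ge>N. hdot_norm2 \<alpha> (\<lambda>x. \<psi> m x - \<psi> n x) < e"
      by (simp add: hdot_norm2_ip hs_diff \<psi>)
  next
    show "loc_integrable U" unfolding loc_integrable_def
    proof (intro conjI allI impI)
      fix K :: "(real^'n) set" assume K: "compact K"
      have [measurable]: "K \<in> sets borel" using K by (simp add: borel_compact)
      obtain R where R: "\<And>x. x \<in> K \<Longrightarrow> norm x \<le> R" using compact_imp_bounded[OF K] by (auto simp: bounded_iff)
      obtain c where c: "c > 0" "\<And>x::real^'n. norm x \<le> R \<Longrightarrow> c \<le> weight x" using weight_lower_bound by blast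
      show "set_integrable lborel K U" unfolding set_integrable_def
      proof (rule Bochner_Integration.integrable_bound)
        show "integrable lborel (\<lambda>x. 1 / c * (weight x * \<bar>U x\<bar>))" by (intro integrable_mult_right ig)
        show "AE x in lborel. norm (indicat_real K x *\<^sub>R U x) \<le> norm (1 / c * (weight x * \<bar>U x\<bar>))"
        proof (rule AE_I2)
          fix x show "norm (indicat_real K x *\<^sub>R U x) \<le> norm (1 / c * (weight x * \<bar>U x\<bar>))"
          proof (cases "x \<in> K")
            case True
            then have "c * \<bar>U x\<bar> \<le> weight x * \<bar>U x\<bar>" using c(2) R by (intro mult_right_mono) auto
            then show ?thesis using True c(1) by (simp add: abs_mult field_simps)
          qed simp
        qed
      qed measurable
    qed (use Um in simp)
  next
    fix K :: "(real^'n) set" assume K: "compact K"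
    have [measurable]: "K \<in> sets borel" using K by (simp add: borel_compact)
    obtain R where R: "\<And>x. x \<in> K \<Longrightarrow> norm x \<le> R" using compact_imp_bounded[OF K] by (auto simp: bounded_iff)
    obtain c where c: "c > 0" "\<And>x::real^'n. norm x \<le> R \<Longrightarrow> c \<le> weight x" using weight_lower_bound by blast
    show "(\<lambda>k. \<integral>x. indicator K x * \<bar>\<psi> k x - U x\<bar> \<partial>lborel) \<longlonglongrightarrow> 0"
    proof (rule Lim_null_comparison)
      have "(\<integral>x. indicator K x * \<bar>\<psi> k x - U x\<bar> \<partial>lborel) \<le> 1 / c * (\<integral>x. norm (f k x - g x) powr 1 \<partial>lborel)" for k
      proof -
        have i: "integrable lborel (\<lambda>x. 1 / c * \<bar>f k x - g x\<bar>)"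
          using gi fi[of k] gm by (intro integrable_mult_right integrable_abs Bochner_Integration.integrable_diff) (auto simp: integrable_abs_iff)
        have b: "indicator K x * \<bar>\<psi> k x - U x\<bar> \<le> 1 / c * \<bar>f k x - g x\<bar>" for x
        proof (cases "x \<in> K")
          case True
          then have "c * \<bar>\<psi> k x - U x\<bar> \<le> weight x * \<bar>\<psi> k x - U x\<bar>" using c(2) R by (intro mult_right_mono) auto
          also have "\<dots> = \<bar>f k x - g x\<bar>" by (simp add: f_def gU right_diff_distrib[symmetric] abs_mult)
          finally show ?thesis using True c(1) by (simp add: field_simps)
        qed (use c in simp)
        have "(\<integral>x. indicator K x * \<bar>\<psi> k x - U x\<bar> \<partial>lborel) \<le> (\<integral>x. 1 / c * \<bar>f k x - g x\<bar> \<partial>lborel)"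
        proof (rule integral_mono[OF _ i b])
          show "integrable lborel (\<lambda>x. indicator K x * \<bar>\<psi> k x - U x\<bar>)"
            by (rule Bochner_Integration.integrable_bound[OF i])
              (use b c(1) in \<open>auto intro!: AE_I2\<close>)
        qed
        then show ?thesis by simp
      qed
      moreover have "0 \<le> (\<integral>x. indicator K x * \<bar>\<psi> k x - U x\<bar> \<partial>lborel)" for k
        by (intro integral_nonneg_AE) auto
      ultimately show "\<forall>\<^sub>F k in sequentially. norm (\<integral>x. indicator K x * \<bar>\<psi> k x - U x\<bar> \<partial>lborel) \<le> 1 / c * (\<integral>x. norm (f k x - g x) powr 1 \<partial>lborel)"
        by (intro always_eventually) simp
      show "(\<lambda>k. 1 / c * (\<integral>x. norm (f k x - g x) powr 1 \<partial>lborel)) \<longlonglongrightarrow> 0"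
        using tendsto_mult[OF tendsto_const glim, of "1/c"] by simp
    qed
  qed
  then show ?thesis by blast
qed

text \<open>\<open>G\<close> takes the place of |2 pi \<xi>|^(\<alpha>/2) times the transform of
  \<open>U\<close>, for which the function \<open>U\<close>, given only in L^1_loc, has no integral
  formula.\<close>

lemma hdot_approx_limit:
  fixes \<psi> :: "nat \<Rightarrow> real^'n \<Rightarrow> real"
  assumes \<alpha>: "0 < \<alpha>" "\<alpha> < real CARD('n)" and U: "hdot_approx \<alpha> \<psi> U"
  obtains G where "G \<in> L2" "(\<lambda>k. ip (\<lambda>x. hs \<alpha> (\<psi> k) x - G x) (\<lambda>x. hs \<alpha> (\<psi> k) x - G x)) \<longlonglongrightarrow> 0"
proof -
  have \<psi>: "test_fun (\<psi> k)" for k using U by (simp add: hdot_approx_def)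
  show ?thesis
  proof (rule L2_complete[of "\<lambda>k. hs \<alpha> (\<psi> k)"])
    show "hs \<alpha> (\<psi> k) \<in> L2" for k by (rule hs_L2[OF \<alpha> \<psi>])
    show "\<exists>N. \<forall>m\<ge>N. \<forall>n\<ge>N. ip (\<lambda>x. hs \<alpha> (\<psi> m) x - hs \<alpha> (\<psi> n) x) (\<lambda>x. hs \<alpha> (\<psi> m) x - hs \<alpha> (\<psi> n) x) < e" if "e > 0" for e
      using U that by (simp add: hdot_approx_def hdot_norm2_ip hs_diff \<psi>)
  qed (use that in blast)
qed

text \<open>Two limits of the same sequence: \<open>G\<close> governs pairings with the whole energy
  space, \<open>U\<close> governs integrals against bounded densities of compact support. For the
  latter both limits exist, so they coincide.\<close>

lemma hdot_approx_pairing: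
  fixes f :: "real^'n \<Rightarrow> real"
  assumes \<alpha>: "0 < \<alpha>" "\<alpha> < real CARD('n)" and q: "q > 1" and U: "hdot_approx \<alpha> \<psi> U"
    and G: "G \<in> L2" "(\<lambda>k. ip (\<lambda>x. hs \<alpha> (\<psi> k) x - G x) (\<lambda>x. hs \<alpha> (\<psi> k) x - G x)) \<longlonglongrightarrow> 0"
  shows "\<rho> \<in> H_alpha q \<alpha> \<Longrightarrow> (\<lambda>k. \<integral>x. \<rho> x * \<psi> k x \<partial>lborel) \<longlonglongrightarrow> ip (ht \<alpha> \<rho>) G"
    and "f \<in> borel_measurable borel \<Longrightarrow> (\<And>x. \<bar>f x\<bar> \<le> B) \<Longrightarrow> (\<And>x. norm x > R \<Longrightarrow> f x = 0) \<Longrightarrow>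
      ip (ht \<alpha> f) G = (\<integral>x. f x * U x \<partial>lborel)"
proof -
  have \<psi>: "test_fun (\<psi> k)" for k using U by (simp add: hdot_approx_def)
  have lim: "(\<lambda>k. \<integral>x. \<rho> x * \<psi> k x \<partial>lborel) \<longlonglongrightarrow> ip (ht \<alpha> \<rho>) G" if \<rho>: "\<rho> \<in> H_alpha q \<alpha>" for \<rho>
  proof -
    have "ht \<alpha> \<rho> \<in> L2" using \<rho> by (auto simp: H_alpha_def intro: Hneg_ht)
    from ip_tendsto[OF hs_L2[OF \<alpha> \<psi>] G(1) this G(2)] show ?thesis
      by (simp add: pairing_H_alpha(1)[OF \<alpha> q \<rho> \<psi>] ip_commute)
  qed
  then show "\<rho> \<in> H_alpha q \<alpha> \<Longrightarrow> (\<lambda>k. \<integral>x. \<rho> x * \<psi> k x \<partial>lborel) \<longlonglongrightarrow> ip (ht \<alpha> \<rho>) G" .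
  assume fm[measurable]: "f \<in> borel_measurable borel" and B: "\<And>x. \<bar>f x\<bar> \<le> B" and R: "\<And>x. norm x > R \<Longrightarrow> f x = 0"
  have f: "f \<in> H_alpha q \<alpha>" by (rule bounded_support_H_alpha[OF \<alpha> q fm B R])
  let ?K = "cball 0 R :: (real^'n) set"
  have [measurable]: "U \<in> borel_measurable borel" using U by (simp add: hdot_approx_def loc_integrable_def)
  have [measurable]: "\<psi> k \<in> borel_measurable borel" for k using \<psi> by (rule test_fun_measurable)
  have UK: "integrable lborel (\<lambda>x. indicator ?K x * U x)"
    using U compact_cball[of 0 R] by (auto simp: hdot_approx_def loc_integrable_def set_integrable_def)
  have B0: "B \<ge> 0" using B[of 0] abs_ge_zero order_trans by blast
  have bd: "\<bar>f x\<bar> \<le> B * indicator ?K x" for x using B[of x] R[of x] by (cases "norm x \<le> R") auto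
  have bm: "\<bar>f x * t\<bar> \<le> \<bar>B * (indicator ?K x * t)\<bar>" for x t
    using mult_right_mono[OF bd[of x], of "\<bar>t\<bar>"] B0 by (simp add: abs_mult mult_ac)
  have fU: "integrable lborel (\<lambda>x. f x * U x)"
    by (rule Bochner_Integration.integrable_bound[OF integrable_mult_right[OF UK, of B]]) (use bm in \<open>auto intro!: AE_I2\<close>)
  have Kp: "integrable lborel (\<lambda>x. indicator ?K x * \<psi> k x)" for k
    by (rule Bochner_Integration.integrable_bound[OF test_fun_integrable[OF \<psi>[of k]]]) (auto simp: indicator_def)
  have fp: "integrable lborel (\<lambda>x. f x * \<psi> k x)" for k
    by (rule Bochner_Integration.integrable_bound[OF integrable_mult_right[OF Kp, of B]]) (use bm in \<open>auto intro!: AE_I2\<close>)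
  have "(\<lambda>k. (\<integral>x. f x * \<psi> k x \<partial>lborel) - (\<integral>x. f x * U x \<partial>lborel)) \<longlonglongrightarrow> 0"
  proof (rule Lim_null_comparison)
    have "\<bar>(\<integral>x. f x * \<psi> k x \<partial>lborel) - (\<integral>x. f x * U x \<partial>lborel)\<bar> \<le> B * (\<integral>x. indicator ?K x * \<bar>\<psi> k x - U x\<bar> \<partial>lborel)" for k
    proof -
      have iK: "integrable lborel (\<lambda>x. indicator ?K x * \<bar>\<psi> k x - U x\<bar>)"
      proof -
        have "integrable lborel (\<lambda>x. \<bar>indicator ?K x * \<psi> k x - indicator ?K x * U x\<bar>)"
          by (intro integrable_abs Bochner_Integration.integrable_diff Kp UK)
        then show ?thesis by (simp add: right_diff_distrib[symmetric] abs_mult)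
      qed
      have "\<bar>(\<integral>x. f x * \<psi> k x \<partial>lborel) - (\<integral>x. f x * U x \<partial>lborel)\<bar> = \<bar>\<integral>x. f x * (\<psi> k x - U x) \<partial>lborel\<bar>"
        by (simp add: right_diff_distrib fp fU)
      also have "\<dots> \<le> (\<integral>x. \<bar>f x * (\<psi> k x - U x)\<bar> \<partial>lborel)"
        using integral_norm_bound[of lborel "\<lambda>x. f x * (\<psi> k x - U x)"] by simp
      also have "\<dots> \<le> (\<integral>x. B * (indicator ?K x * \<bar>\<psi> k x - U x\<bar>) \<partial>lborel)"
      proof (rule integral_mono)
        show "integrable lborel (\<lambda>x. \<bar>f x * (\<psi> k x - U x)\<bar>)"
          using Bochner_Integration.integrable_diff[OF fp fU] by (intro integrable_abs) (simp add: right_diff_distrib)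
        show "integrable lborel (\<lambda>x. B * (indicator ?K x * \<bar>\<psi> k x - U x\<bar>))" by (intro integrable_mult_right iK)
        show "\<bar>f x * (\<psi> k x - U x)\<bar> \<le> B * (indicator ?K x * \<bar>\<psi> k x - U x\<bar>)" for x
          using mult_right_mono[OF bd[of x], of "\<bar>\<psi> k x - U x\<bar>"] by (simp add: abs_mult mult_ac)
      qed
      finally show ?thesis by simp
    qed
    then show "\<forall>\<^sub>F k in sequentially. norm ((\<integral>x. f x * \<psi> k x \<partial>lborel) - (\<integral>x. f x * U x \<partial>lborel)) \<le> B * (\<integral>x. indicator ?K x * \<bar>\<psi> k x - U x\<bar> \<partial>lborel)"
      by (intro always_eventually) simp
    have "(\<lambda>k. \<integral>x. indicator ?K x * \<bar>\<psi> k x - U x\<bar> \<partial>lborel) \<longlonglongrightarrow> 0"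
      using U compact_cball[of 0 R] by (simp add: hdot_approx_def)
    from tendsto_mult[OF tendsto_const this, of B]
    show "(\<lambda>k. B * (\<integral>x. indicator ?K x * \<bar>\<psi> k x - U x\<bar> \<partial>lborel)) \<longlonglongrightarrow> 0" by simp
  qed
  then have "(\<lambda>k. \<integral>x. f x * \<psi> k x \<partial>lborel) \<longlonglongrightarrow> (\<integral>x. f x * U x \<partial>lborel)" by (rule LIM_zero_cancel)
  from LIMSEQ_unique[OF lim[OF f] this] show "ip (ht \<alpha> f) G = (\<integral>x. f x * U x \<partial>lborel)" .
qed

subsection \<open>Riesz potentials\<close>

text \<open>Project \<open>ht \<alpha> \<rho>\<close> onto the closure of the transforms
  \<open>hs \<alpha> \<psi>\<close>. The residual is orthogonal to every
  \<open>hs \<alpha> \<phi>\<close>, which is the defining identity once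
  \<open>pairing_H_alpha\<close> is applied; a sequence minimizing the distance is the approximating
  sequence.\<close>

lemma riesz_pot_exists:
  fixes \<rho> :: "real^'n \<Rightarrow> real"
  assumes \<alpha>: "0 < \<alpha>" "\<alpha> < real CARD('n)" and q: "q > 1" and \<rho>: "\<rho> \<in> H_alpha q \<alpha>"
  shows "\<exists>U. riesz_pot \<alpha> \<rho> U"
proof -
  define v where "v = ht \<alpha> \<rho>"
  have v: "v \<in> L2" using \<rho> by (auto simp: H_alpha_def v_def intro: Hneg_ht)
  define u where "u = (\<lambda>\<psi> \<xi>. hs \<alpha> \<psi> \<xi> - v \<xi>)"
  define D where "D = (\<lambda>\<psi>. ip (u \<psi>) (u \<psi>))"
  have u: "u \<psi> \<in> L2" if "test_fun \<psi>" for \<psi> unfolding u_def by (intro L2_diff hs_L2 \<alpha> that v)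
  define d where "d = Inf (D ` Collect test_fun)"
  have dlow: "d \<le> D \<psi>" if "test_fun \<psi>" for \<psi>
    unfolding d_def using that by (intro cInf_lower bdd_belowI[of _ 0]) (auto simp: D_def)
  have "\<exists>\<psi>. test_fun \<psi> \<and> D \<psi> < d + inverse (real (Suc k))" for k
  proof (rule ccontr)
    assume h: "\<not> ?thesis"
    have "d + inverse (real (Suc k)) \<le> d" unfolding d_def
      by (rule cInf_greatest) (use h test_fun_zero in \<open>auto simp: d_def not_less\<close>)
    then show False by (simp add: not_le)
  qed
  then obtain \<psi> where \<psi>: "\<And>k. test_fun (\<psi> k)" and D\<psi>: "\<And>k. D (\<psi> k) < d + inverse (real (Suc k))" by metis
  \<comment> \<open>Parallelogram law: half the sum of two residuals is the residual of the averaged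
    test function, so its square is at least \<open>d\<close>.\<close>
  have par: "ip (\<lambda>x. hs \<alpha> (\<psi> m) x - hs \<alpha> (\<psi> n) x) (\<lambda>x. hs \<alpha> (\<psi> m) x - hs \<alpha> (\<psi> n) x)
      \<le> 2 * inverse (real (Suc m)) + 2 * inverse (real (Suc n))" for m n
  proof -
    let ?s = "\<lambda>x. u (\<psi> m) x + u (\<psi> n) x"
    define \<phi> where "\<phi> = (\<lambda>x. (1/2) * \<psi> m x + (1/2) * \<psi> n x)"
    have t: "test_fun \<phi>" unfolding \<phi>_def using \<psi> by (intro test_fun_add test_fun_cmult)
    have "u \<phi> = (\<lambda>\<xi>. complex_of_real (1/2) * ?s \<xi>)"
      unfolding u_def \<phi>_def hs_add[OF test_fun_cmult[OF \<psi>] test_fun_cmult[OF \<psi>]] hs_cmult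
      by (simp add: fun_eq_iff field_simps)
    then have "D \<phi> = (1/2) * ((1/2) * ip ?s ?s)" unfolding D_def by (simp only: ip_cmult_left ip_cmult_right)
    then have "4 * d \<le> ip ?s ?s" using dlow[OF t] by simp
    moreover have "(\<lambda>x. hs \<alpha> (\<psi> m) x - hs \<alpha> (\<psi> n) x) = (\<lambda>x. u (\<psi> m) x - u (\<psi> n) x)" by (simp add: u_def)
    ultimately show ?thesis
      using ip_parallelogram[OF u[OF \<psi>[of m]] u[OF \<psi>[of n]]] D\<psi>[of m] D\<psi>[of n] by (simp add: D_def)
  qed
  have C: "\<exists>N. \<forall>m\<ge>N. \<forall>n\<ge>N. ip (\<lambda>x. hs \<alpha> (\<psi> m) x - hs \<alpha> (\<psi> n) x) (\<lambda>x. hs \<alpha> (\<psi> m) x - hs \<alpha> (\<psi> n) x) < e" if "e > 0" for e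
  proof -
    obtain N where N: "inverse (real (Suc N)) < e / 4" using reals_Archimedean[of "e/4"] \<open>e > 0\<close> by (metis zero_less_divide_iff zero_less_numeral)
    have "ip (\<lambda>x. hs \<alpha> (\<psi> m) x - hs \<alpha> (\<psi> n) x) (\<lambda>x. hs \<alpha> (\<psi> m) x - hs \<alpha> (\<psi> n) x) < e" if "m \<ge> N" "n \<ge> N" for m n
    proof -
      have "inverse (real (Suc m)) \<le> inverse (real (Suc N))" "inverse (real (Suc n)) \<le> inverse (real (Suc N))"
        using that by (auto intro!: le_imp_inverse_le)
      then show ?thesis using par[of m n] N by linarith
    qed
    then show ?thesis by blast
  qed
  obtain U where U: "hdot_approx \<alpha> \<psi> U" using hdot_approx_exists[OF \<alpha> \<psi> C] by blast
  obtain G where G: "G \<in> L2" "(\<lambda>k. ip (\<lambda>x. hs \<alpha> (\<psi> k) x - G x) (\<lambda>x. hs \<alpha> (\<psi> k) x - G x)) \<longlonglongrightarrow> 0"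
    using hdot_approx_limit[OF \<alpha> U] by blast
  let ?w = "\<lambda>\<xi>. G \<xi> - v \<xi>"
  have w: "?w \<in> L2" by (rule L2_diff[OF G(1) v])
  have ulim: "(\<lambda>k. ip (\<lambda>x. u (\<psi> k) x - ?w x) (\<lambda>x. u (\<psi> k) x - ?w x)) \<longlonglongrightarrow> 0"
    using G(2) by (simp add: u_def)
  have Dlim: "(\<lambda>k. D (\<psi> k)) \<longlonglongrightarrow> ip ?w ?w"
    unfolding D_def by (rule ip_self_tendsto[OF u[OF \<psi>] w ulim])
  have wd: "ip ?w ?w \<le> d"
  proof (rule LIMSEQ_le[OF Dlim])
    show "(\<lambda>k. d + inverse (real (Suc k))) \<longlonglongrightarrow> d" by (rule LIMSEQ_inverse_real_of_nat_add)
    show "\<exists>N. \<forall>n\<ge>N. D (\<psi> n) \<le> d + inverse (real (Suc n))" using D\<psi> less_imp_le by blast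
  qed
  \<comment> \<open>Moving each minimizing test function by t \<phi> cannot go below
    \<open>d\<close>; in the limit a quadratic polynomial in t without constant term stays
    nonnegative.\<close>
  have orth: "ip ?w (hs \<alpha> \<phi>) = 0" if \<phi>: "test_fun \<phi>" for \<phi>
  proof (rule quadratic_nonneg_linear_zero)
    fix t :: real
    have h: "hs \<alpha> \<phi> \<in> L2" by (rule hs_L2[OF \<alpha> \<phi>])
    have "d \<le> D (\<psi> k) + 2 * t * ip (u (\<psi> k)) (hs \<alpha> \<phi>) + t\<^sup>2 * ip (hs \<alpha> \<phi>) (hs \<alpha> \<phi>)" for k
    proof -
      have "test_fun (\<lambda>x. \<psi> k x + t * \<phi> x)" by (intro test_fun_add test_fun_cmult \<psi> \<phi>)
      from dlow[OF this] have "d \<le> ip (u (\<lambda>x. \<psi> k x + t * \<phi> x)) (u (\<lambda>x. \<psi> k x + t * \<phi> x))" by (simp add: D_def)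
      also have "u (\<lambda>x. \<psi> k x + t * \<phi> x) = (\<lambda>\<xi>. u (\<psi> k) \<xi> + complex_of_real t * hs \<alpha> \<phi> \<xi>)"
        unfolding u_def by (subst hs_add[OF \<psi> test_fun_cmult[OF \<phi>]]) (simp add: hs_cmult fun_eq_iff)
      finally show ?thesis by (simp only: ip_expand[OF u[OF \<psi>] h] D_def)
    qed
    moreover have "(\<lambda>k. D (\<psi> k) + 2 * t * ip (u (\<psi> k)) (hs \<alpha> \<phi>) + t\<^sup>2 * ip (hs \<alpha> \<phi>) (hs \<alpha> \<phi>))
        \<longlonglongrightarrow> ip ?w ?w + 2 * t * ip ?w (hs \<alpha> \<phi>) + t\<^sup>2 * ip (hs \<alpha> \<phi>) (hs \<alpha> \<phi>)"
      by (intro tendsto_intros Dlim ip_tendsto[OF u[OF \<psi>] w h ulim])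
    ultimately have "d \<le> ip ?w ?w + 2 * t * ip ?w (hs \<alpha> \<phi>) + t\<^sup>2 * ip (hs \<alpha> \<phi>) (hs \<alpha> \<phi>)"
      by (intro LIMSEQ_le_const) auto
    then show "0 \<le> 2 * t * ip ?w (hs \<alpha> \<phi>) + t\<^sup>2 * ip (hs \<alpha> \<phi>) (hs \<alpha> \<phi>)" using wd by linarith
  qed
  have "(\<lambda>k. hdot_inner \<alpha> (\<psi> k) \<phi>) \<longlonglongrightarrow> (\<integral>x. \<rho> x * \<phi> x \<partial>lborel)" if \<phi>: "test_fun \<phi>" for \<phi>
  proof -
    have h: "hs \<alpha> \<phi> \<in> L2" by (rule hs_L2[OF \<alpha> \<phi>])
    have "(\<lambda>k. ip (hs \<alpha> (\<psi> k)) (hs \<alpha> \<phi>)) \<longlonglongrightarrow> ip G (hs \<alpha> \<phi>)"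
      by (rule ip_tendsto[OF hs_L2[OF \<alpha> \<psi>] G(1) h G(2)])
    also have "ip G (hs \<alpha> \<phi>) = ip v (hs \<alpha> \<phi>)" using orth[OF \<phi>] ip_diff_left[OF G(1) v h] by simp
    also have "\<dots> = (\<integral>x. \<rho> x * \<phi> x \<partial>lborel)" unfolding v_def by (rule pairing_H_alpha(1)[OF \<alpha> q \<rho> \<phi>, symmetric])
    finally show ?thesis by (simp add: hdot_inner_ip[OF \<alpha> \<psi> \<phi>])
  qed
  then show ?thesis using U unfolding riesz_pot_def by blast
qed

text \<open>The multiplier times the weight lies in \<open>L2\<close>, so its product with
  \<open>F\<close> is integrable; on a compact set the weight can be divided out.\<close>

lemma L2_multiplier_loc_integrable:
  fixes F :: "real^'n \<Rightarrow> complex"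
  assumes \<alpha>: "0 < \<alpha>" "\<alpha> < real CARD('n)" and F: "F \<in> L2"
  shows "loc_integrable_c (\<lambda>\<xi>. F \<xi> * complex_of_real ((2 * pi * norm \<xi>) powr (\<alpha>/2)))"
proof -
  have [measurable]: "F \<in> borel_measurable borel" using F by (simp add: L2_def)
  let ?m = "\<lambda>\<xi>::real^'n. complex_of_real ((2 * pi * norm \<xi>) powr (\<alpha>/2))"
  have M: "(\<lambda>\<xi>. ?m \<xi> * complex_of_real (weight \<xi>)) \<in> L2"
    by (rule weight_multiplier_L2[OF \<alpha>, where C=1]) auto
  have FM: "integrable lborel (\<lambda>\<xi>. cmod (F \<xi>) * cmod (?m \<xi> * complex_of_real (weight \<xi>)))"
    by (rule L2_norm_mult_integrable[OF F M])
  show ?thesis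
      unfolding loc_integrable_c_def set_integrable_def
    proof (intro conjI allI impI)
      show "(\<lambda>\<xi>. F \<xi> * ?m \<xi>) \<in> borel_measurable lborel" by measurable
      fix K :: "(real^'n) set" assume K: "compact K"
      have [measurable]: "K \<in> sets borel" using K by (simp add: borel_compact)
      obtain R where R: "\<And>x. x \<in> K \<Longrightarrow> norm x \<le> R" using compact_imp_bounded[OF K] by (auto simp: bounded_iff)
      obtain c where c: "c > 0" "\<And>x::real^'n. norm x \<le> R \<Longrightarrow> c \<le> weight x" using weight_lower_bound by blast
      show "integrable lborel (\<lambda>\<xi>. indicat_real K \<xi> *\<^sub>R (F \<xi> * ?m \<xi>))"
      proof (rule Bochner_Integration.integrable_bound[OF integrable_mult_right[OF FM, of "1/c"]])
        show "AE \<xi> in lborel. norm (indicat_real K \<xi> *\<^sub>R (F \<xi> * ?m \<xi>)) \<le> norm (1 / c * (cmod (F \<xi>) * cmod (?m \<xi> * complex_of_real (weight \<xi>))))"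
        proof (rule AE_I2)
          fix \<xi> :: "real^'n"
          show "norm (indicat_real K \<xi> *\<^sub>R (F \<xi> * ?m \<xi>)) \<le> norm (1 / c * (cmod (F \<xi>) * cmod (?m \<xi> * complex_of_real (weight \<xi>))))"
          proof (cases "\<xi> \<in> K")
            case True
            then have "c \<le> weight \<xi>" using c(2) R by blast
            then have "c * (cmod (F \<xi>) * cmod (?m \<xi>)) \<le> weight \<xi> * (cmod (F \<xi>) * cmod (?m \<xi>))"
              by (rule mult_right_mono) simp
            then have "cmod (F \<xi>) * cmod (?m \<xi>) \<le> (1 / c) * (weight \<xi> * (cmod (F \<xi>) * cmod (?m \<xi>)))"
              using c(1) by (simp add: field_simps)
            then show ?thesis using True c(1) by (simp add: norm_mult abs_mult mult_ac)
          qed simp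
        qed
      qed measurable
    qed
qed

text \<open>Inserting the cut-off inverse transforms and passing to the limit shows that
  \<open>F\<close> times the multiplier integrates to zero against every test function; the
  multiplier vanishes only at the origin. Orthogonality to \<open>\<i> * hs \<alpha> \<phi>\<close>
  is assumed as well because \<open>ip\<close> sees only real parts.\<close>

lemma hs_total:
  fixes F :: "real^'n \<Rightarrow> complex"
  assumes \<alpha>: "0 < \<alpha>" "\<alpha> < real CARD('n)" and F: "F \<in> L2"
    and Z: "\<And>\<phi>. test_fun \<phi> \<Longrightarrow> ip F (hs \<alpha> \<phi>) = 0" "\<And>\<phi>. test_fun \<phi> \<Longrightarrow> ip F (\<lambda>\<xi>. \<i> * hs \<alpha> \<phi> \<xi>) = 0"
  shows "AE \<xi> in lborel. F \<xi> = 0"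
proof -
  have [measurable]: "F \<in> borel_measurable borel" using F by (simp add: L2_def)
  let ?m = "\<lambda>\<xi>::real^'n. complex_of_real ((2 * pi * norm \<xi>) powr (\<alpha>/2))"
  have z: "(\<integral>\<xi>. F \<xi> * cnj (hs \<alpha> \<phi> \<xi>) \<partial>lborel) = 0" if \<phi>: "test_fun \<phi>" for \<phi>
    using Z[OF \<phi>] unfolding ip_Re[OF F hs_L2[OF \<alpha> \<phi>]] ip_Im[OF F hs_L2[OF \<alpha> \<phi>]] by (simp add: complex_eq_iff)
  have M: "(\<lambda>\<xi>. ?m \<xi> * complex_of_real (weight \<xi>)) \<in> L2"
    by (rule weight_multiplier_L2[OF \<alpha>, where C=1]) auto
  have FM: "integrable lborel (\<lambda>\<xi>. cmod (F \<xi>) * cmod (?m \<xi> * complex_of_real (weight \<xi>)))"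
    by (rule L2_norm_mult_integrable[OF F M])
  have "AE \<xi> in lborel. F \<xi> * ?m \<xi> = 0"
  proof (rule fundamental_lemma_test_fun)
    show "loc_integrable_c (\<lambda>\<xi>. F \<xi> * ?m \<xi>)" by (rule L2_multiplier_loc_integrable[OF \<alpha> F])
    fix \<psi> :: "real^'n \<Rightarrow> real" assume \<psi>: "test_fun \<psi>"
    obtain a b C where ab: "\<And>k::nat. test_fun (a k)" "\<And>k. test_fun (b k)" "C > 0"
      "\<And>x. (\<lambda>k. fourier (a k) x + \<i> * fourier (b k) x) \<longlonglongrightarrow> complex_of_real (\<psi> x)"
      "\<And>k x. cmod (fourier (a k) x + \<i> * fourier (b k) x) \<le> C * weight x"
      "\<And>\<xi>. (\<lambda>k. Complex (a k \<xi>) (b k \<xi>)) \<longlonglongrightarrow> cnj (fourier \<psi> \<xi>)"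
      "\<And>k \<xi>. cmod (Complex (a k \<xi>) (b k \<xi>)) \<le> cmod (fourier \<psi> \<xi>)"
      using test_fun_fourier_inverse[OF \<psi>] by blast
    have [measurable]: "\<psi> \<in> borel_measurable borel" "a k \<in> borel_measurable borel" "b k \<in> borel_measurable borel" for k
      using ab(1,2) \<psi> by (auto intro: test_fun_measurable)
    have [measurable]: "fourier (a k) \<in> borel_measurable borel" "fourier (b k) \<in> borel_measurable borel" for k
      by (auto intro!: fourier_measurable)
    let ?s = "\<lambda>k \<xi>. fourier (a k) \<xi> + \<i> * fourier (b k) \<xi>"
    have "(\<integral>\<xi>. F \<xi> * cnj (?m \<xi> * ?s k \<xi>) \<partial>lborel) = 0" for k
    proof -
      have "(\<integral>\<xi>. F \<xi> * cnj (?m \<xi> * ?s k \<xi>) \<partial>lborel)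
        = (\<integral>\<xi>. F \<xi> * cnj (hs \<alpha> (a k) \<xi>) + (- \<i>) * (F \<xi> * cnj (hs \<alpha> (b k) \<xi>)) \<partial>lborel)"
        by (intro Bochner_Integration.integral_cong refl) (simp add: hs_def algebra_simps)
      also have "\<dots> = (\<integral>\<xi>. F \<xi> * cnj (hs \<alpha> (a k) \<xi>) \<partial>lborel) + (- \<i>) * (\<integral>\<xi>. F \<xi> * cnj (hs \<alpha> (b k) \<xi>) \<partial>lborel)"
        by (subst Bochner_Integration.integral_add)
          (auto intro!: integrable_mult_right L2_mult_integrable F hs_L2 \<alpha> ab simp del: mult_minus_left)
      finally show ?thesis by (simp add: z ab)
    qed
    moreover have "(\<lambda>k. \<integral>\<xi>. F \<xi> * cnj (?m \<xi> * ?s k \<xi>) \<partial>lborel) \<longlonglongrightarrow> (\<integral>\<xi>. F \<xi> * cnj (?m \<xi> * complex_of_real (\<psi> \<xi>)) \<partial>lborel)"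
    proof (rule integral_dominated_convergence[where w="\<lambda>\<xi>. C * (cmod (F \<xi>) * cmod (?m \<xi> * complex_of_real (weight \<xi>)))"])
      show "integrable lborel (\<lambda>\<xi>. C * (cmod (F \<xi>) * cmod (?m \<xi> * complex_of_real (weight \<xi>))))"
        by (rule integrable_mult_right[OF FM])
      show "AE \<xi> in lborel. (\<lambda>k. F \<xi> * cnj (?m \<xi> * ?s k \<xi>)) \<longlonglongrightarrow> F \<xi> * cnj (?m \<xi> * complex_of_real (\<psi> \<xi>))"
        by (intro AE_I2 tendsto_mult tendsto_const tendsto_cnj ab)
      show "AE \<xi> in lborel. norm (F \<xi> * cnj (?m \<xi> * ?s k \<xi>)) \<le> C * (cmod (F \<xi>) * cmod (?m \<xi> * complex_of_real (weight \<xi>)))" for k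
      proof (rule AE_I2)
        fix \<xi> :: "real^'n"
        have "(cmod (F \<xi>) * cmod (?m \<xi>)) * cmod (?s k \<xi>) \<le> (cmod (F \<xi>) * cmod (?m \<xi>)) * (C * weight \<xi>)"
          by (intro mult_left_mono ab) simp
        then show "norm (F \<xi> * cnj (?m \<xi> * ?s k \<xi>)) \<le> C * (cmod (F \<xi>) * cmod (?m \<xi> * complex_of_real (weight \<xi>)))"
          unfolding norm_mult complex_mod_cnj by (simp add: mult_ac)
      qed
    qed measurable
    ultimately have "(\<integral>\<xi>. F \<xi> * cnj (?m \<xi> * complex_of_real (\<psi> \<xi>)) \<partial>lborel) = 0"
      using LIMSEQ_unique[OF tendsto_const] by force
    then show "(\<integral>\<xi>. F \<xi> * ?m \<xi> * complex_of_real (\<psi> \<xi>) \<partial>lborel) = 0" by (simp add: mult.assoc)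
  qed
  with AE_lborel_nonzero show ?thesis by eventually_elim auto
qed

text \<open>The \<open>L2\<close> limit along any approximating sequence of \<open>U\<close> has the
  same products with all \<open>hs \<alpha> \<phi>\<close> as \<open>ht \<alpha> \<rho>\<close>, so
  by \<open>hs_total\<close> the two agree. Products in the dual norm then become integrals against
  \<open>U\<close>.\<close>

lemma riesz_pot_pairing:
  fixes \<rho> f :: "real^'n \<Rightarrow> real"
  assumes \<alpha>: "0 < \<alpha>" "\<alpha> < real CARD('n)" and q: "q > 1" and \<rho>: "\<rho> \<in> H_alpha q \<alpha>" and U: "riesz_pot \<alpha> \<rho> U"
    and f: "f \<in> borel_measurable borel" "\<And>x. \<bar>f x\<bar> \<le> B" "\<And>x. norm x > R \<Longrightarrow> f x = 0"
  shows "ip (ht \<alpha> f) (ht \<alpha> \<rho>) = (\<integral>x. f x * U x \<partial>lborel)"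
proof -
  obtain \<psi> where \<psi>: "hdot_approx \<alpha> \<psi> U"
    "\<And>\<phi>. test_fun \<phi> \<Longrightarrow> (\<lambda>k. hdot_inner \<alpha> (\<psi> k) \<phi>) \<longlonglongrightarrow> (\<integral>x. \<rho> x * \<phi> x \<partial>lborel)"
    using U unfolding riesz_pot_def by blast
  have t: "test_fun (\<psi> k)" for k using \<psi>(1) by (simp add: hdot_approx_def)
  obtain G where G: "G \<in> L2" "(\<lambda>k. ip (\<lambda>x. hs \<alpha> (\<psi> k) x - G x) (\<lambda>x. hs \<alpha> (\<psi> k) x - G x)) \<longlonglongrightarrow> 0"
    using hdot_approx_limit[OF \<alpha> \<psi>(1)] by blast
  have v: "ht \<alpha> \<rho> \<in> L2" using \<rho> by (auto simp: H_alpha_def intro: Hneg_ht)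
  have "AE \<xi> in lborel. G \<xi> - ht \<alpha> \<rho> \<xi> = 0"
  proof (rule hs_total[OF \<alpha> L2_diff[OF G(1) v]])
    fix \<phi> :: "real^'n \<Rightarrow> real" assume \<phi>: "test_fun \<phi>"
    have h: "hs \<alpha> \<phi> \<in> L2" by (rule hs_L2[OF \<alpha> \<phi>])
    have hi: "(\<lambda>\<xi>. \<i> * hs \<alpha> \<phi> \<xi>) \<in> L2" by (rule L2_cmult[OF h])
    have "ip G (hs \<alpha> \<phi>) = (\<integral>x. \<rho> x * \<phi> x \<partial>lborel)"
      using ip_tendsto[OF hs_L2[OF \<alpha> t] G(1) h G(2)] \<psi>(2)[OF \<phi>]
      unfolding hdot_inner_ip[OF \<alpha> t \<phi>] by (rule LIMSEQ_unique)
    then show "ip (\<lambda>\<xi>. G \<xi> - ht \<alpha> \<rho> \<xi>) (hs \<alpha> \<phi>) = 0"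
      by (simp add: ip_diff_left[OF G(1) v h] pairing_H_alpha(1)[OF \<alpha> q \<rho> \<phi>])
    \<comment> \<open>Transforms of real functions give zero for every k by Hermitian symmetry, and
      the limit inherits this.\<close>
    have "ip G (\<lambda>\<xi>. \<i> * hs \<alpha> \<phi> \<xi>) = 0"
      using ip_tendsto[OF hs_L2[OF \<alpha> t] G(1) hi G(2)] unfolding hs_ip_imaginary[OF t \<phi>]
      by (rule LIMSEQ_unique) (rule tendsto_const)
    then show "ip (\<lambda>\<xi>. G \<xi> - ht \<alpha> \<rho> \<xi>) (\<lambda>\<xi>. \<i> * hs \<alpha> \<phi> \<xi>) = 0"
      by (simp add: ip_diff_left[OF G(1) v hi] pairing_H_alpha(2)[OF \<alpha> q \<rho> \<phi>])
  qed
  then have ae: "AE \<xi> in lborel. ht \<alpha> \<rho> \<xi> = G \<xi>" by eventually_elim simp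
  have fH: "f \<in> H_alpha q \<alpha>" by (rule bounded_support_H_alpha[OF \<alpha> q f])
  then have fv: "ht \<alpha> f \<in> L2" by (auto simp: H_alpha_def intro: Hneg_ht)
  have "ip (ht \<alpha> f) (ht \<alpha> \<rho>) = ip (ht \<alpha> f) G"
    using fv v G(1) ae by (intro ip_cong) (auto simp: L2_def)
  also have "\<dots> = (\<integral>x. f x * U x \<partial>lborel)"
    by (rule hdot_approx_pairing(2)[OF \<alpha> q \<psi>(1) G f])
  finally show ?thesis .
qed

subsection \<open>Closedness of the energy space\<close>

lemma integrable_powr_le_weight:
  fixes w :: "real^'n \<Rightarrow> 'b::{banach,second_countable_topology}"
  assumes p: "p > 1" and [measurable]: "w \<in> borel_measurable borel" and C: "\<And>x. norm (w x) \<le> C * weight x"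
  shows "integrable lborel (\<lambda>x. norm (w x) powr p)"
proof (rule Bochner_Integration.integrable_bound)
  show "integrable lborel (\<lambda>x::real^'n. \<bar>C\<bar> powr p * weight x)" by (intro integrable_mult_right integrable_weight)
  show "AE x in lborel. norm (norm (w x) powr p) \<le> norm (\<bar>C\<bar> powr p * weight x)"
  proof (rule AE_I2)
    fix x
    have "norm (w x) \<le> \<bar>C\<bar> * weight x"
      using C[of x] mult_right_mono[OF abs_ge_self[of C] weight_nonneg[of x]] by linarith
    then have "norm (w x) powr p \<le> (\<bar>C\<bar> * weight x) powr p" using p by (intro powr_mono2) auto
    also have "\<dots> = \<bar>C\<bar> powr p * weight x powr p" by (simp add: powr_mult)
    also have "\<dots> \<le> \<bar>C\<bar> powr p * weight x"
      using powr_mono'[of 1 p "weight x"] p weight_le1[of x] by (intro mult_left_mono) auto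
    finally show "norm (norm (w x) powr p) \<le> norm (\<bar>C\<bar> powr p * weight x)" by simp
  qed
qed measurable

text \<open>Vector values are allowed because the lemma serves both the real potential
  \<open>V2\<close> and the complex transforms of test functions.\<close>

lemma Lp_pairing_tendsto:
  fixes r :: "nat \<Rightarrow> real^'n \<Rightarrow> real" and w :: "real^'n \<Rightarrow> 'b::{banach,second_countable_topology}"
  assumes q: "q > 1" and r: "\<And>k. r k \<in> Lp q" and \<rho>: "\<rho> \<in> Lp q"
    and lim: "(\<lambda>k. \<integral>x. \<bar>r k x - \<rho> x\<bar> powr q \<partial>lborel) \<longlonglongrightarrow> 0"
    and wm: "w \<in> borel_measurable borel" and w: "integrable lborel (\<lambda>x. norm (w x) powr conj_exp q)"
  shows "(\<lambda>k. \<integral>x. r k x *\<^sub>R w x \<partial>lborel) \<longlonglongrightarrow> (\<integral>x. \<rho> x *\<^sub>R w x \<partial>lborel)"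
    and "integrable lborel (\<lambda>x. \<rho> x *\<^sub>R w x)"
proof -
  note wm[measurable]
  have q': "conj_exp q > 1" "1/q + 1/conj_exp q = 1" using q by (auto simp: conj_exp_def field_simps)
  have int: "integrable lborel (\<lambda>x. f x *\<^sub>R w x)" if f: "f \<in> Lp q" for f
  proof -
    have [measurable]: "f \<in> borel_measurable borel" using f by (simp add: Lp_def)
    have "integrable lborel (\<lambda>x. f x * norm (w x))"
      using f w by (intro integrable_Hoelder[OF q q']) (auto simp: Lp_def)
    then show ?thesis by (rule Bochner_Integration.integrable_bound) (auto simp: abs_mult)
  qed
  then show "integrable lborel (\<lambda>x. \<rho> x *\<^sub>R w x)" using \<rho> .
  define W where "W = (\<integral>x. norm (w x) powr conj_exp q \<partial>lborel) powr (1 / conj_exp q)"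
  have "(\<lambda>k. (\<integral>x. r k x *\<^sub>R w x \<partial>lborel) - (\<integral>x. \<rho> x *\<^sub>R w x \<partial>lborel)) \<longlonglongrightarrow> 0"
  proof (rule Lim_null_comparison)
    have "norm ((\<integral>x. r k x *\<^sub>R w x \<partial>lborel) - (\<integral>x. \<rho> x *\<^sub>R w x \<partial>lborel)) \<le> (\<integral>x. \<bar>r k x - \<rho> x\<bar> powr q \<partial>lborel) powr (1/q) * W" for k
    proof -
      have [measurable]: "r k \<in> borel_measurable borel" "\<rho> \<in> borel_measurable borel" using r \<rho> by (auto simp: Lp_def)
      have "integrable lborel (\<lambda>x. norm (r k x - \<rho> x) powr q)"
        using q r[of k] \<rho> by (intro integrable_powr_diff) (auto simp: Lp_def)
      then have H: "(\<integral>x. \<bar>(r k x - \<rho> x) * norm (w x)\<bar> \<partial>lborel) \<le> (\<integral>x. \<bar>r k x - \<rho> x\<bar> powr q \<partial>lborel) powr (1/q) * (\<integral>x. \<bar>norm (w x)\<bar> powr conj_exp q \<partial>lborel) powr (1/conj_exp q)"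
        using w by (intro Hoelder_inequality[OF q q']) auto
      have "(\<integral>x. r k x *\<^sub>R w x \<partial>lborel) - (\<integral>x. \<rho> x *\<^sub>R w x \<partial>lborel) = (\<integral>x. (r k x - \<rho> x) *\<^sub>R w x \<partial>lborel)"
        using int[OF r[of k]] int[OF \<rho>] by (simp add: scaleR_diff_left)
      then have "norm ((\<integral>x. r k x *\<^sub>R w x \<partial>lborel) - (\<integral>x. \<rho> x *\<^sub>R w x \<partial>lborel)) \<le> (\<integral>x. norm ((r k x - \<rho> x) *\<^sub>R w x) \<partial>lborel)"
        using integral_norm_bound[of lborel "\<lambda>x. (r k x - \<rho> x) *\<^sub>R w x"] by simp
      then show ?thesis using H by (simp add: W_def abs_mult)
    qed
    then show "\<forall>\<^sub>F k in sequentially. norm ((\<integral>x. r k x *\<^sub>R w x \<partial>lborel) - (\<integral>x. \<rho> x *\<^sub>R w x \<partial>lborel)) \<le> (\<integral>x. \<bar>r k x - \<rho> x\<bar> powr q \<partial>lborel) powr (1/q) * W"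
      by (intro always_eventually) simp
    have "(\<lambda>k. (\<integral>x. \<bar>r k x - \<rho> x\<bar> powr q \<partial>lborel) powr (1/q) * W) \<longlonglongrightarrow> 0 powr (1/q) * W"
      using q by (intro tendsto_mult tendsto_powr' lim tendsto_const) auto
    then show "(\<lambda>k. (\<integral>x. \<bar>r k x - \<rho> x\<bar> powr q \<partial>lborel) powr (1/q) * W) \<longlonglongrightarrow> 0" by simp
  qed
  then show "(\<lambda>k. \<integral>x. r k x *\<^sub>R w x \<partial>lborel) \<longlonglongrightarrow> (\<integral>x. \<rho> x *\<^sub>R w x \<partial>lborel)" by (rule LIM_zero_cancel)
qed

text \<open>The two limits, one in L^q and one on the Fourier side, are linked by passing to the
  limit in the defining identity of the transforms. It shows that \<open>H\<close> times the
  multiplier of order \<alpha>/2 is a transform of \<rho>.\<close>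

lemma H_alpha_closed:
  fixes r :: "nat \<Rightarrow> real^'n \<Rightarrow> real"
  assumes \<alpha>: "0 < \<alpha>" "\<alpha> < real CARD('n)" and q: "q > 1" and r: "\<And>k. r k \<in> H_alpha q \<alpha>" and \<rho>: "\<rho> \<in> Lp q"
    and lim: "(\<lambda>k. \<integral>x. \<bar>r k x - \<rho> x\<bar> powr q \<partial>lborel) \<longlonglongrightarrow> 0"
    and H: "H \<in> L2" "(\<lambda>k. ip (\<lambda>x. ht \<alpha> (r k) x - H x) (\<lambda>x. ht \<alpha> (r k) x - H x)) \<longlonglongrightarrow> 0"
  shows "\<rho> \<in> H_alpha q \<alpha>" "AE \<xi> in lborel. ht \<alpha> \<rho> \<xi> = H \<xi>"
proof -
  let ?m = "\<lambda>\<xi>::real^'n. complex_of_real ((2 * pi * norm \<xi>) powr (\<alpha>/2))"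
  let ?n = "\<lambda>\<xi>::real^'n. complex_of_real ((2 * pi * norm \<xi>) powr (-\<alpha>/2))"
  have nm: "?n \<xi> * ?m \<xi> = 1" if "\<xi> \<noteq> 0" for \<xi>
  proof -
    have "(2 * pi * norm \<xi>) powr (- \<alpha>/2) * (2 * pi * norm \<xi>) powr (\<alpha>/2) = 1"
      using that by (simp add: powr_add[symmetric])
    then show ?thesis by (simp only: of_real_mult[symmetric] of_real_1)
  qed
  have [measurable]: "H \<in> borel_measurable borel" using H by (simp add: L2_def)
  have L: "r k \<in> Lp q" and N: "r k \<in> Hneg \<alpha>" for k using r[of k] by (auto simp: H_alpha_def)
  have hr: "ht \<alpha> (r k) \<in> L2" for k by (rule Hneg_ht[OF N])
  have [measurable]: "fourier_d (r k) \<in> borel_measurable borel" for k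
    using Hneg_fourier[OF N[of k]] by (simp add: is_fourier_of_def loc_integrable_c_def)
  have F: "is_fourier_of \<rho> (\<lambda>\<xi>. H \<xi> * ?m \<xi>)"
    unfolding is_fourier_of_def
  proof (intro conjI allI impI L2_multiplier_loc_integrable \<alpha> H)
    fix \<phi> :: "real^'n \<Rightarrow> real" assume \<phi>: "test_fun \<phi>"
    have [measurable]: "\<phi> \<in> borel_measurable borel" by (rule test_fun_measurable[OF \<phi>])
    obtain R where R: "R > 0" "\<And>x. norm x > R \<Longrightarrow> \<phi> x = 0" using test_fun_support[OF \<phi>] by blast
    obtain B where B: "B > 0" "\<And>x. \<bar>\<phi> x\<bar> \<le> B" using test_fun_bounded[OF \<phi>] by blast
    obtain c where c: "c > 0" "\<And>x::real^'n. norm x \<le> R \<Longrightarrow> c \<le> weight x" using weight_lower_bound by blast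
    have b: "\<bar>\<phi> \<xi>\<bar> \<le> (B / c) * weight \<xi>" for \<xi>
    proof (cases "norm \<xi> \<le> R")
      case True
      have "\<bar>\<phi> \<xi>\<bar> \<le> (B / c) * c" using B c by simp
      also have "\<dots> \<le> (B / c) * weight \<xi>" using B c True by (intro mult_left_mono) auto
      finally show ?thesis .
    next
      case False
      then show ?thesis using R(2)[of \<xi>] B(1) c(1) by simp
    qed
    \<comment> \<open>The multiplier attached to \<phi> undoes the one in \<open>ht\<close>, so the
      \<open>L2\<close> product with \<open>M\<close> is the integral of the transform against
      \<phi>.\<close>
    define M where "M = (\<lambda>\<xi>. ?m \<xi> * complex_of_real (\<phi> \<xi>))"
    have M: "M \<in> L2" unfolding M_def by (rule weight_multiplier_L2[OF \<alpha>, where C="B/c"]) (use b in auto)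
    have [measurable]: "M \<in> borel_measurable borel" using M by (simp add: L2_def)
    have "(\<lambda>k. Complex (ip (ht \<alpha> (r k)) M) (ip (ht \<alpha> (r k)) (\<lambda>x. \<i> * M x))) \<longlonglongrightarrow> Complex (ip H M) (ip H (\<lambda>x. \<i> * M x))"
      by (intro tendsto_Complex ip_tendsto[OF hr H(1) _ H(2)] M L2_cmult)
    moreover have cI: "Complex (ip u M) (ip u (\<lambda>x. \<i> * M x)) = (\<integral>\<xi>. u \<xi> * cnj (M \<xi>) \<partial>lborel)" if "u \<in> L2" for u
      using that M by (simp add: ip_Re ip_Im)
    ultimately have "(\<lambda>k. \<integral>\<xi>. ht \<alpha> (r k) \<xi> * cnj (M \<xi>) \<partial>lborel) \<longlonglongrightarrow> (\<integral>\<xi>. H \<xi> * cnj (M \<xi>) \<partial>lborel)"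
      using hr H(1) by simp
    moreover have "(\<integral>\<xi>. ht \<alpha> (r k) \<xi> * cnj (M \<xi>) \<partial>lborel) = (\<integral>x. r k x *\<^sub>R fourier \<phi> x \<partial>lborel)" for k
    proof -
      have "(\<integral>\<xi>. ht \<alpha> (r k) \<xi> * cnj (M \<xi>) \<partial>lborel) = (\<integral>\<xi>. fourier_d (r k) \<xi> * complex_of_real (\<phi> \<xi>) \<partial>lborel)"
      proof (rule integral_cong_AE)
        show "AE \<xi> in lborel. ht \<alpha> (r k) \<xi> * cnj (M \<xi>) = fourier_d (r k) \<xi> * complex_of_real (\<phi> \<xi>)"
        proof (rule eventually_mono[OF AE_lborel_nonzero])
          fix \<xi> :: "real^'n" assume "\<xi> \<noteq> 0"
          have "ht \<alpha> (r k) \<xi> * cnj (M \<xi>) = (?n \<xi> * ?m \<xi>) * (fourier_d (r k) \<xi> * complex_of_real (\<phi> \<xi>))"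
            by (simp add: ht_def M_def mult_ac)
          then show "ht \<alpha> (r k) \<xi> * cnj (M \<xi>) = fourier_d (r k) \<xi> * complex_of_real (\<phi> \<xi>)"
            using nm[OF \<open>\<xi> \<noteq> 0\<close>] by simp
        qed
        show "(\<lambda>\<xi>. ht \<alpha> (r k) \<xi> * cnj (M \<xi>)) \<in> borel_measurable lborel" unfolding ht_def by measurable
      qed measurable
      also have "\<dots> = (\<integral>x. complex_of_real (r k x) * fourier \<phi> x \<partial>lborel)"
        using Hneg_fourier[OF N[of k]] \<phi> by (simp add: is_fourier_of_def)
      finally show ?thesis by (simp add: scaleR_conv_of_real[where 'a=complex])
    qed
    moreover have "(\<lambda>k. \<integral>x. r k x *\<^sub>R fourier \<phi> x \<partial>lborel) \<longlonglongrightarrow> (\<integral>x. \<rho> x *\<^sub>R fourier \<phi> x \<partial>lborel)"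
    proof (rule Lp_pairing_tendsto(1)[OF q L \<rho> lim])
      show fm: "fourier \<phi> \<in> borel_measurable borel" by (rule fourier_measurable) measurable
      obtain C where "\<And>\<xi>. cmod (fourier \<phi> \<xi>) \<le> C * weight \<xi> ^ 1" using fourier_decay_weight[OF \<phi>] by blast
      then show "integrable lborel (\<lambda>x. cmod (fourier \<phi> x) powr conj_exp q)"
        using q by (intro integrable_powr_le_weight[OF _ fm, of _ C]) (auto simp: conj_exp_def field_simps)
    qed
    ultimately have "(\<integral>x. \<rho> x *\<^sub>R fourier \<phi> x \<partial>lborel) = (\<integral>\<xi>. H \<xi> * cnj (M \<xi>) \<partial>lborel)"
      using LIMSEQ_unique by simp
    then show "(\<integral>x. complex_of_real (\<rho> x) * fourier \<phi> x \<partial>lborel) = (\<integral>\<xi>. H \<xi> * ?m \<xi> * complex_of_real (\<phi> \<xi>) \<partial>lborel)"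
      by (simp add: scaleR_conv_of_real[where 'a=complex] M_def mult.assoc)
  qed
  have ae: "AE \<xi> in lborel. ?n \<xi> * (H \<xi> * ?m \<xi>) = H \<xi>"
  proof (rule eventually_mono[OF AE_lborel_nonzero])
    fix \<xi> :: "real^'n" assume "\<xi> \<noteq> 0"
    have "?n \<xi> * (H \<xi> * ?m \<xi>) = (?n \<xi> * ?m \<xi>) * H \<xi>" by (simp add: mult_ac)
    then show "?n \<xi> * (H \<xi> * ?m \<xi>) = H \<xi>" using nm[OF \<open>\<xi> \<noteq> 0\<close>] by simp
  qed
  have nH: "(\<lambda>\<xi>. ?n \<xi> * (H \<xi> * ?m \<xi>)) \<in> L2" by (rule L2_cong[OF H(1) ae]) measurable
  show "\<rho> \<in> H_alpha q \<alpha>" using HnegI(1)[OF F nH] \<rho> by (simp add: H_alpha_def)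
  show "AE \<xi> in lborel. ht \<alpha> \<rho> \<xi> = H \<xi>"
    using HnegI(2)[OF F nH] ae by eventually_elim simp
qed

subsection \<open>The minimization problem\<close>

text \<open>To be read with x the energy at the midpoint, a and b the energies at the ends, i the
  infimum, and g and n the convexity defect over q and the squared norm of the difference.\<close>

lemma midpoint_arith:
  fixes x :: real
  assumes "x = (a + b) / 2 - g - n / 8" "i \<le> x" "a < i + s" "b < i + t"
  shows "g + n / 8 \<le> (s + t) / 2"
  using assms by argo

lemma midpoint_arith':
  fixes x :: real
  assumes "x = (a + b) / 2 - g - n / 8" "a = b" "a \<le> x"
  shows "g + n / 8 \<le> 0"
  using assms by argo

locale min_problem =
  fixes q \<alpha> :: real and V1 V2 :: "real^'n \<Rightarrow> real"
  assumes alpha: "0 < \<alpha>" "\<alpha> < real CARD('n)" and q: "q > 1"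
    and V1: "V1 \<in> Hdot \<alpha>" and V2: "V2 \<in> Lp (conj_exp q)"
begin

text \<open>The approximating sequence chosen by \<open>pair_hdot\<close>.\<close>

definition psi0 :: "nat \<Rightarrow> real^'n \<Rightarrow> real" where
  "psi0 = (SOME \<psi>. hdot_approx \<alpha> \<psi> V1)"

lemma psi0: "hdot_approx \<alpha> psi0 V1"
  using V1 unfolding psi0_def Hdot_def mem_Collect_eq by (rule someI_ex)

text \<open>The Fourier-side representative of \<open>V1\<close>: pairing a density with
  \<open>V1\<close> is the product with this function.\<close>

definition G :: "real^'n \<Rightarrow> complex" where
  "G = (SOME G. G \<in> L2 \<and> (\<lambda>k. ip (\<lambda>x. hs \<alpha> (psi0 k) x - G x) (\<lambda>x. hs \<alpha> (psi0 k) x - G x)) \<longlonglongrightarrow> 0)"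

lemma G: "G \<in> L2" "(\<lambda>k. ip (\<lambda>x. hs \<alpha> (psi0 k) x - G x) (\<lambda>x. hs \<alpha> (psi0 k) x - G x)) \<longlonglongrightarrow> 0"
proof -
  have "\<exists>G. G \<in> L2 \<and> (\<lambda>k. ip (\<lambda>x. hs \<alpha> (psi0 k) x - G x) (\<lambda>x. hs \<alpha> (psi0 k) x - G x)) \<longlonglongrightarrow> 0"
    using hdot_approx_limit[OF alpha psi0] by blast
  from someI_ex[OF this]
  show "G \<in> L2" "(\<lambda>k. ip (\<lambda>x. hs \<alpha> (psi0 k) x - G x) (\<lambda>x. hs \<alpha> (psi0 k) x - G x)) \<longlonglongrightarrow> 0"
    unfolding G_def by blast+
qed

definition P :: "(real^'n \<Rightarrow> real) \<Rightarrow> real" where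
  "P \<rho> = (\<integral>x. \<bar>\<rho> x\<bar> powr q \<partial>lborel)"

definition N :: "(real^'n \<Rightarrow> real) \<Rightarrow> (real^'n \<Rightarrow> real) \<Rightarrow> real" where
  "N \<rho> \<sigma> = ip (ht \<alpha> \<rho>) (ht \<alpha> \<sigma>)"

definition lin :: "(real^'n \<Rightarrow> real) \<Rightarrow> real" where
  "lin \<rho> = ip (ht \<alpha> \<rho>) G + (\<integral>x. \<rho> x * V2 x \<partial>lborel)"

abbreviation E :: "(real^'n \<Rightarrow> real) \<Rightarrow> real" where "E \<equiv> energy q \<alpha> V1 V2"
abbreviation H :: "(real^'n \<Rightarrow> real) set" where "H \<equiv> H_alpha q \<alpha>"
abbreviation Hp :: "(real^'n \<Rightarrow> real) set" where "Hp \<equiv> H_alpha_pos q \<alpha>"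

lemma HpD: "\<rho> \<in> Hp \<Longrightarrow> \<rho> \<in> H" "\<rho> \<in> Hp \<Longrightarrow> AE x in lborel. 0 \<le> \<rho> x"
  by (auto simp: H_alpha_pos_def)

lemma HD: "\<rho> \<in> H \<Longrightarrow> \<rho> \<in> Lp q" "\<rho> \<in> H \<Longrightarrow> \<rho> \<in> Hneg \<alpha>" "\<rho> \<in> H \<Longrightarrow> ht \<alpha> \<rho> \<in> L2"
  by (auto simp: H_alpha_def intro: Hneg_ht)

lemma H_meas: "\<rho> \<in> H \<Longrightarrow> \<rho> \<in> borel_measurable borel"
  using HD(1) by (auto simp: Lp_def)

lemma H_int: "\<rho> \<in> H \<Longrightarrow> integrable lborel (\<lambda>x. \<bar>\<rho> x\<bar> powr q)"
  using HD(1) by (auto simp: Lp_def)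

lemma V2D: "V2 \<in> borel_measurable borel" "integrable lborel (\<lambda>x. \<bar>V2 x\<bar> powr conj_exp q)"
  using V2 by (auto simp: Lp_def)

lemma q': "conj_exp q > 1" "1/q + 1/conj_exp q = 1"
  using q by (auto simp: conj_exp_def field_simps)

lemma V2_int: "\<rho> \<in> H \<Longrightarrow> integrable lborel (\<lambda>x. \<rho> x * V2 x)"
  by (intro integrable_Hoelder[OF q q'] H_meas H_int V2D) (auto intro: H_meas V2D)

text \<open>The \<open>lim\<close> in \<open>pair_hdot\<close> runs along exactly the sequence
  \<open>psi0\<close>, so it evaluates to the product with \<open>G\<close>.\<close>

lemma pairV_lin: "\<rho> \<in> H \<Longrightarrow> pairV \<alpha> \<rho> V1 V2 = lin \<rho>"
  unfolding pairV_def lin_def pair_hdot_def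
  using hdot_approx_pairing(1)[OF alpha q psi0 G, of \<rho>] by (simp add: limI psi0_def)

lemma hneg_inner_N: "\<rho> \<in> H \<Longrightarrow> \<sigma> \<in> H \<Longrightarrow> hneg_inner \<alpha> \<rho> \<sigma> = N \<rho> \<sigma>"
  by (simp add: N_def hneg_inner_ip HD)

lemma energy_eq: "\<rho> \<in> H \<Longrightarrow> E \<rho> = P \<rho> / q - lin \<rho> + N \<rho> \<rho> / 2"
  by (simp add: energy_def pairV_lin hneg_norm2_ip P_def N_def)

lemma lincomb: "\<rho> \<in> H \<Longrightarrow> \<sigma> \<in> H \<Longrightarrow> (\<lambda>x. a * \<rho> x + b * \<sigma> x) \<in> H"
  by (rule H_alpha_lincomb(1)[OF q])

lemma ip_ht_lincomb:
  assumes \<rho>: "\<rho> \<in> H" and \<sigma>: "\<sigma> \<in> H" and w: "w \<in> L2"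
  shows "ip (ht \<alpha> (\<lambda>x. a * \<rho> x + b * \<sigma> x)) w = a * ip (ht \<alpha> \<rho>) w + b * ip (ht \<alpha> \<sigma>) w"
proof -
  let ?u = "\<lambda>\<xi>. complex_of_real a * ht \<alpha> \<rho> \<xi> + complex_of_real b * ht \<alpha> \<sigma> \<xi>"
  have u: "?u \<in> L2" by (intro L2_add L2_cmult HD \<rho> \<sigma>)
  have "ip (ht \<alpha> (\<lambda>x. a * \<rho> x + b * \<sigma> x)) w = ip ?u w"
    using H_alpha_lincomb(2)[OF q \<rho> \<sigma>, of a b] HD(3)[OF lincomb[OF \<rho> \<sigma>, of a b]] u w
    by (intro ip_cong) (auto simp: L2_def)
  then show ?thesis using w by (simp add: ip_add_left L2_cmult HD \<rho> \<sigma> ip_cmult_left)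
qed

lemma N_sym: "N \<rho> \<sigma> = N \<sigma> \<rho>" by (simp add: N_def ip_commute)

lemma N_left: "\<rho> \<in> H \<Longrightarrow> \<sigma> \<in> H \<Longrightarrow> \<tau> \<in> H \<Longrightarrow> N (\<lambda>x. a * \<rho> x + b * \<sigma> x) \<tau> = a * N \<rho> \<tau> + b * N \<sigma> \<tau>"
  by (simp add: N_def ip_ht_lincomb HD)

lemma N_lincomb:
  assumes \<rho>: "\<rho> \<in> H" and \<sigma>: "\<sigma> \<in> H"
  shows "N (\<lambda>x. a * \<rho> x + b * \<sigma> x) (\<lambda>x. a * \<rho> x + b * \<sigma> x) = a\<^sup>2 * N \<rho> \<rho> + 2 * a * b * N \<rho> \<sigma> + b\<^sup>2 * N \<sigma> \<sigma>"
proof -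
  let ?s = "\<lambda>x. a * \<rho> x + b * \<sigma> x"
  have "N ?s ?s = a * N \<rho> ?s + b * N \<sigma> ?s" by (rule N_left[OF \<rho> \<sigma> lincomb[OF \<rho> \<sigma>]])
  also have "N \<rho> ?s = a * N \<rho> \<rho> + b * N \<sigma> \<rho>" by (subst N_sym) (rule N_left[OF \<rho> \<sigma> \<rho>])
  also have "N \<sigma> ?s = a * N \<rho> \<sigma> + b * N \<sigma> \<sigma>" by (subst N_sym) (rule N_left[OF \<rho> \<sigma> \<sigma>])
  also have "N \<sigma> \<rho> = N \<rho> \<sigma>" by (rule N_sym)
  finally show ?thesis by (simp add: power2_eq_square algebra_simps)
qed

lemma N_nonneg: "0 \<le> N \<rho> \<rho>" by (simp add: N_def)

lemma lin_lincomb: "\<rho> \<in> H \<Longrightarrow> \<sigma> \<in> H \<Longrightarrow> lin (\<lambda>x. a * \<rho> x + b * \<sigma> x) = a * lin \<rho> + b * lin \<sigma>"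
  using V2_int[of \<rho>] V2_int[of \<sigma>] by (simp add: lin_def ip_ht_lincomb G distrib_right mult.assoc distrib_left)

text \<open>Absolute values keep the integrand in the range where \<open>powr_gap\<close> is
  nonnegative: members of \<open>Hp\<close> are nonnegative only almost everywhere.\<close>

definition gap :: "(real^'n \<Rightarrow> real) \<Rightarrow> (real^'n \<Rightarrow> real) \<Rightarrow> real" where
  "gap \<rho> \<sigma> = (\<integral>x. powr_gap q \<bar>\<rho> x\<bar> \<bar>\<sigma> x\<bar> \<partial>lborel)"

text \<open>Explicit coefficients, also in \<open>dif\<close>, so that the lemmas on linear
  combinations apply by matching.\<close>

abbreviation mid :: "(real^'n \<Rightarrow> real) \<Rightarrow> (real^'n \<Rightarrow> real) \<Rightarrow> real^'n \<Rightarrow> real" where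
  "mid \<rho> \<sigma> \<equiv> (\<lambda>x. (1/2) * \<rho> x + (1/2) * \<sigma> x)"
abbreviation dif :: "(real^'n \<Rightarrow> real) \<Rightarrow> (real^'n \<Rightarrow> real) \<Rightarrow> real^'n \<Rightarrow> real" where
  "dif \<rho> \<sigma> \<equiv> (\<lambda>x. 1 * \<rho> x + (-1) * \<sigma> x)"

lemma mid_pos: "\<rho> \<in> Hp \<Longrightarrow> \<sigma> \<in> Hp \<Longrightarrow> mid \<rho> \<sigma> \<in> Hp"
  using lincomb[of \<rho> \<sigma> "1/2" "1/2"] by (auto simp: H_alpha_pos_def elim: AE_mp)

lemma
  assumes \<rho>: "\<rho> \<in> Hp" and \<sigma>: "\<sigma> \<in> Hp"
  shows gap_integrable: "integrable lborel (\<lambda>x. powr_gap q \<bar>\<rho> x\<bar> \<bar>\<sigma> x\<bar>)"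
    and P_mid: "P (mid \<rho> \<sigma>) = (P \<rho> + P \<sigma>) / 2 - gap \<rho> \<sigma>"
proof -
  note h = HpD(1)[OF \<rho>] HpD(1)[OF \<sigma>] lincomb[OF HpD(1)[OF \<rho>] HpD(1)[OF \<sigma>], of "1/2" "1/2"]
  have [measurable]: "\<rho> \<in> borel_measurable borel" "\<sigma> \<in> borel_measurable borel" using h H_meas by auto
  have ae: "AE x in lborel. \<bar>mid \<rho> \<sigma> x\<bar> powr q = ((\<bar>\<rho> x\<bar> + \<bar>\<sigma> x\<bar>) / 2) powr q"
    using HpD(2)[OF \<rho>] HpD(2)[OF \<sigma>] by eventually_elim (simp add: add_divide_distrib)
  have i: "integrable lborel (\<lambda>x. ((\<bar>\<rho> x\<bar> + \<bar>\<sigma> x\<bar>) / 2) powr q)"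
    by (rule integrable_cong_AE_imp[OF H_int[OF h(3)]]) (use ae in \<open>auto elim: eventually_mono\<close>)
  have e: "(\<integral>x. ((\<bar>\<rho> x\<bar> + \<bar>\<sigma> x\<bar>) / 2) powr q \<partial>lborel) = P (mid \<rho> \<sigma>)"
    unfolding P_def by (intro integral_cong_AE) (use ae in \<open>auto elim: eventually_mono\<close>)
  show "integrable lborel (\<lambda>x. powr_gap q \<bar>\<rho> x\<bar> \<bar>\<sigma> x\<bar>)"
    unfolding powr_gap_def using i H_int h by auto
  show "P (mid \<rho> \<sigma>) = (P \<rho> + P \<sigma>) / 2 - gap \<rho> \<sigma>"
    unfolding gap_def powr_gap_def using i H_int[OF h(1)] H_int[OF h(2)] by (simp add: e) (simp add: P_def)
qed

lemma gap_nonneg: "0 \<le> gap \<rho> \<sigma>"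
  unfolding gap_def by (intro integral_nonneg_AE AE_I2 powr_gap_nonneg q) auto

text \<open>The linear part is affine and drops out. The parallelogram law for the squared norm
  leaves a quarter of the norm of the difference, and the factor 1/2 in the energy makes it an
  eighth.\<close>

lemma energy_mid:
  assumes \<rho>: "\<rho> \<in> Hp" and \<sigma>: "\<sigma> \<in> Hp"
  shows "E (mid \<rho> \<sigma>) = (E \<rho> + E \<sigma>) / 2 - gap \<rho> \<sigma> / q - N (dif \<rho> \<sigma>) (dif \<rho> \<sigma>) / 8"
proof -
  note h = HpD(1)[OF \<rho>] HpD(1)[OF \<sigma>]
  note e = energy_eq[OF lincomb[OF h, of "1/2" "1/2"]] energy_eq[OF h(1)] energy_eq[OF h(2)]
  show ?thesis
    unfolding e P_mid[OF \<rho> \<sigma>] lin_lincomb[OF h] N_lincomb[OF h]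
    using q by (simp add: field_simps power2_eq_square)
qed

text \<open>The pointwise estimate integrated. The constant depends on \<epsilon> only, not on the
  two densities.\<close>

lemma P_dif_bound:
  assumes "\<epsilon> > 0"
  obtains C where "C \<ge> 0" "\<And>\<rho> \<sigma>. \<rho> \<in> Hp \<Longrightarrow> \<sigma> \<in> Hp \<Longrightarrow> P (dif \<rho> \<sigma>) \<le> \<epsilon> * (P \<rho> + P \<sigma>) + C * gap \<rho> \<sigma>"
proof -
  obtain C where C: "C \<ge> 0" "\<And>a b. a \<ge> 0 \<Longrightarrow> b \<ge> 0 \<Longrightarrow> \<bar>a - b\<bar> powr q \<le> \<epsilon> * (a powr q + b powr q) + C * powr_gap q a b"
    using powr_gap_uniform[OF q assms] by blast
  show thesis
  proof (rule that[OF C(1)])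
    fix \<rho> \<sigma> assume \<rho>: "\<rho> \<in> Hp" and \<sigma>: "\<sigma> \<in> Hp"
    note h = HpD(1)[OF \<rho>] HpD(1)[OF \<sigma>]
    note i = H_int[OF h(1)] H_int[OF h(2)] gap_integrable[OF \<rho> \<sigma>]
    have "P (dif \<rho> \<sigma>) \<le> (\<integral>x. \<epsilon> * (\<bar>\<rho> x\<bar> powr q + \<bar>\<sigma> x\<bar> powr q) + C * powr_gap q \<bar>\<rho> x\<bar> \<bar>\<sigma> x\<bar> \<partial>lborel)"
      unfolding P_def
    proof (rule integral_mono_AE)
      show "integrable lborel (\<lambda>x. \<bar>dif \<rho> \<sigma> x\<bar> powr q)" by (rule H_int[OF lincomb[OF h]])
      show "integrable lborel (\<lambda>x. \<epsilon> * (\<bar>\<rho> x\<bar> powr q + \<bar>\<sigma> x\<bar> powr q) + C * powr_gap q \<bar>\<rho> x\<bar> \<bar>\<sigma> x\<bar>)"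
        using i by auto
      show "AE x in lborel. \<bar>dif \<rho> \<sigma> x\<bar> powr q \<le> \<epsilon> * (\<bar>\<rho> x\<bar> powr q + \<bar>\<sigma> x\<bar> powr q) + C * powr_gap q \<bar>\<rho> x\<bar> \<bar>\<sigma> x\<bar>"
        using HpD(2)[OF \<rho>] HpD(2)[OF \<sigma>]
      proof eventually_elim
        case (elim x)
        then show ?case using C(2)[of "\<rho> x" "\<sigma> x"] by simp
      qed
    qed
    also have "\<dots> = \<epsilon> * (P \<rho> + P \<sigma>) + C * gap \<rho> \<sigma>" using i by (simp add: P_def gap_def)
    finally show "P (dif \<rho> \<sigma>) \<le> \<epsilon> * (P \<rho> + P \<sigma>) + C * gap \<rho> \<sigma>" .
  qed
qed

lemma P_nonneg: "0 \<le> P \<rho>" unfolding P_def by simp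

text \<open>Young's inequality charges the pairing with \<open>V2\<close> to half of the power term;
  completing the square charges the pairing with \<open>V1\<close> to the dual norm. The other half
  of the power term is left over.\<close>

lemma energy_lower_bound:
  obtains c where "\<And>\<rho>. \<rho> \<in> H \<Longrightarrow> P \<rho> \<le> 2 * q * (E \<rho> + c)"
proof -
  \<comment> \<open>Chosen with \<delta>^q = 1/2, so that Young's inequality for \<delta> |\<rho>|
    and |V2|/\<delta> uses up exactly half of the power term.\<close>
  define \<delta> where "\<delta> = (1/2 :: real) powr (1/q)"
  have \<delta>: "\<delta> > 0" "\<delta> powr q = 1/2" using q by (auto simp: \<delta>_def powr_powr)
  define K where "K = (1/\<delta>) powr conj_exp q / conj_exp q"
  define c where "c = ip G G / 2 + K * (\<integral>x. \<bar>V2 x\<bar> powr conj_exp q \<partial>lborel)"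
  have "P \<rho> \<le> 2 * q * (E \<rho> + c)" if \<rho>: "\<rho> \<in> H" for \<rho>
  proof -
    have b: "\<rho> x * V2 x \<le> \<bar>\<rho> x\<bar> powr q / (2 * q) + K * \<bar>V2 x\<bar> powr conj_exp q" for x
    proof -
      have "(\<delta> * \<bar>\<rho> x\<bar>) * (1/\<delta> * \<bar>V2 x\<bar>) \<le> (\<delta> * \<bar>\<rho> x\<bar>) powr q / q + (1/\<delta> * \<bar>V2 x\<bar>) powr conj_exp q / conj_exp q"
        using \<delta> q q' by (intro Youngs_inequality) auto
      also have "(\<delta> * \<bar>\<rho> x\<bar>) powr q = 1/2 * \<bar>\<rho> x\<bar> powr q" by (simp add: powr_mult \<delta>)
      also have "(1/\<delta> * \<bar>V2 x\<bar>) powr conj_exp q / conj_exp q = K * \<bar>V2 x\<bar> powr conj_exp q"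
        using \<delta> by (subst powr_mult) (auto simp: K_def)
      also have "(\<delta> * \<bar>\<rho> x\<bar>) * (1/\<delta> * \<bar>V2 x\<bar>) = \<bar>\<rho> x * V2 x\<bar>" using \<delta>(1) by (simp add: abs_mult)
      finally show ?thesis by (simp add: mult.commute)
    qed
    have "(\<integral>x. \<rho> x * V2 x \<partial>lborel) \<le> (\<integral>x. \<bar>\<rho> x\<bar> powr q / (2 * q) + K * \<bar>V2 x\<bar> powr conj_exp q \<partial>lborel)"
      using H_int[OF \<rho>] V2D by (intro integral_mono V2_int \<rho> b) auto
    also have "\<dots> = P \<rho> / (2 * q) + K * (\<integral>x. \<bar>V2 x\<bar> powr conj_exp q \<partial>lborel)"
      using H_int[OF \<rho>] V2D by (simp add: P_def)
    finally have v: "(\<integral>x. \<rho> x * V2 x \<partial>lborel) \<le> P \<rho> / (2 * q) + K * (\<integral>x. \<bar>V2 x\<bar> powr conj_exp q \<partial>lborel)" .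
    have "0 \<le> ip (\<lambda>\<xi>. ht \<alpha> \<rho> \<xi> - G \<xi>) (\<lambda>\<xi>. ht \<alpha> \<rho> \<xi> - G \<xi>)" by simp
    also have "\<dots> = N \<rho> \<rho> - 2 * ip (ht \<alpha> \<rho>) G + ip G G"
      using HD(3)[OF \<rho>] G(1) by (simp add: ip_diff_left ip_diff_right L2_diff ip_commute[of G "ht \<alpha> \<rho>"] N_def)
    finally have "P \<rho> / q - P \<rho> / (2 * q) \<le> E \<rho> + c"
      unfolding energy_eq[OF \<rho>] lin_def c_def using v by linarith
    then show ?thesis using q by (simp add: field_simps)
  qed
  then show thesis by (rule that)
qed

lemma minimizer_exists: "\<exists>\<rho>\<in>Hp. \<forall>f\<in>Hp. E \<rho> \<le> E f"
proof -
  obtain c where c: "\<And>\<rho>. \<rho> \<in> H \<Longrightarrow> P \<rho> \<le> 2 * q * (E \<rho> + c)" by (rule energy_lower_bound) blast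
  have Elow: "- c \<le> E \<rho>" if "\<rho> \<in> H" for \<rho>
  proof -
    have "0 \<le> 2 * q * (E \<rho> + c)" using c[OF that] P_nonneg[of \<rho>] by linarith
    then show ?thesis using q by (simp add: zero_le_mult_iff)
  qed
  have q0: "q > 0" using q by simp
  define I where "I = Inf (E ` Hp)"
  have z: "(\<lambda>x. 0) \<in> Hp"
    using bounded_support_H_alpha[OF alpha q, of "\<lambda>x. 0" 0 0] by (auto simp: H_alpha_pos_def)
  have Ilow: "I \<le> E \<rho>" if "\<rho> \<in> Hp" for \<rho>
    unfolding I_def using that Elow HpD(1) by (intro cInf_lower bdd_belowI[of _ "- c"]) auto
  have "\<exists>\<rho>. \<rho> \<in> Hp \<and> E \<rho> < I + inverse (real (Suc k))" for k
  proof (rule ccontr)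
    assume h: "\<not> ?thesis"
    have "I + inverse (real (Suc k)) \<le> Inf (E ` Hp)"
      by (rule cInf_greatest) (use h z in \<open>auto simp: not_less\<close>)
    then show False by (simp add: I_def[symmetric] not_le)
  qed
  then obtain r where r: "\<And>k. r k \<in> Hp" and Er: "\<And>k. E (r k) < I + inverse (real (Suc k))" by metis
  note rH = HpD(1)[OF r]
  have EI: "(\<lambda>k. E (r k)) \<longlonglongrightarrow> I"
  proof (rule tendsto_sandwich[OF _ _ tendsto_const LIMSEQ_inverse_real_of_nat_add])
    show "\<forall>\<^sub>F k in sequentially. I \<le> E (r k)" using Ilow r by simp
    show "\<forall>\<^sub>F k in sequentially. E (r k) \<le> I + inverse (real (Suc k))" using Er less_imp_le by (intro always_eventually) blast
  qed
  \<comment> \<open>All energies of the sequence are below \<open>I + 1\<close>, so coercivity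
    bounds the power terms uniformly.\<close>
  define M where "M = 2 * q * (I + 1 + c)"
  have PM: "P (r k) \<le> M" for k
  proof -
    have "inverse (real (Suc k)) \<le> 1" by (simp add: field_simps)
    then have "E (r k) + c \<le> I + 1 + c" using Er[of k] by linarith
    then have "2 * q * (E (r k) + c) \<le> M" unfolding M_def using q by (intro mult_left_mono) auto
    then show ?thesis using c[OF rH[of k]] by linarith
  qed
  have M0: "M \<ge> 0" using PM[of 0] P_nonneg[of "r 0"] by linarith
  \<comment> \<open>The midpoint is admissible, hence its energy is at least \<open>I\<close>; both
    defects are paid for by the excess energies of the two ends.\<close>
  have key: "gap (r m) (r n) / q + N (dif (r m) (r n)) (dif (r m) (r n)) / 8 \<le> (inverse (real (Suc m)) + inverse (real (Suc n))) / 2" for m n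
    by (rule midpoint_arith[OF energy_mid[OF r r] Ilow[OF mid_pos[OF r r]] Er Er])
  have inv: "\<exists>N. \<forall>m\<ge>N. \<forall>n\<ge>N. inverse (real (Suc m)) + inverse (real (Suc n)) < e" if "e > 0" for e
  proof -
    obtain N where N: "inverse (real (Suc N)) < e / 2" using reals_Archimedean[of "e/2"] \<open>e > 0\<close> by (metis zero_less_divide_iff zero_less_numeral)
    have "inverse (real (Suc m)) + inverse (real (Suc n)) < e" if "m \<ge> N" "n \<ge> N" for m n
    proof -
      have "inverse (real (Suc m)) \<le> inverse (real (Suc N))" "inverse (real (Suc n)) \<le> inverse (real (Suc N))"
        using that by (auto intro!: le_imp_inverse_le)
      then show ?thesis using N by linarith
    qed
    then show ?thesis by blast
  qed
  have htd: "ip (\<lambda>x. ht \<alpha> (r m) x - ht \<alpha> (r n) x) (\<lambda>x. ht \<alpha> (r m) x - ht \<alpha> (r n) x) = N (dif (r m) (r n)) (dif (r m) (r n))" for m n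
    unfolding N_lincomb[OF rH rH]
    using HD(3)[OF rH[of m]] HD(3)[OF rH[of n]]
    by (simp add: ip_diff_left ip_diff_right L2_diff ip_commute[of "ht \<alpha> (r n)" "ht \<alpha> (r m)"] N_def)
  have C2: "\<exists>N. \<forall>m\<ge>N. \<forall>n\<ge>N. ip (\<lambda>x. ht \<alpha> (r m) x - ht \<alpha> (r n) x) (\<lambda>x. ht \<alpha> (r m) x - ht \<alpha> (r n) x) < e" if e: "e > 0" for e
  proof -
    obtain K where K: "\<forall>m\<ge>K. \<forall>n\<ge>K. inverse (real (Suc m)) + inverse (real (Suc n)) < e / 4" using inv[of "e/4"] e by auto
    have "ip (\<lambda>x. ht \<alpha> (r m) x - ht \<alpha> (r n) x) (\<lambda>x. ht \<alpha> (r m) x - ht \<alpha> (r n) x) < e" if "m \<ge> K" "n \<ge> K" for m n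
    proof -
      have "gap (r m) (r n) / q \<ge> 0" using gap_nonneg q by simp
      moreover have "inverse (real (Suc m)) + inverse (real (Suc n)) < e / 4" using K that by blast
      ultimately show ?thesis using key[of m n] unfolding htd by argo
    qed
    then show ?thesis by blast
  qed
  have Cq: "\<exists>N. \<forall>m\<ge>N. \<forall>n\<ge>N. (\<integral>x. norm (r m x - r n x) powr q \<partial>lborel) < e" if e: "e > 0" for e
  proof -
    \<comment> \<open>Order of choices: \<epsilon> from the uniform bound \<open>M\<close>, so that
      the first term is at most e/2; then \<open>C\<close> from \<epsilon>; then \<open>K\<close>
      from \<open>C\<close>, so that the term with the defect is below e/2.\<close>
    define \<epsilon> where "\<epsilon> = e / (4 * (M + 1))"
    have \<epsilon>: "\<epsilon> > 0" using e M0 by (simp add: \<epsilon>_def)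
    obtain C where C: "C \<ge> 0" "\<And>\<rho> \<sigma>. \<rho> \<in> Hp \<Longrightarrow> \<sigma> \<in> Hp \<Longrightarrow> P (dif \<rho> \<sigma>) \<le> \<epsilon> * (P \<rho> + P \<sigma>) + C * gap \<rho> \<sigma>"
      using P_dif_bound[OF \<epsilon>] by blast
    have pos: "e / (2 * ((C + 1) * q)) > 0" using e C q by simp
    obtain K where K: "\<forall>m\<ge>K. \<forall>n\<ge>K. inverse (real (Suc m)) + inverse (real (Suc n)) < e / (2 * ((C + 1) * q))"
      using inv[OF pos] by blast
    have "(\<integral>x. norm (r m x - r n x) powr q \<partial>lborel) < e" if "m \<ge> K" "n \<ge> K" for m n
    proof -
      have "(\<integral>x. norm (r m x - r n x) powr q \<partial>lborel) = P (dif (r m) (r n))" by (simp add: P_def)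
      also have "\<dots> \<le> \<epsilon> * (P (r m) + P (r n)) + C * gap (r m) (r n)" by (rule C(2)[OF r r])
      also have "\<dots> \<le> \<epsilon> * (2 * M) + (C + 1) * gap (r m) (r n)"
        using PM[of m] PM[of n] \<epsilon> gap_nonneg[of "r m" "r n"] by (intro add_mono mult_left_mono mult_right_mono) auto
      also have "\<epsilon> * (2 * M) \<le> e / 2" using e M0 by (simp add: \<epsilon>_def field_simps)
      also have "(C + 1) * gap (r m) (r n) < e / 2"
      proof -
        have "gap (r m) (r n) / q \<le> (inverse (real (Suc m)) + inverse (real (Suc n))) / 2"
          using key[of m n] N_nonneg[of "dif (r m) (r n)"] by linarith
        also have "\<dots> < e / (2 * ((C + 1) * q))"
        proof -
          have "inverse (real (Suc m)) + inverse (real (Suc n)) < e / (2 * ((C + 1) * q))" using K that by blast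
          moreover have "(inverse (real (Suc m)) + inverse (real (Suc n))) / 2 \<le> inverse (real (Suc m)) + inverse (real (Suc n))"
            by simp
          ultimately show ?thesis by (rule order.strict_trans1[rotated])
        qed
        finally have gq: "gap (r m) (r n) / q < e / (2 * ((C + 1) * q))" .
        have cq: "(C + 1) * q > 0" using C(1) q by simp
        have "((C + 1) * q) * (gap (r m) (r n) / q) < ((C + 1) * q) * (e / (2 * ((C + 1) * q)))"
          by (rule mult_strict_left_mono[OF gq cq])
        moreover have "((C + 1) * q) * (e / (2 * ((C + 1) * q))) = e / 2" using q0 C(1) by simp
        moreover have "((C + 1) * q) * (gap (r m) (r n) / q) = (C + 1) * gap (r m) (r n)" using q0 by simp
        ultimately show ?thesis by (simp only:)
      qed
      finally show ?thesis by simp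
    qed
    then show ?thesis by blast
  qed
  have fm: "\<And>k. r k \<in> borel_measurable lborel" using H_meas rH by simp
  have fi: "\<And>k. integrable lborel (\<lambda>x. norm (r k x) powr q)" using H_int rH by simp
  obtain \<rho> s where \<rho>m: "\<rho> \<in> borel_measurable lborel" and \<rho>i: "integrable lborel (\<lambda>x. norm (\<rho> x) powr q)" and s: "strict_mono s"
    and sl: "AE x in lborel. (\<lambda>k. r (s k) x) \<longlonglongrightarrow> \<rho> x" and lim: "(\<lambda>n. \<integral>x. norm (r n x - \<rho> x) powr q \<partial>lborel) \<longlonglongrightarrow> 0"
    by (rule Lp_complete[OF q0 fm fi Cq])
  obtain h where h: "h \<in> L2" "(\<lambda>k. ip (\<lambda>x. ht \<alpha> (r k) x - h x) (\<lambda>x. ht \<alpha> (r k) x - h x)) \<longlonglongrightarrow> 0"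
    by (rule L2_complete[OF HD(3)[OF rH] C2])
  have \<rho>L: "\<rho> \<in> Lp q" using \<rho>m \<rho>i by (simp add: Lp_def)
  have lim': "(\<lambda>k. \<integral>x. \<bar>r k x - \<rho> x\<bar> powr q \<partial>lborel) \<longlonglongrightarrow> 0" using lim by simp
  note cl = H_alpha_closed[OF alpha q rH \<rho>L lim' h]
  have pos: "AE x in lborel. 0 \<le> \<rho> x"
  proof -
    have "AE x in lborel. \<forall>k. 0 \<le> r k x" using HpD(2)[OF r] by (simp add: AE_all_countable)
    with sl show ?thesis
    proof eventually_elim
      case (elim x)
      then show ?case by (intro LIMSEQ_le_const[of "\<lambda>k. r (s k) x"]) auto
    qed
  qed
  have \<rho>: "\<rho> \<in> Hp" using cl(1) pos by (simp add: H_alpha_pos_def)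
  have hth: "ip (ht \<alpha> \<rho>) v = ip h v" if "v \<in> L2" for v
    using cl(2) HD(3)[OF cl(1)] h(1) that by (intro ip_cong) (auto simp: L2_def)
  have Nlim: "(\<lambda>k. N (r k) (r k)) \<longlonglongrightarrow> N \<rho> \<rho>"
  proof -
    have "N \<rho> \<rho> = ip h (ht \<alpha> \<rho>)" unfolding N_def by (rule hth[OF HD(3)[OF cl(1)]])
    also have "\<dots> = ip h h" using hth[OF h(1)] by (simp add: ip_commute)
    finally have "N \<rho> \<rho> = ip h h" .
    then show ?thesis using ip_self_tendsto[OF HD(3)[OF rH] h] by (simp add: N_def)
  qed
  have "(\<lambda>k. \<integral>x. r k x *\<^sub>R V2 x \<partial>lborel) \<longlonglongrightarrow> (\<integral>x. \<rho> x *\<^sub>R V2 x \<partial>lborel)"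
    by (rule Lp_pairing_tendsto(1)[OF q HD(1)[OF rH] \<rho>L lim' V2D(1)]) (use V2D(2) in simp)
  then have linlim: "(\<lambda>k. lin (r k)) \<longlonglongrightarrow> lin \<rho>"
    unfolding lin_def hth[OF G(1)] by (intro tendsto_add ip_tendsto[OF HD(3)[OF rH] h(1) G(1) h(2)]) simp
  \<comment> \<open>Energies, linear parts and dual norms converge, so the power terms must converge
    to \<open>p\<close>. Fatou along the pointwise convergent subsequence gives
    \<open>P \<rho> \<le> p\<close>, which is the direction a minimizer requires.\<close>
  define p where "p = q * (I + lin \<rho> - N \<rho> \<rho> / 2)"
  have Plim: "(\<lambda>k. P (r k)) \<longlonglongrightarrow> p"
  proof -
    have "(\<lambda>k. q * (E (r k) + lin (r k) - N (r k) (r k) / 2)) \<longlonglongrightarrow> p"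
      unfolding p_def by (intro tendsto_intros EI linlim Nlim) simp
    moreover have "q * (E (r k) + lin (r k) - N (r k) (r k) / 2) = P (r k)" for k
      unfolding energy_eq[OF rH] using q by simp
    ultimately show ?thesis by simp
  qed
  have p0: "p \<ge> 0" by (rule LIMSEQ_le_const[OF Plim]) (use P_nonneg in auto)
  have "ennreal (P \<rho>) \<le> ennreal p"
  proof -
    have "ennreal (P \<rho>) = (\<integral>\<^sup>+x. ennreal (\<bar>\<rho> x\<bar> powr q) \<partial>lborel)"
      unfolding P_def by (rule nn_integral_eq_integral[symmetric]) (use \<rho>i in auto)
    also have "\<dots> \<le> (\<integral>\<^sup>+x. liminf (\<lambda>k. ennreal (\<bar>r (s k) x\<bar> powr q)) \<partial>lborel)"
    proof (intro nn_integral_mono_AE, use sl in eventually_elim)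
      case (elim x)
      have "(\<lambda>k. ennreal (\<bar>r (s k) x\<bar> powr q)) \<longlonglongrightarrow> ennreal (\<bar>\<rho> x\<bar> powr q)"
        using q by (intro tendsto_ennrealI tendsto_powr' tendsto_rabs elim tendsto_const) auto
      from lim_imp_Liminf[OF _ this] show ?case by simp
    qed
    also have "\<dots> \<le> liminf (\<lambda>k. \<integral>\<^sup>+x. ennreal (\<bar>r (s k) x\<bar> powr q) \<partial>lborel)"
      using fm by (intro nn_integral_liminf) auto
    also have "\<dots> = liminf (\<lambda>k. ennreal (P (r (s k))))"
    proof -
      have "(\<integral>\<^sup>+x. ennreal (\<bar>r (s k) x\<bar> powr q) \<partial>lborel) = ennreal (P (r (s k)))" for k
        unfolding P_def by (rule nn_integral_eq_integral) (use fi[of "s k"] in auto)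
      then show ?thesis by simp
    qed
    also have "\<dots> = ennreal p"
      by (rule lim_imp_Liminf) (auto intro!: tendsto_ennrealI LIMSEQ_subseq_LIMSEQ[OF Plim s, unfolded o_def])
    finally show ?thesis .
  qed
  then have "P \<rho> \<le> p" using p0 by simp
  then have "P \<rho> / q \<le> I + lin \<rho> - N \<rho> \<rho> / 2" using q by (simp add: p_def field_simps)
  then have "E \<rho> \<le> I" unfolding energy_eq[OF cl(1)] by linarith
  then show ?thesis using \<rho> Ilow by (intro bexI[of _ \<rho>]) (auto intro: order_trans)
qed

text \<open>Equal minimal energies force the convexity defect to vanish. Then
  \<open>P_dif_bound\<close> bounds the difference by arbitrarily small multiples of a fixed number,
  whatever the constant \<open>C\<close> is.\<close>

lemma minimizer_unique:
  assumes \<rho>: "\<rho> \<in> Hp" "\<And>f. f \<in> Hp \<Longrightarrow> E \<rho> \<le> E f" and \<sigma>: "\<sigma> \<in> Hp" "\<And>f. f \<in> Hp \<Longrightarrow> E \<sigma> \<le> E f"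
  shows "AE x in lborel. \<sigma> x = \<rho> x"
proof -
  have "E \<rho> = E \<sigma>" using \<rho> \<sigma> by (meson order_antisym)
  moreover have "E \<rho> \<le> E (mid \<rho> \<sigma>)" using \<rho> mid_pos[OF \<rho>(1) \<sigma>(1)] by blast
  ultimately have "gap \<rho> \<sigma> / q + N (dif \<rho> \<sigma>) (dif \<rho> \<sigma>) / 8 \<le> 0"
    using midpoint_arith'[OF energy_mid[OF \<rho>(1) \<sigma>(1)]] by blast
  then have "gap \<rho> \<sigma> / q \<le> 0" using N_nonneg[of "dif \<rho> \<sigma>"] by linarith
  then have g: "gap \<rho> \<sigma> = 0" using gap_nonneg[of \<rho> \<sigma>] q by (simp add: divide_le_0_iff)
  have le: "P (dif \<rho> \<sigma>) \<le> e * (P \<rho> + P \<sigma>)" if "e > 0" for e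
  proof -
    obtain C where "\<And>\<rho> \<sigma>. \<rho> \<in> Hp \<Longrightarrow> \<sigma> \<in> Hp \<Longrightarrow> P (dif \<rho> \<sigma>) \<le> e * (P \<rho> + P \<sigma>) + C * gap \<rho> \<sigma>"
      using P_dif_bound[OF \<open>e > 0\<close>] by metis
    from this[OF \<rho>(1) \<sigma>(1)] show ?thesis by (simp add: g)
  qed
  have "P (dif \<rho> \<sigma>) \<le> 0"
  proof (rule ccontr)
    assume "\<not> ?thesis"
    then have a: "P (dif \<rho> \<sigma>) > 0" by simp
    define S where "S = P \<rho> + P \<sigma>"
    have S: "S \<ge> 0" unfolding S_def using P_nonneg[of \<rho>] P_nonneg[of \<sigma>] by simp
    \<comment> \<open>The multiple is P (dif \<rho> \<sigma>) / (2 (S + 1)): positive, and small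
      enough to contradict itself.\<close>
    have "P (dif \<rho> \<sigma>) \<le> (P (dif \<rho> \<sigma>) / (2 * (S + 1))) * S"
      using le[of "P (dif \<rho> \<sigma>) / (2 * (S + 1))"] a S unfolding S_def[symmetric] by simp
    also have "\<dots> < P (dif \<rho> \<sigma>)"
    proof -
      have "P (dif \<rho> \<sigma>) * S < P (dif \<rho> \<sigma>) * (2 * (S + 1))" using a S by (intro mult_strict_left_mono) auto
      then show ?thesis using S by (simp add: pos_divide_less_eq)
    qed
    finally show False by simp
  qed
  then have "P (dif \<rho> \<sigma>) = 0" using P_nonneg[of "dif \<rho> \<sigma>"] by linarith
  then have "AE x in lborel. \<bar>dif \<rho> \<sigma> x\<bar> powr q = 0"
    unfolding P_def using integral_nonneg_eq_0_iff_AE[OF H_int[OF lincomb[OF HpD(1)[OF \<rho>(1)] HpD(1)[OF \<sigma>(1)]]], of 1 "-1"] by simp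
  then show ?thesis by eventually_elim simp
qed

end

subsection \<open>The Euler--Lagrange conditions\<close>

lemma AE_zero_of_nonpos_integral_nonneg:
  fixes g :: "'a \<Rightarrow> real"
  assumes g: "integrable M g" and "AE x in M. g x \<le> 0" and "0 \<le> (\<integral>x. g x \<partial>M)"
  shows "AE x in M. g x = 0"
proof -
  have "AE x in M. 0 \<le> - g x" using assms(2) by eventually_elim simp
  moreover from this have "0 \<le> (\<integral>x. - g x \<partial>M)" by (rule integral_nonneg_AE)
  ultimately have "AE x in M. - g x = 0"
    using integral_nonneg_eq_0_iff_AE[of M "\<lambda>x. - g x"] g assms(3) by simp
  then show ?thesis by eventually_elim simp
qed

context min_problem
begin

text \<open>Convexity of \<open>|\<cdot>|\<^sup>q\<close> bounds the difference quotient from above by the derivative at the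
  displaced point, so only dominated convergence of that derivative is needed.\<close>

lemma variational_inequality:
  assumes \<rho>: "\<rho> \<in> Hp" "\<And>f. f \<in> Hp \<Longrightarrow> E \<rho> \<le> E f" and h: "h \<in> H" and \<rho>h: "(\<lambda>x. \<rho> x + h x) \<in> Hp"
  shows "integrable lborel (\<lambda>x. \<bar>\<rho> x\<bar> powr (q - 1) * h x)"
    and "0 \<le> (\<integral>x. \<bar>\<rho> x\<bar> powr (q - 1) * h x \<partial>lborel) - lin h + N \<rho> h"
proof -
  note \<rho>H = HpD(1)[OF \<rho>(1)]
  have [measurable]: "\<rho> \<in> borel_measurable borel" "h \<in> borel_measurable borel"
    using H_meas \<rho>H h by auto
  define D where "D = (\<lambda>x. (\<bar>\<rho> x\<bar> + \<bar>h x\<bar>) powr q)"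
  have Di: "integrable lborel D"
  proof -
    have "integrable lborel (\<lambda>x. norm (\<bar>\<rho> x\<bar> + \<bar>h x\<bar>) powr q)"
      using q H_int[OF \<rho>H] H_int[OF h] by (intro integrable_powr_add) auto
    then show ?thesis by (simp add: D_def)
  qed
  \<comment> \<open>|h| and |u| are both at most |\<rho>| + |h|, so the product of |u|^(q-1) and |h|
    is at most the q-th power of that sum: one majorant for \<rho> and all displaced
    densities.\<close>
  have dom: "\<bar>\<bar>u\<bar> powr (q - 1) * h x\<bar> \<le> D x" if "\<bar>u\<bar> \<le> \<bar>\<rho> x\<bar> + \<bar>h x\<bar>" for u x
  proof -
    have "\<bar>h x\<bar> * \<bar>u\<bar> powr (q - 1) \<le> (\<bar>\<rho> x\<bar> + \<bar>h x\<bar>) * (\<bar>\<rho> x\<bar> + \<bar>h x\<bar>) powr (q - 1)"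
      using that q by (intro mult_mono powr_mono2) auto
    also have "\<dots> = D x" using powr_mult_base[of "\<bar>\<rho> x\<bar> + \<bar>h x\<bar>" "q - 1"] by (simp add: D_def)
    finally show ?thesis by (simp add: abs_mult mult.commute)
  qed
  have int: "integrable lborel (\<lambda>x. \<bar>u x\<bar> powr (q - 1) * h x)"
    if [measurable]: "u \<in> borel_measurable borel" and "\<And>x. \<bar>u x\<bar> \<le> \<bar>\<rho> x\<bar> + \<bar>h x\<bar>" for u
  proof (rule Bochner_Integration.integrable_bound[OF Di])
    show "AE x in lborel. norm (\<bar>u x\<bar> powr (q - 1) * h x) \<le> norm (D x)"
      using dom[OF that(2)] by (intro AE_I2) (auto intro: order_trans[OF _ abs_ge_self])
  qed measurable
  show int0: "integrable lborel (\<lambda>x. \<bar>\<rho> x\<bar> powr (q - 1) * h x)" by (rule int) auto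
  let ?t = scale_seq
  define r where "r = (\<lambda>k x. 1 * \<rho> x + ?t k * h x)"
  have rH: "r k \<in> H" for k unfolding r_def by (rule lincomb[OF \<rho>H h])
  have rm[measurable]: "r k \<in> borel_measurable borel" for k by (rule H_meas[OF rH])
  have rp: "AE x in lborel. 0 \<le> r k x" for k
    using HpD(2)[OF \<rho>(1)] HpD(2)[OF \<rho>h]
  proof eventually_elim
    case (elim x)
    have "0 \<le> (1 - ?t k) * \<rho> x"
      by (rule mult_nonneg_nonneg) (use elim scale_seq_le1[of k] in auto)
    moreover have "0 \<le> ?t k * (\<rho> x + h x)"
      by (rule mult_nonneg_nonneg) (use elim scale_seq_pos[of k] in auto)
    ultimately have "0 \<le> (1 - ?t k) * \<rho> x + ?t k * (\<rho> x + h x)" by (rule add_nonneg_nonneg)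
    then show ?case by (simp add: r_def algebra_simps)
  qed
  have rHp: "r k \<in> Hp" for k using rH rp by (simp add: H_alpha_pos_def)
  have rb: "\<bar>r k x\<bar> \<le> \<bar>\<rho> x\<bar> + \<bar>h x\<bar>" for k x
  proof -
    have "\<bar>?t k * h x\<bar> \<le> \<bar>h x\<bar>"
      using scale_seq_pos[of k] scale_seq_le1[of k] by (simp add: abs_mult mult_left_le_one_le)
    then show ?thesis unfolding r_def by linarith
  qed
  define A where "A = (\<lambda>k. \<integral>x. \<bar>r k x\<bar> powr (q - 1) * h x \<partial>lborel)"
  have Ai: "integrable lborel (\<lambda>x. \<bar>r k x\<bar> powr (q - 1) * h x)" for k by (rule int[OF rm rb])
  have Pr: "P (r k) - P \<rho> \<le> q * ?t k * A k" for k
  proof -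
    have "P (r k) - P \<rho> = (\<integral>x. \<bar>r k x\<bar> powr q - \<bar>\<rho> x\<bar> powr q \<partial>lborel)"
      using H_int[OF rH[of k]] H_int[OF \<rho>H] by (simp add: P_def)
    also have "\<dots> \<le> (\<integral>x. q * ?t k * (\<bar>r k x\<bar> powr (q - 1) * h x) \<partial>lborel)"
    proof (rule integral_mono_AE)
      show "AE x in lborel. \<bar>r k x\<bar> powr q - \<bar>\<rho> x\<bar> powr q \<le> q * ?t k * (\<bar>r k x\<bar> powr (q - 1) * h x)"
        using HpD(2)[OF \<rho>(1)] rp[of k]
      proof eventually_elim
        case (elim x)
        have "\<bar>r k x\<bar> powr q - \<bar>\<rho> x\<bar> powr q \<le> q * \<bar>r k x\<bar> powr (q - 1) * (\<bar>r k x\<bar> - \<bar>\<rho> x\<bar>)"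
          by (rule powr_tangent[OF q]) auto
        also have "\<bar>r k x\<bar> - \<bar>\<rho> x\<bar> = ?t k * h x" using elim by (simp add: r_def)
        finally show ?case by (simp add: mult_ac)
      qed
    qed (use H_int[OF rH[of k]] H_int[OF \<rho>H] Ai[of k] in auto)
    finally show ?thesis by (simp add: A_def)
  qed
  \<comment> \<open>The energy increment divided by the step; the quadratic remainder keeps one
    factor of the step and disappears in the limit.\<close>
  have ineq: "0 \<le> A k - lin h + N \<rho> h + ?t k / 2 * N h h" for k
  proof -
    have t: "?t k > 0" by (rule scale_seq_pos)
    have "P (r k) / q - P \<rho> / q \<le> ?t k * A k"
      using Pr[of k] q by (simp add: field_simps)
    moreover have "E \<rho> \<le> E (r k)" by (rule \<rho>(2)[OF rHp])
    moreover have "lin (r k) = lin \<rho> + ?t k * lin h" unfolding r_def lin_lincomb[OF \<rho>H h] by simp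
    moreover have "N (r k) (r k) = N \<rho> \<rho> + 2 * (?t k * N \<rho> h) + 2 * (?t k * (?t k / 2 * N h h))"
      unfolding r_def N_lincomb[OF \<rho>H h] by (simp add: power2_eq_square)
    ultimately have "0 \<le> ?t k * A k - ?t k * lin h + ?t k * N \<rho> h + ?t k * (?t k / 2 * N h h)"
      unfolding energy_eq[OF \<rho>H] energy_eq[OF rH] by argo
    also have "\<dots> = ?t k * (A k - lin h + N \<rho> h + ?t k / 2 * N h h)" by (simp add: algebra_simps)
    finally show ?thesis using t by (simp add: zero_le_mult_iff)
  qed
  have Alim: "A \<longlonglongrightarrow> (\<integral>x. \<bar>\<rho> x\<bar> powr (q - 1) * h x \<partial>lborel)"
    unfolding A_def
  proof (rule integral_dominated_convergence[where w=D])
    show "AE x in lborel. (\<lambda>k. \<bar>r k x\<bar> powr (q - 1) * h x) \<longlonglongrightarrow> \<bar>\<rho> x\<bar> powr (q - 1) * h x"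
    proof (rule AE_I2)
      fix x
      have "(\<lambda>k. r k x) \<longlonglongrightarrow> 1 * \<rho> x + 0 * h x"
        unfolding r_def by (intro tendsto_intros scale_seq_lim)
      then have "(\<lambda>k. r k x) \<longlonglongrightarrow> \<rho> x" by simp
      then show "(\<lambda>k. \<bar>r k x\<bar> powr (q - 1) * h x) \<longlonglongrightarrow> \<bar>\<rho> x\<bar> powr (q - 1) * h x"
        using q by (intro tendsto_mult tendsto_powr' tendsto_rabs tendsto_const) auto
    qed
    show "AE x in lborel. norm (\<bar>r k x\<bar> powr (q - 1) * h x) \<le> D x" for k
      using dom[OF rb] by (intro AE_I2) simp
  qed (use Di in \<open>auto simp: borel_measurable_integrable\<close>)
  have "(\<lambda>k. A k - lin h + N \<rho> h + ?t k / 2 * N h h) \<longlonglongrightarrow> (\<integral>x. \<bar>\<rho> x\<bar> powr (q - 1) * h x \<partial>lborel) - lin h + N \<rho> h + 0 / 2 * N h h"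
    by (intro tendsto_intros Alim scale_seq_lim) simp
  then have "0 \<le> (\<integral>x. \<bar>\<rho> x\<bar> powr (q - 1) * h x \<partial>lborel) - lin h + N \<rho> h + 0 / 2 * N h h"
    by (rule LIMSEQ_le_const) (use ineq in auto)
  then show "0 \<le> (\<integral>x. \<bar>\<rho> x\<bar> powr (q - 1) * h x \<partial>lborel) - lin h + N \<rho> h" by simp
qed

lemma loc_integrable_ball:
  fixes f X :: "real^'n \<Rightarrow> real"
  assumes X: "integrable lborel (\<lambda>x. indicator (cball 0 R) x * X x)" and [measurable]: "X \<in> borel_measurable borel"
    "f \<in> borel_measurable borel" and f: "\<And>x. \<bar>f x\<bar> \<le> indicator (cball 0 R) x"
  shows "integrable lborel (\<lambda>x. f x * X x)"
proof (rule Bochner_Integration.integrable_bound[OF X])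
  show "AE x in lborel. norm (f x * X x) \<le> norm (indicator (cball 0 R) x * X x)"
    using f by (intro AE_I2) (auto simp: abs_mult intro!: mult_right_mono)
qed measurable

text \<open>Exponents may be lowered on a ball by |X|^s \<le> 1 + |X|^p. It is applied with exponent
  q - 1 to \<rho> and with exponent 1 to \<open>V2\<close>.\<close>

lemma integrable_ball_powr:
  fixes X :: "real^'n \<Rightarrow> real"
  assumes s: "0 \<le> s" "s \<le> p" and [measurable]: "X \<in> borel_measurable borel" and X: "integrable lborel (\<lambda>x. \<bar>X x\<bar> powr p)"
  shows "integrable lborel (\<lambda>x. indicator (cball 0 R) x * \<bar>X x\<bar> powr s)"
proof (rule Bochner_Integration.integrable_bound)
  show "integrable lborel (\<lambda>x. indicator (cball 0 R) x + \<bar>X x\<bar> powr p)"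
    using X emeasure_bounded_finite[OF bounded_cball[of "0::real^'n" R]]
    by (intro Bochner_Integration.integrable_add integrable_real_indicator) auto
  show "AE x in lborel. norm (indicator (cball 0 R) x * \<bar>X x\<bar> powr s) \<le> norm (indicator (cball 0 R) x + \<bar>X x\<bar> powr p)"
  proof (rule AE_I2)
    fix x
    have "\<bar>X x\<bar> powr s \<le> 1 + \<bar>X x\<bar> powr p"
    proof (cases "\<bar>X x\<bar> \<le> 1")
      case True
      then have "\<bar>X x\<bar> powr s \<le> 1" using s by (intro powr_le1) auto
      then show ?thesis by (simp add: add_increasing2)
    next
      case False
      then have "\<bar>X x\<bar> powr s \<le> \<bar>X x\<bar> powr p" using s by (intro powr_mono) auto
      then show ?thesis by simp
    qed
    then show "norm (indicator (cball 0 R) x * \<bar>X x\<bar> powr s) \<le> norm (indicator (cball 0 R) x + \<bar>X x\<bar> powr p)"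
      by (auto simp: indicator_def)
  qed
  have [measurable]: "cball 0 R \<in> sets (borel :: (real^'n) measure)" by simp
  show "(\<lambda>x. indicator (cball 0 R) x * \<bar>X x\<bar> powr s) \<in> borel_measurable lborel" by measurable
qed

text \<open>For bounded \<open>f\<close> of compact support every term of the first variation is an
  ordinary integral: \<open>hdot_approx_pairing\<close> handles \<open>V1\<close> and
  \<open>riesz_pot_pairing\<close> handles \<open>U\<close>. The variation is then the integral of
  \<open>f\<close> times \<open>W\<close>, and suitable signs of \<open>f\<close> give the pointwise
  statement.\<close>

lemma minimizer_pointwise:
  assumes \<rho>: "\<rho> \<in> Hp" "\<And>f. f \<in> Hp \<Longrightarrow> E \<rho> \<le> E f" and U: "riesz_pot \<alpha> \<rho> U"
  shows "AE x in lborel. \<rho> x = (max (V1 x + V2 x - U x) 0) powr (1 / (q - 1))"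
proof -
  note \<rho>H = HpD(1)[OF \<rho>(1)]
  obtain \<psi> where \<psi>: "hdot_approx \<alpha> \<psi> U" using U unfolding riesz_pot_def by blast
  have m: "\<rho> \<in> borel_measurable borel" "V1 \<in> borel_measurable borel" "V2 \<in> borel_measurable borel" "U \<in> borel_measurable borel"
    using H_meas[OF \<rho>H] psi0 V2D(1) \<psi> by (auto simp: hdot_approx_def loc_integrable_def)
  note m[measurable]
  define W where "W = (\<lambda>x. \<bar>\<rho> x\<bar> powr (q - 1) - (V1 x + V2 x - U x))"
  have Wm[measurable]: "W \<in> borel_measurable borel" unfolding W_def by measurable
  have loc: "integrable lborel (\<lambda>x. indicator (cball 0 R) x * X x)" if "hdot_approx \<alpha> \<phi> X" for R \<phi> X
    using that compact_cball[of 0 R] by (auto simp: hdot_approx_def loc_integrable_def set_integrable_def)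
  have i\<rho>: "integrable lborel (\<lambda>x. indicator (cball 0 R) x * \<bar>\<rho> x\<bar> powr (q - 1))" for R
    using q by (intro integrable_ball_powr[OF _ _ m(1) H_int[OF \<rho>H]]) auto
  have iV2: "integrable lborel (\<lambda>x. indicator (cball 0 R) x * V2 x)" for R
  proof -
    have "integrable lborel (\<lambda>x. indicator (cball 0 R) x * \<bar>V2 x\<bar> powr 1)"
      using q'(1) by (intro integrable_ball_powr[OF _ _ m(3) V2D(2)]) auto
    moreover have [measurable]: "cball 0 R \<in> sets (borel :: (real^'n) measure)" by simp
    have "(\<lambda>x. indicator (cball 0 R) x * V2 x) \<in> borel_measurable lborel" by measurable
    ultimately show ?thesis by (rule Bochner_Integration.integrable_bound) (auto simp: abs_mult)
  qed
  have main: "integrable lborel (\<lambda>x. f x * W x)" "0 \<le> (\<integral>x. f x * W x \<partial>lborel)"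
    if fm[measurable]: "f \<in> borel_measurable borel" and f: "\<And>x. \<bar>f x\<bar> \<le> indicator (cball 0 R) x"
      and pos: "AE x in lborel. 0 \<le> \<rho> x + f x" for f R
  proof -
    have f1: "\<bar>f x\<bar> \<le> 1" for x using f[of x] indicator_le_1[of "cball 0 R" x] by (rule order_trans)
    have f0: "f x = 0" if "norm x > R" for x using f[of x] that by simp
    have fH: "f \<in> H" by (rule bounded_support_H_alpha[OF alpha q fm f1 f0])
    have "(\<lambda>x. \<rho> x + f x) \<in> Hp"
      using lincomb[OF \<rho>H fH, of 1 1] pos by (simp add: H_alpha_pos_def)
    note v = variational_inequality[OF \<rho> fH this]
    note i = v(1) loc_integrable_ball[OF loc[OF psi0] m(2) fm f] loc_integrable_ball[OF iV2 m(3) fm f] loc_integrable_ball[OF loc[OF \<psi>] m(4) fm f]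
    have e: "f x * W x = \<bar>\<rho> x\<bar> powr (q - 1) * f x - f x * V1 x - f x * V2 x + f x * U x" for x
      by (simp add: W_def algebra_simps)
    show "integrable lborel (\<lambda>x. f x * W x)" unfolding e using i by auto
    have l: "lin f = (\<integral>x. f x * V1 x \<partial>lborel) + (\<integral>x. f x * V2 x \<partial>lborel)"
    proof -
      have "ip (ht \<alpha> f) G = (\<integral>x. f x * V1 x \<partial>lborel)"
        by (rule hdot_approx_pairing(2)[OF alpha q psi0 G fm f1 f0])
      then show ?thesis by (simp add: lin_def)
    qed
    have n: "N \<rho> f = (\<integral>x. f x * U x \<partial>lborel)"
      unfolding N_sym[of \<rho>] unfolding N_def by (rule riesz_pot_pairing[OF alpha q \<rho>H U fm f1 f0])
    have "(\<integral>x. f x * W x \<partial>lborel) = (\<integral>x. \<bar>\<rho> x\<bar> powr (q - 1) * f x \<partial>lborel) - lin f + N \<rho> f"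
      unfolding e using i by (simp add: l n)
    then show "0 \<le> (\<integral>x. f x * W x \<partial>lborel)" using v(2) by simp
  qed
  have W0: "AE x in lborel. indicator (cball 0 (real n)) x * indicator {x. W x < 0} x * W x = 0" for n
  proof (rule AE_zero_of_nonpos_integral_nonneg)
    let ?f = "\<lambda>x. indicator (cball 0 (real n)) x * indicator {x. W x < 0} x :: real"
    have [measurable]: "cball 0 (real n) \<in> sets (borel :: (real^'n) measure)" by simp
    have fm: "?f \<in> borel_measurable borel" by measurable
    have fb: "\<bar>?f x\<bar> \<le> indicator (cball 0 (real n)) x" for x by (auto simp: indicator_def)
    have fp: "AE x in lborel. 0 \<le> \<rho> x + ?f x" using HpD(2)[OF \<rho>(1)] by eventually_elim simp
    show "integrable lborel (\<lambda>x. ?f x * W x)" "0 \<le> (\<integral>x. ?f x * W x \<partial>lborel)" by (rule main[OF fm fb fp])+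
    show "AE x in lborel. ?f x * W x \<le> 0" by (intro AE_I2) (auto simp: indicator_def)
  qed
  have "AE x in lborel. \<forall>n. indicator (cball 0 (real n)) x * indicator {x. W x < 0} x * W x = 0"
    using W0 by (subst AE_all_countable) blast
  then have Wn: "AE x in lborel. 0 \<le> W x"
  proof eventually_elim
    case (elim x)
    obtain n :: nat where "norm x \<le> real n" using real_arch_simple by blast
    then show ?case using elim[rule_format, of n] by (cases "W x < 0") auto
  qed
  have Z: "AE x in lborel. - (indicator (cball 0 (real n)) x * min \<bar>\<rho> x\<bar> 1) * W x = 0" for n
  proof (rule AE_zero_of_nonpos_integral_nonneg)
    \<comment> \<open>Truncation at 1 makes the direction bounded although \<rho> need not be; it
      removes at most \<rho> itself, so the sum stays nonnegative, and the direction is nonzero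
      wherever \<rho> is positive in the ball.\<close>
    let ?f = "\<lambda>x. - (indicator (cball 0 (real n)) x * min \<bar>\<rho> x\<bar> 1) :: real"
    have [measurable]: "cball 0 (real n) \<in> sets (borel :: (real^'n) measure)" by simp
    have fm: "?f \<in> borel_measurable borel" by measurable
    have fb: "\<bar>?f x\<bar> \<le> indicator (cball 0 (real n)) x" for x by (auto simp: indicator_def)
    have fp: "AE x in lborel. 0 \<le> \<rho> x + ?f x" using HpD(2)[OF \<rho>(1)] by eventually_elim (auto simp: indicator_def)
    show "integrable lborel (\<lambda>x. ?f x * W x)" "0 \<le> (\<integral>x. ?f x * W x \<partial>lborel)" by (rule main[OF fm fb fp])+
    show "AE x in lborel. ?f x * W x \<le> 0"
      using Wn by eventually_elim (auto simp: indicator_def)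
  qed
  have "AE x in lborel. \<forall>n. - (indicator (cball 0 (real n)) x * min \<bar>\<rho> x\<bar> 1) * W x = 0"
    using Z by (subst AE_all_countable) blast
  with Wn HpD(2)[OF \<rho>(1)] show ?thesis
  proof eventually_elim
    case (elim x)
    obtain n :: nat where n: "norm x \<le> real n" using real_arch_simple by blast
    show ?case
    proof (cases "\<rho> x = 0")
      case True
      \<comment> \<open>Since \<open>0 powr (q - 1)\<close> is 0, \<open>W x \<ge> 0\<close> says
        that V - U is nonpositive; the positive part is 0 and so is its power.\<close>
      then have "V1 x + V2 x - U x \<le> 0" using elim(1) q by (simp add: W_def)
      then show ?thesis using True q by (simp add: max_def)
    next
      case False
      then have pos: "\<rho> x > 0" using elim by simp
      then have "W x = 0" using elim(3)[rule_format, of n] n by (auto simp: min_def split: if_splits)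
      then have e: "V1 x + V2 x - U x = \<rho> x powr (q - 1)" using pos by (simp add: W_def)
      then have "max (V1 x + V2 x - U x) 0 = \<rho> x powr (q - 1)" by simp
      then show ?thesis using pos q by (simp add: powr_powr)
    qed
  qed
qed

end

theorem mainTheorem3:
  fixes q \<alpha> :: real
    and V1 V2 :: "real^'n \<Rightarrow> real"
  assumes "CARD('n) \<ge> 2"
    and "0 < \<alpha>" and "\<alpha> < real CARD('n)"
    and "q > 2 * real CARD('n) / (real CARD('n) + \<alpha>)"
    and "V1 \<in> Hdot \<alpha>" and "V2 \<in> Lp (conj_exp q)"
  shows "\<exists>\<rho>. \<rho> \<in> H_alpha_pos q \<alpha>
      \<and> (\<forall>f \<in> H_alpha_pos q \<alpha>. energy q \<alpha> V1 V2 \<rho> \<le> energy q \<alpha> V1 V2 f)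
      \<and> (\<forall>\<sigma> \<in> H_alpha_pos q \<alpha>.
            (\<forall>f \<in> H_alpha_pos q \<alpha>. energy q \<alpha> V1 V2 \<sigma> \<le> energy q \<alpha> V1 V2 f)
            \<longrightarrow> (AE x in lborel. \<sigma> x = \<rho> x))
      \<and> (\<forall>\<phi> \<in> H_alpha_pos q \<alpha>.
            (\<integral>x. \<rho> x powr (q - 1) * \<phi> x \<partial>lborel) - pairV \<alpha> \<phi> V1 V2
              + hneg_inner \<alpha> \<rho> \<phi> \<ge> 0)
      \<and> (\<exists>U. riesz_pot \<alpha> \<rho> U)
      \<and> (\<forall>U. riesz_pot \<alpha> \<rho> U \<longrightarrow>
            (AE x in lborel. \<rho> x = (max (V1 x + V2 x - U x) 0) powr (1 / (q - 1))))"
proof -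
  \<comment> \<open>As \<alpha> < d, the denominator d + \<alpha> is below 2 d.\<close>
  have "1 < 2 * real CARD('n) / (real CARD('n) + \<alpha>)" using assms(2,3) by (simp add: field_simps)
  then have q: "q > 1" using assms(4) by linarith
  interpret min_problem q \<alpha> V1 V2 by unfold_locales (use assms q in auto)
  obtain \<rho> where \<rho>: "\<rho> \<in> Hp" "\<And>f. f \<in> Hp \<Longrightarrow> E \<rho> \<le> E f" using minimizer_exists by blast
  have "0 \<le> (\<integral>x. \<rho> x powr (q - 1) * \<phi> x \<partial>lborel) - pairV \<alpha> \<phi> V1 V2 + hneg_inner \<alpha> \<rho> \<phi>" if \<phi>: "\<phi> \<in> Hp" for \<phi>
  proof -
    note h = HpD(1)[OF \<rho>(1)] HpD(1)[OF \<phi>]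
    have "AE x in lborel. 0 \<le> \<rho> x + \<phi> x" using HpD(2)[OF \<rho>(1)] HpD(2)[OF \<phi>] by eventually_elim simp
    then have "(\<lambda>x. \<rho> x + \<phi> x) \<in> Hp"
      using lincomb[OF h, of 1 1] by (simp add: H_alpha_pos_def)
    note v = variational_inequality(2)[OF \<rho> h(2) this]
    have "(\<integral>x. \<rho> x powr (q - 1) * \<phi> x \<partial>lborel) = (\<integral>x. \<bar>\<rho> x\<bar> powr (q - 1) * \<phi> x \<partial>lborel)"
      using H_meas[OF h(1)] H_meas[OF h(2)] HpD(2)[OF \<rho>(1)]
      by (intro integral_cong_AE) (auto elim: eventually_mono)
    then show ?thesis using v by (simp add: pairV_lin h hneg_inner_N)
  qed
  then show ?thesis
    using \<rho> minimizer_unique[OF \<rho>] riesz_pot_exists[OF alpha q HpD(1)[OF \<rho>(1)]] minimizer_pointwise[OF \<rho>]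
    by (intro exI[of _ \<rho>]) auto
qed

end
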